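(* Let $n\ge 3$ and let $M\subset\mathbb{R}^{n+1}$ be a compact connected smooth embedded hypersurface with the induced Riemannian metric $g$. Suppose $M$ admits a Killing vector field $\xi$ (with respect to $g$) with $g(\xi,\xi)\equiv 1$. Then $n+1=2N$ is even, $M$ is diffeomorphic to the sphere $S^{n}$, and, after applying a rigid motion of $\mathbb{R}^{n+1}$ and a linear isometric identification $\mathbb{R}^{n+1}\cong\mathbb{C}^N$, $M$ is the complex ellipsoid $$\{(z_1,\dots,z_N)\in\mathbb{C}^N:\ |\omega_1 z_1|^2+|\omega_2 z_2|^2+\cdots+|\omega_N z_N|^2=1\}$$ for some nonzero real numbers $\omega_1,\dots,\omega_N$, and $\xi$ is the restriction to $M$ of the vector field $(z_1,\dots,z_N)\mapsto(i\omega_1 z_1,\dots,i\omega_N z_N)$. Moreover, if $A$ denotes the shape operator of $M$ with respect to a unit normal field and the function $g(A\xi,\xi)$ is constant on $M$, then $\omega_1^2=\omega_2^2=\cdots=\omega_N^2$, so $M$ is a round hypersphere (of constant curvature) $|z_1|^2+\cdots+|z_N|^2=1/\omega_1^2$.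
   Context: The shape operator $A$ of a hypersurface with unit normal field $\nu$ is $A(X)=-D_X\nu$, where $D$ is the Euclidean derivative. A Killing vector field of a Riemannian manifold is a vector field whose flow consists of isometries. *)

theory Defs
  imports "HOL-Analysis.Analysis"
begin

text \<open>C^k on a set (intended: an open set), via directional derivatives.\<close>
fun Ck :: "nat \<Rightarrow> 'a::real_normed_vector set \<Rightarrow> ('a \<Rightarrow> 'b::real_normed_vector) \<Rightarrow> bool" where
  "Ck 0 S f = continuous_on S f"
| "Ck (Suc k) S f =
     (continuous_on S f \<and>
      (\<exists>f'. (\<forall>x\<in>S. (f has_derivative f' x) (at x)) \<and> (\<forall>v. Ck k S (\<lambda>x. f' x v))))"

definition smooth_on :: "'a::real_normed_vector set \<Rightarrow> ('a \<Rightarrow> 'b::real_normed_vector) \<Rightarrow> bool" where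
  "smooth_on S f \<longleftrightarrow> open S \<and> (\<forall>k. Ck k S f)"

definition smooth_map_on :: "'a::real_normed_vector set \<Rightarrow> ('a \<Rightarrow> 'b::real_normed_vector) \<Rightarrow> bool" where
  "smooth_map_on A f \<longleftrightarrow>
     (\<forall>x\<in>A. \<exists>U g. open U \<and> x \<in> U \<and> smooth_on U g \<and> (\<forall>y\<in>A \<inter> U. g y = f y))"

definition diffeomorphic :: "'a::real_normed_vector set \<Rightarrow> 'b::real_normed_vector set \<Rightarrow> bool" where
  "diffeomorphic A B \<longleftrightarrow>
     (\<exists>f g. smooth_map_on A f \<and> smooth_map_on B g \<and> f ` A \<subseteq> B \<and> g ` B \<subseteq> A \<and>
            (\<forall>x\<in>A. g (f x) = x) \<and> (\<forall>y\<in>B. f (g y) = y))"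

definition smooth_hypersurface :: "'a::euclidean_space set \<Rightarrow> bool" where
  "smooth_hypersurface M \<longleftrightarrow>
     (\<forall>p\<in>M. \<exists>U F. open U \<and> p \<in> U \<and> smooth_on U (F :: 'a \<Rightarrow> real) \<and>
        M \<inter> U = {x\<in>U. F x = 0} \<and>
        (\<forall>x\<in>M \<inter> U. \<exists>D. (F has_derivative D) (at x) \<and> D \<noteq> (\<lambda>_. 0)))"

definition curve_through :: "'a::euclidean_space set \<Rightarrow> 'a \<Rightarrow> 'a \<Rightarrow> (real \<Rightarrow> 'a) \<Rightarrow> bool" where
  "curve_through M p v \<gamma> \<longleftrightarrow>
     (\<exists>e>0. smooth_on {-e<..<e} \<gamma> \<and> (\<forall>t\<in>{-e<..<e}. \<gamma> t \<in> M)) \<and>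
     \<gamma> 0 = p \<and> (\<gamma> has_vector_derivative v) (at 0)"

definition tangent_space :: "'a::euclidean_space set \<Rightarrow> 'a \<Rightarrow> 'a set" where
  "tangent_space M p = {v. \<exists>\<gamma>. curve_through M p v \<gamma>}"

definition riemannian_isometry :: "'a::euclidean_space set \<Rightarrow> ('a \<Rightarrow> 'a) \<Rightarrow> bool" where
  "riemannian_isometry M f \<longleftrightarrow>
     smooth_map_on M f \<and> bij_betw f M M \<and> smooth_map_on M (inv_into M f) \<and>
     (\<forall>p\<in>M. \<exists>U g g'. open U \<and> p \<in> U \<and> smooth_on U g \<and> (\<forall>y\<in>M \<inter> U. g y = f y) \<and>
        (g has_derivative g') (at p) \<and>
        (\<forall>u\<in>tangent_space M p. \<forall>w\<in>tangent_space M p. g' u \<bullet> g' w = u \<bullet> w))"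

definition killing_field :: "'a::euclidean_space set \<Rightarrow> ('a \<Rightarrow> 'a) \<Rightarrow> bool" where
  "killing_field M \<xi> \<longleftrightarrow>
     smooth_map_on M \<xi> \<and> (\<forall>p\<in>M. \<xi> p \<in> tangent_space M p) \<and>
     (\<exists>\<phi>::real \<Rightarrow> 'a \<Rightarrow> 'a.
        (\<forall>p\<in>M. \<phi> 0 p = p \<and>
           (\<forall>t. \<phi> t p \<in> M \<and> ((\<lambda>s. \<phi> s p) has_vector_derivative \<xi> (\<phi> t p)) (at t))) \<and>
        (\<forall>t. riemannian_isometry M (\<phi> t)))"

definition unit_normal_field :: "'a::euclidean_space set \<Rightarrow> ('a \<Rightarrow> 'a) \<Rightarrow> bool" where
  "unit_normal_field M \<nu> \<longleftrightarrow>
     smooth_map_on M \<nu> \<and>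
     (\<forall>p\<in>M. norm (\<nu> p) = 1 \<and> (\<forall>v\<in>tangent_space M p. \<nu> p \<bullet> v = 0))"

definition shape_operator :: "'a::euclidean_space set \<Rightarrow> ('a \<Rightarrow> 'a) \<Rightarrow> 'a \<Rightarrow> 'a \<Rightarrow> 'a" where
  "shape_operator M \<nu> p X =
     - (THE w. \<forall>\<gamma>. curve_through M p X \<gamma> \<longrightarrow> ((\<nu> \<circ> \<gamma>) has_vector_derivative w) (at 0))"

end

theory Submission
  imports Defs
begin

text \<open>
  In a local chart \<open>X\<close> with normal direction \<open>N\<close>, write \<open>\<Xi> = \<xi> \<circ> X\<close> and denote directional
  derivatives by subscripts. The Killing equation \<open>\<Xi>\<^sub>a \<bullet> X\<^sub>b + \<Xi>\<^sub>b \<bullet> X\<^sub>a = 0\<close> says that \<open>\<Xi>\<^sub>a = B X\<^sub>a\<close> for a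
  skew operator \<open>B\<close> of the ambient space. Differentiating once gives \<open>\<Xi>\<^sub>a\<^sub>c = B X\<^sub>a\<^sub>c + \<beta>\<^sub>a\<^sub>c N\<close> with
  \<open>\<beta>\<close> symmetric, and differentiating again gives the linearized Gauss equation
  \<open>\<beta>\<^sub>a\<^sub>c h\<^sub>b\<^sub>d + \<beta>\<^sub>b\<^sub>d h\<^sub>a\<^sub>c = \<beta>\<^sub>a\<^sub>d h\<^sub>b\<^sub>c + \<beta>\<^sub>b\<^sub>c h\<^sub>a\<^sub>d\<close>, \<open>h\<close> being the second fundamental form. If \<open>h\<close> is
  nondegenerate and \<open>n \<ge> 3\<close>, this forces \<open>\<beta> = 0\<close>, and then \<open>B\<close> is locally constant. Since \<open>\<xi>\<close> has
  unit length, the form \<open>\<Xi>\<^sub>a \<bullet> \<Xi>\<^sub>b\<close> is a multiple of \<open>h\<^sub>a\<^sub>b\<close>, so \<open>h\<close> is nondegenerate wherever \<open>B\<close> is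
  injective; \<open>B\<close> is injective at a point farthest from the origin. As an injective \<open>B\<close> that is
  locally constant stays injective in the limit, connectedness gives \<open>\<xi> x = B (x - c)\<close> on all of \<open>M\<close>.
  Hence \<open>M\<close> lies on the ellipsoid \<open>norm (B (x - c)) = 1\<close>, and it is all of it: a point \<open>q\<close> of the
  ellipsoid and the point \<open>p\<close> of \<open>M\<close> maximizing \<open>B (p - c) \<bullet> B (q - c)\<close> satisfy \<open>q - c = \<plusminus> (p - c)\<close>.
  The normal form of the skew operator \<open>B\<close> yields the frequencies, and \<open>g(A\<xi>, \<xi>)\<close> equals
  \<open>norm (B (B (x - c)))\<close> up to sign, whose values on the axes are \<open>\<bar>\<omega>\<^sub>k\<bar>\<close>.
\<close>

subsection \<open>Directional derivatives of smooth maps\<close>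

text \<open>The direction precedes the point, so that \<open>dir_deriv f a\<close> is again a map on
  the same space and higher derivatives are iterates. The value is meaningful only where
  \<open>f\<close> is differentiable.\<close>

definition dir_deriv :: "('a::real_normed_vector \<Rightarrow> 'b::real_normed_vector) \<Rightarrow> 'a \<Rightarrow> 'a \<Rightarrow> 'b" where
  "dir_deriv f a x = frechet_derivative f (at x) a"

lemma has_derivative_dir_deriv:
  assumes "f differentiable (at x)"
  shows "(f has_derivative (\<lambda>a. dir_deriv f a x)) (at x)"
  using assms unfolding dir_deriv_def frechet_derivative_works by simp

lemma dir_deriv_eq:
  assumes "(f has_derivative f') (at x)"
  shows "dir_deriv f a x = f' a"
  using frechet_derivative_at[OF assms] by (simp add: dir_deriv_def)

section \<open>Closure properties of maps of class C^k\<close>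

lemma Ck_cong:
  assumes "open S" "\<And>x. x \<in> S \<Longrightarrow> f x = g x" "Ck k S f"
  shows "Ck k S g"
proof (cases k)
  case 0
  then show ?thesis using assms continuous_on_cong by (metis Ck.simps(1))
next
  case (Suc m)
  then obtain f' where f': "\<forall>x\<in>S. (f has_derivative f' x) (at x)" "\<forall>v. Ck m S (\<lambda>x. f' x v)"
    and c: "continuous_on S f"
    using assms(3) by auto
  have "continuous_on S g" using c assms(2) continuous_on_cong by metis
  moreover have "\<forall>x\<in>S. (g has_derivative f' x) (at x)"
    using f'(1) assms(1,2) has_derivative_transform_within_open by blast
  ultimately show ?thesis using f'(2) Suc by auto
qed

text \<open>Derivatives on an open set are unique, so the existentially quantified derivative in
  \<open>Ck\<close> can be taken to be \<open>dir_deriv\<close>; smoothness then passes to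
  directional derivatives.\<close>

lemma Ck_Suc_iff:
  assumes "open S"
  shows "Ck (Suc k) S f \<longleftrightarrow> (\<forall>x\<in>S. f differentiable (at x)) \<and> (\<forall>v. Ck k S (dir_deriv f v))"
proof
  assume "Ck (Suc k) S f"
  then obtain f' where f': "\<forall>x\<in>S. (f has_derivative f' x) (at x)" "\<forall>v. Ck k S (\<lambda>x. f' x v)"
    by auto
  have "Ck k S (dir_deriv f v)" for v
    using Ck_cong[OF assms _ f'(2)[rule_format, of v], of "dir_deriv f v"] f'(1) dir_deriv_eq by metis
  then show "(\<forall>x\<in>S. f differentiable (at x)) \<and> (\<forall>v. Ck k S (dir_deriv f v))"
    using f'(1) differentiable_def by blast
next
  assume r: "(\<forall>x\<in>S. f differentiable (at x)) \<and> (\<forall>v. Ck k S (dir_deriv f v))"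
  then have "continuous_on S f"
    by (simp add: continuous_at_imp_continuous_on differentiable_imp_continuous_within)
  with r show "Ck (Suc k) S f"
    using has_derivative_dir_deriv by (auto intro!: exI[of _ "\<lambda>x a. dir_deriv f a x"])
qed

lemma Ck_SucI:
  assumes "open S" "\<And>x. x \<in> S \<Longrightarrow> (f has_derivative f' x) (at x)" "\<And>v. Ck k S (\<lambda>x. f' x v)"
  shows "Ck (Suc k) S f"
proof -
  have "continuous_on S f"
    using assms(2) by (meson continuous_at_imp_continuous_on has_derivative_continuous)
  then show ?thesis using assms by auto
qed

lemma Ck_lower: "Ck (Suc k) S f \<Longrightarrow> Ck k S f"
proof (induction k arbitrary: f)
  case (Suc k)
  then show ?case by (metis Ck.simps(2))
qed simp

lemma Ck_subset: "Ck k S f \<Longrightarrow> T \<subseteq> S \<Longrightarrow> Ck k T f"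
proof (induction k arbitrary: f)
  case (Suc k)
  then obtain f' where "\<forall>x\<in>S. (f has_derivative f' x) (at x)" "\<forall>v. Ck k S (\<lambda>x. f' x v)"
    by auto
  then have "\<forall>x\<in>T. (f has_derivative f' x) (at x)" "\<forall>v. Ck k T (\<lambda>x. f' x v)"
    using Suc by auto
  then show ?case using Suc.prems continuous_on_subset by auto
qed (auto intro: continuous_on_subset)

lemma Ck_const: "Ck k S (\<lambda>x. c)"
proof (induction k arbitrary: c)
  case (Suc k)
  then show ?case by (auto intro!: exI[of _ "\<lambda>_ _. 0"])
qed simp

lemma Ck_bounded_linear:
  assumes "bounded_linear L" "Ck k S f"
  shows "Ck k S (\<lambda>x. L (f x))"
  using assms(2)
proof (induction k arbitrary: f)
  case 0
  then show ?case using bounded_linear.continuous_on[OF assms(1)] by auto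
next
  case (Suc k)
  then obtain f' where f': "\<forall>x\<in>S. (f has_derivative f' x) (at x)" "\<forall>v. Ck k S (\<lambda>x. f' x v)"
    and c: "continuous_on S f" by auto
  have "\<forall>x\<in>S. ((\<lambda>x. L (f x)) has_derivative (\<lambda>v. L (f' x v))) (at x)"
    using f'(1) bounded_linear.has_derivative[OF assms(1)] by blast
  moreover have "\<forall>v. Ck k S (\<lambda>x. L (f' x v))" using Suc.IH f'(2) by blast
  moreover have "continuous_on S (\<lambda>x. L (f x))" using bounded_linear.continuous_on[OF assms(1) c] .
  ultimately show ?case by (auto intro!: exI[of _ "\<lambda>x v. L (f' x v)"])
qed

lemma Ck_ident: "Ck k S (\<lambda>x. x)"
proof (cases k)
  case (Suc m)
  then show ?thesis using Ck_const by (auto intro!: exI[of _ "\<lambda>_ v. v"])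
qed simp

lemma Ck_add:
  assumes "Ck k S f" "Ck k S g"
  shows "Ck k S (\<lambda>x. f x + g x)"
  using assms
proof (induction k arbitrary: f g)
  case 0
  then show ?case by (auto intro: continuous_intros)
next
  case (Suc k)
  obtain f' where f': "\<forall>x\<in>S. (f has_derivative f' x) (at x)" "\<forall>v. Ck k S (\<lambda>x. f' x v)"
    and c: "continuous_on S f" using Suc by auto
  obtain g' where g': "\<forall>x\<in>S. (g has_derivative g' x) (at x)" "\<forall>v. Ck k S (\<lambda>x. g' x v)"
    and d: "continuous_on S g" using Suc by auto
  have "\<forall>x\<in>S. ((\<lambda>x. f x + g x) has_derivative (\<lambda>v. f' x v + g' x v)) (at x)"
    using f'(1) g'(1) has_derivative_add by blast
  moreover have "\<forall>v. Ck k S (\<lambda>x. f' x v + g' x v)" using Suc.IH f'(2) g'(2) by blast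
  moreover have "continuous_on S (\<lambda>x. f x + g x)" using c d by (intro continuous_intros)
  ultimately show ?case by (auto intro!: exI[of _ "\<lambda>x v. f' x v + g' x v"])
qed

lemma Ck_sum:
  assumes "\<And>i. i \<in> I \<Longrightarrow> Ck k S (f i)"
  shows "Ck k S (\<lambda>x. \<Sum>i\<in>I. f i x)"
  using assms
proof (induction I rule: infinite_finite_induct)
  case (insert i I)
  then show ?case using Ck_add[of k S "f i" "\<lambda>x. \<Sum>i\<in>I. f i x"] by simp
qed (auto simp: Ck_const)

lemma Ck_bilinear:
  assumes "bounded_bilinear m" "Ck k S f" "Ck k S g"
  shows "Ck k S (\<lambda>x. m (f x) (g x))"
  using assms(2,3)
proof (induction k arbitrary: f g)
  case 0
  then show ?case using bounded_bilinear.continuous_on[OF assms(1)] by auto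
next
  case (Suc k)
  obtain f' where f': "\<forall>x\<in>S. (f has_derivative f' x) (at x)" "\<forall>v. Ck k S (\<lambda>x. f' x v)"
    and c: "continuous_on S f" using Suc by auto
  obtain g' where g': "\<forall>x\<in>S. (g has_derivative g' x) (at x)" "\<forall>v. Ck k S (\<lambda>x. g' x v)"
    and d: "continuous_on S g" using Suc by auto
  have "\<forall>x\<in>S. ((\<lambda>x. m (f x) (g x)) has_derivative (\<lambda>v. m (f x) (g' x v) + m (f' x v) (g x))) (at x)"
    using f'(1) g'(1) bounded_bilinear.FDERIV[OF assms(1)] by blast
  \<comment> \<open>The product rule keeps one factor undifferentiated, hence the drop from order
    \<open>Suc k\<close> to order \<open>k\<close> for \<open>f\<close> and
    \<open>g\<close>.\<close>
  moreover have "\<forall>v. Ck k S (\<lambda>x. m (f x) (g' x v) + m (f' x v) (g x))"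
    using Suc.IH f'(2) g'(2) Ck_lower[OF Suc.prems(1)] Ck_lower[OF Suc.prems(2)] by (simp add: Ck_add)
  moreover have "continuous_on S (\<lambda>x. m (f x) (g x))"
    using bounded_bilinear.continuous_on[OF assms(1) c d] .
  ultimately show ?case by (auto intro!: exI[of _ "\<lambda>x v. m (f x) (g' x v) + m (f' x v) (g x)"])
qed

text \<open>The derivative of \<open>1/f\<close> is built from \<open>f'\<close> and two copies of
  \<open>1/f\<close>, so the induction feeds on the order of \<open>1/f\<close> already
  reached.\<close>

lemma Ck_inverse:
  fixes f :: "'a::real_normed_vector \<Rightarrow> real"
  assumes "open S" "Ck k S f" "\<And>x. x \<in> S \<Longrightarrow> f x \<noteq> 0"
  shows "Ck k S (\<lambda>x. inverse (f x))"
  using assms(2)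
proof (induction k)
  case 0
  then show ?case using assms(3) by (auto intro!: continuous_intros)
next
  case (Suc k)
  obtain f' where f': "\<forall>x\<in>S. (f has_derivative f' x) (at x)" "\<forall>v. Ck k S (\<lambda>x. f' x v)"
    using Suc by auto
  have inv: "Ck k S (\<lambda>x. inverse (f x))" using Suc Ck_lower by blast
  show ?case
  proof (rule Ck_SucI[OF assms(1)])
    show "((\<lambda>x. inverse (f x)) has_derivative (\<lambda>h. (-1) *\<^sub>R (inverse (f x) * f' x h * inverse (f x)))) (at x)"
      if "x \<in> S" for x
      using Deriv.has_derivative_inverse[of f x "f' x" UNIV] assms(3) f'(1) that by auto
    show "Ck k S (\<lambda>x. (-1) *\<^sub>R (inverse (f x) * f' x v * inverse (f x)))" for v
      by (intro Ck_bounded_linear[OF bounded_linear_scaleR_right]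
          Ck_bilinear[OF bounded_bilinear_mult] inv f'(2)[rule_format])
  qed
qed

text \<open>In the chain rule \<open>f' (g x) (g' x v)\<close> the direction depends on
  \<open>x\<close>, while \<open>Ck\<close> controls \<open>f'\<close> only for fixed directions.
  Expanding \<open>g' x v\<close> over \<open>Basis\<close> leaves finitely many fixed directions,
  to which the induction hypothesis applies.\<close>

lemma Ck_compose:
  fixes f :: "'b::euclidean_space \<Rightarrow> 'c::real_normed_vector"
  assumes "open S" "open T" "Ck k T f" "Ck k S g" "g ` S \<subseteq> T"
  shows "Ck k S (\<lambda>x. f (g x))"
  using assms(3,4)
proof (induction k arbitrary: f)
  case 0
  then show ?case using assms(5) by (auto intro: continuous_on_compose2)
next
  case (Suc k)
  obtain f' where f': "\<forall>x\<in>T. (f has_derivative f' x) (at x)" "\<forall>v. Ck k T (\<lambda>x. f' x v)"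
    using Suc by auto
  obtain g' where g': "\<forall>x\<in>S. (g has_derivative g' x) (at x)" "\<forall>v. Ck k S (\<lambda>x. g' x v)"
    using Suc by auto
  have gk: "Ck k S g" using Suc Ck_lower by blast
  show ?case
  proof (rule Ck_SucI[OF assms(1)])
    show "((\<lambda>x. f (g x)) has_derivative (\<lambda>v. \<Sum>b\<in>Basis. (g' x v \<bullet> b) *\<^sub>R f' (g x) b)) (at x)"
      if "x \<in> S" for x
    proof -
      have lin: "linear (f' (g x))" using f'(1) assms(5) that has_derivative_linear by blast
      have "f' (g x) (g' x v) = (\<Sum>b\<in>Basis. (g' x v \<bullet> b) *\<^sub>R f' (g x) b)" for v
      proof -
        have "f' (g x) (g' x v) = f' (g x) (\<Sum>b\<in>Basis. (g' x v \<bullet> b) *\<^sub>R b)"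
          by (simp add: euclidean_representation)
        then show ?thesis by (simp add: linear_sum[OF lin] linear_cmul[OF lin])
      qed
      moreover have "((\<lambda>x. f (g x)) has_derivative (\<lambda>v. f' (g x) (g' x v))) (at x)"
        using diff_chain_at[of g "g' x" x f "f' (g x)"] f'(1) g'(1) assms(5) that
        by (auto simp: o_def)
      ultimately show ?thesis by simp
    qed
    show "Ck k S (\<lambda>x. \<Sum>b\<in>Basis. (g' x v \<bullet> b) *\<^sub>R f' (g x) b)" for v
      by (intro Ck_sum Ck_bilinear[OF bounded_bilinear_scaleR]
          Ck_bounded_linear[OF bounded_linear_inner_left] g'(2)[rule_format] Suc.IH[OF _ gk] f'(2)[rule_format])
  qed
qed

lemma smooth_on_open: "smooth_on S f \<Longrightarrow> open S"
  by (simp add: smooth_on_def)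

lemma smooth_on_continuous_on: "smooth_on S f \<Longrightarrow> continuous_on S f"
  unfolding smooth_on_def by (metis Ck.simps(1))

lemma smooth_on_differentiable: "smooth_on S f \<Longrightarrow> x \<in> S \<Longrightarrow> f differentiable (at x)"
  unfolding smooth_on_def using Ck_Suc_iff by blast

lemma smooth_on_has_derivative:
  "smooth_on S f \<Longrightarrow> x \<in> S \<Longrightarrow> (f has_derivative (\<lambda>a. dir_deriv f a x)) (at x)"
  by (simp add: has_derivative_dir_deriv smooth_on_differentiable)

lemma smooth_on_linear_dir_deriv: "smooth_on S f \<Longrightarrow> x \<in> S \<Longrightarrow> linear (\<lambda>a. dir_deriv f a x)"
  using smooth_on_has_derivative has_derivative_linear by blast

lemma smooth_on_dir_deriv: "smooth_on S f \<Longrightarrow> smooth_on S (dir_deriv f a)"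
  unfolding smooth_on_def using Ck_Suc_iff by blast

lemma smooth_on_cong:
  "smooth_on S f \<Longrightarrow> (\<And>x. x \<in> S \<Longrightarrow> f x = g x) \<Longrightarrow> smooth_on S g"
  unfolding smooth_on_def using Ck_cong by blast

lemma smooth_on_subset: "smooth_on S f \<Longrightarrow> open T \<Longrightarrow> T \<subseteq> S \<Longrightarrow> smooth_on T f"
  unfolding smooth_on_def using Ck_subset by blast

lemma smooth_on_const: "open S \<Longrightarrow> smooth_on S (\<lambda>x. c)"
  by (simp add: smooth_on_def Ck_const)

lemma smooth_on_ident: "open S \<Longrightarrow> smooth_on S (\<lambda>x. x)"
  by (simp add: smooth_on_def Ck_ident)

lemma smooth_on_bounded_linear:
  "bounded_linear L \<Longrightarrow> smooth_on S f \<Longrightarrow> smooth_on S (\<lambda>x. L (f x))"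
  by (simp add: smooth_on_def Ck_bounded_linear)

lemma smooth_on_add: "smooth_on S f \<Longrightarrow> smooth_on S g \<Longrightarrow> smooth_on S (\<lambda>x. f x + g x)"
  by (simp add: smooth_on_def Ck_add)

lemma smooth_on_inner:
  fixes f g :: "'a::real_normed_vector \<Rightarrow> 'b::real_inner"
  shows "smooth_on S f \<Longrightarrow> smooth_on S g \<Longrightarrow> smooth_on S (\<lambda>x. f x \<bullet> g x)"
  by (simp add: smooth_on_def Ck_bilinear[OF bounded_bilinear_inner])

lemma smooth_on_scaleR:
  "smooth_on S f \<Longrightarrow> smooth_on S g \<Longrightarrow> smooth_on S (\<lambda>x. f x *\<^sub>R g x)"
  by (simp add: smooth_on_def Ck_bilinear[OF bounded_bilinear_scaleR])

lemma smooth_on_sum: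
  "open S \<Longrightarrow> (\<And>i. i \<in> I \<Longrightarrow> smooth_on S (f i)) \<Longrightarrow> smooth_on S (\<lambda>x. \<Sum>i\<in>I. f i x)"
  by (simp add: smooth_on_def Ck_sum)

lemma smooth_on_compose:
  fixes f :: "'b::euclidean_space \<Rightarrow> 'c::real_normed_vector"
  shows "smooth_on T f \<Longrightarrow> smooth_on S g \<Longrightarrow> g ` S \<subseteq> T \<Longrightarrow> smooth_on S (\<lambda>x. f (g x))"
  unfolding smooth_on_def using Ck_compose by blast

lemma dir_deriv_cong:
  assumes "smooth_on S f" "\<And>x. x \<in> S \<Longrightarrow> f x = g x" "x \<in> S"
  shows "dir_deriv g a x = dir_deriv f a x"
  using has_derivative_transform_within_open[OF smooth_on_has_derivative[OF assms(1,3)] smooth_on_open[OF assms(1)] assms(3,2)]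
  by (rule dir_deriv_eq)

section \<open>Symmetry of second derivatives and uniform linearization\<close>

lemma has_derivative_line:
  assumes "smooth_on S f" "x + t *\<^sub>R a \<in> S"
  shows "((\<lambda>t. f (x + t *\<^sub>R a)) has_vector_derivative dir_deriv f a (x + t *\<^sub>R a)) (at t)"
proof -
  have "((\<lambda>t. x + t *\<^sub>R a) has_derivative (\<lambda>h. h *\<^sub>R a)) (at t)"
    by (auto intro!: derivative_eq_intros)
  from diff_chain_at[OF this smooth_on_has_derivative[OF assms]]
  have "((\<lambda>t. f (x + t *\<^sub>R a)) has_derivative (\<lambda>h. dir_deriv f (h *\<^sub>R a) (x + t *\<^sub>R a))) (at t)"
    by (simp add: o_def)
  then show ?thesis
    unfolding has_vector_derivative_def
    using linear_cmul[OF smooth_on_linear_dir_deriv[OF assms]] by simp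
qed

text \<open>The mean value theorem is applied twice: along \<open>a\<close> to the increment by
  \<open>s *\<^sub>R b\<close>, then along \<open>b\<close> to the derivative in direction
  \<open>a\<close>. The second difference is symmetric in \<open>a\<close> and \<open>b\<close>,
  which is what makes the mixed derivatives agree.\<close>

lemma second_difference_mean_value:
  fixes f :: "'a::real_normed_vector \<Rightarrow> real"
  assumes "smooth_on (ball x \<rho>) f" "s > 0" "s * (norm a + norm b) < \<rho>"
  obtains z where "norm (z - x) \<le> s * (norm a + norm b)"
    "f (x + s *\<^sub>R a + s *\<^sub>R b) - f (x + s *\<^sub>R a) - f (x + s *\<^sub>R b) + f x
       = s * s * dir_deriv (dir_deriv f a) b z"
proof -
  have nb: "norm (t *\<^sub>R a + u *\<^sub>R b) \<le> s * (norm a + norm b)"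
    if "0 \<le> t" "t \<le> s" "0 \<le> u" "u \<le> s" for t u
  proof -
    have "norm (t *\<^sub>R a + u *\<^sub>R b) \<le> t * norm a + u * norm b"
      using norm_triangle_ineq[of "t *\<^sub>R a" "u *\<^sub>R b"] that by simp
    also have "\<dots> \<le> s * norm a + s * norm b"
      using that by (intro add_mono mult_right_mono) auto
    finally show ?thesis by (simp add: distrib_left)
  qed
  have inb: "x + t *\<^sub>R a + u *\<^sub>R b \<in> ball x \<rho>" if "0 \<le> t" "t \<le> s" "0 \<le> u" "u \<le> s" for t u
  proof -
    have "dist x (x + t *\<^sub>R a + u *\<^sub>R b) = norm (t *\<^sub>R a + u *\<^sub>R b)"
      by (metis add.assoc add_diff_cancel_left' dist_commute dist_norm)
    then show ?thesis using nb[OF that] assms(3) by simp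
  qed
  define g where "g t = f ((x + s *\<^sub>R b) + t *\<^sub>R a) - f (x + t *\<^sub>R a)" for t
  have "\<exists>z>0. z < s \<and> g s - g 0 = (s - 0) * (dir_deriv f a ((x + s *\<^sub>R b) + z *\<^sub>R a) - dir_deriv f a (x + z *\<^sub>R a))"
  proof (rule MVT2[OF assms(2)])
    fix t assume t: "0 \<le> t" "t \<le> s"
    have 1: "(x + s *\<^sub>R b) + t *\<^sub>R a \<in> ball x \<rho>" using inb[of t s] t assms(2) by (simp add: algebra_simps)
    have 2: "x + t *\<^sub>R a \<in> ball x \<rho>" using inb[of t 0] t assms(2) by (simp add: algebra_simps)
    show "(g has_real_derivative dir_deriv f a ((x + s *\<^sub>R b) + t *\<^sub>R a) - dir_deriv f a (x + t *\<^sub>R a)) (at t)"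
      unfolding g_def using has_derivative_line[OF assms(1) 1] has_derivative_line[OF assms(1) 2]
      by (simp add: has_real_derivative_iff_has_vector_derivative has_vector_derivative_diff)
  qed
  then obtain \<theta> where \<theta>: "0 < \<theta>" "\<theta> < s"
    and g: "g s - g 0 = s * (dir_deriv f a ((x + s *\<^sub>R b) + \<theta> *\<^sub>R a) - dir_deriv f a (x + \<theta> *\<^sub>R a))"
    by auto
  define k where "k u = dir_deriv f a ((x + \<theta> *\<^sub>R a) + u *\<^sub>R b)" for u
  have "\<exists>z>0. z < s \<and> k s - k 0 = (s - 0) * dir_deriv (dir_deriv f a) b ((x + \<theta> *\<^sub>R a) + z *\<^sub>R b)"
  proof (rule MVT2[OF assms(2)])
    fix u assume u: "0 \<le> u" "u \<le> s"
    have 1: "(x + \<theta> *\<^sub>R a) + u *\<^sub>R b \<in> ball x \<rho>" using inb[of \<theta> u] u \<theta> by simp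
    show "(k has_real_derivative dir_deriv (dir_deriv f a) b ((x + \<theta> *\<^sub>R a) + u *\<^sub>R b)) (at u)"
      unfolding k_def using has_derivative_line[OF smooth_on_dir_deriv[OF assms(1)] 1]
      by (simp add: has_real_derivative_iff_has_vector_derivative)
  qed
  then obtain \<eta> where \<eta>: "0 < \<eta>" "\<eta> < s"
    and k: "k s - k 0 = s * dir_deriv (dir_deriv f a) b ((x + \<theta> *\<^sub>R a) + \<eta> *\<^sub>R b)"
    by auto
  show ?thesis
  proof
    show "norm (x + \<theta> *\<^sub>R a + \<eta> *\<^sub>R b - x) \<le> s * (norm a + norm b)"
      using nb[of \<theta> \<eta>] \<theta> \<eta> by (simp add: algebra_simps)
    have "g s - g 0 = s * (k s - k 0)"
      using g by (simp add: k_def algebra_simps)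
    then show "f (x + s *\<^sub>R a + s *\<^sub>R b) - f (x + s *\<^sub>R a) - f (x + s *\<^sub>R b) + f x
       = s * s * dir_deriv (dir_deriv f a) b (x + \<theta> *\<^sub>R a + \<eta> *\<^sub>R b)"
      using k by (simp add: g_def algebra_simps)
  qed
qed

lemma dir_deriv_commute_real:
  fixes f :: "'a::real_normed_vector \<Rightarrow> real"
  assumes "smooth_on S f" "x \<in> S"
  shows "dir_deriv (dir_deriv f a) b x = dir_deriv (dir_deriv f b) a x"
proof (rule ccontr)
  let ?A = "dir_deriv (dir_deriv f a) b" and ?B = "dir_deriv (dir_deriv f b) a"
  assume ne: "?A x \<noteq> ?B x"
  define \<epsilon> where "\<epsilon> = \<bar>?A x - ?B x\<bar> / 2"
  have \<epsilon>: "\<epsilon> > 0" using ne by (simp add: \<epsilon>_def)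
  obtain \<rho>0 where \<rho>0: "\<rho>0 > 0" "ball x \<rho>0 \<subseteq> S"
    using assms smooth_on_open open_contains_ball by meson
  have sm: "smooth_on (ball x \<rho>0) f" using assms(1) \<rho>0(2) smooth_on_subset by blast
  have cont: "continuous (at x) ?A" "continuous (at x) ?B"
    using smooth_on_continuous_on[OF smooth_on_dir_deriv[OF smooth_on_dir_deriv[OF assms(1)]]] assms smooth_on_open
    by (metis continuous_on_eq_continuous_at)+
  obtain d1 where d1: "d1 > 0" "\<And>y. dist y x < d1 \<Longrightarrow> dist (?A y) (?A x) < \<epsilon>"
    using cont(1) \<epsilon> unfolding continuous_at_eps_delta by blast
  obtain d2 where d2: "d2 > 0" "\<And>y. dist y x < d2 \<Longrightarrow> dist (?B y) (?B x) < \<epsilon>"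
    using cont(2) \<epsilon> unfolding continuous_at_eps_delta by blast
  define m where "m = min \<rho>0 (min d1 d2)"
  define K where "K = norm a + norm b + 1"
  have K: "K > 0" unfolding K_def by (smt (verit) norm_ge_zero)
  \<comment> \<open>This keeps both intermediate points within \<open>m\<close> of \<open>x\<close>,
    where each mixed derivative varies by less than half the supposed gap. The summand 1 in
    \<open>K\<close> covers the case that both directions are zero.\<close>
  define s where "s = m / (2 * K)"
  have m: "m > 0" using \<rho>0 d1 d2 by (simp add: m_def)
  have s: "s > 0" using m K by (simp add: s_def)
  have "s * (norm a + norm b) \<le> s * K" using s by (simp add: K_def)
  also have "\<dots> = m / 2" using K by (simp add: s_def)
  also have "\<dots> < m" using m by simp
  finally have sm_lt: "s * (norm a + norm b) < m" .
  have lt: "s * (norm a + norm b) < \<rho>0" "s * (norm b + norm a) < \<rho>0"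
    using sm_lt by (auto simp: m_def add.commute)
  obtain z where z: "norm (z - x) \<le> s * (norm a + norm b)"
    "f (x + s *\<^sub>R a + s *\<^sub>R b) - f (x + s *\<^sub>R a) - f (x + s *\<^sub>R b) + f x = s * s * ?A z"
    using second_difference_mean_value[OF sm s lt(1)] by blast
  obtain w where w: "norm (w - x) \<le> s * (norm b + norm a)"
    "f (x + s *\<^sub>R b + s *\<^sub>R a) - f (x + s *\<^sub>R b) - f (x + s *\<^sub>R a) + f x = s * s * ?B w"
    using second_difference_mean_value[OF sm s lt(2)] by blast
  have "x + s *\<^sub>R b + s *\<^sub>R a = x + s *\<^sub>R a + s *\<^sub>R b" by simp
  with z(2) w(2) have "s * s * ?A z = s * s * ?B w" by (simp only:)
  then have "?A z = ?B w" using s by simp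
  moreover have "dist z x < d1" "dist w x < d2"
    using z(1) w(1) sm_lt by (auto simp: m_def dist_norm add.commute)
  ultimately have "\<bar>?A x - ?B x\<bar> < 2 * \<epsilon>"
    using d1(2)[of z] d2(2)[of w] by (simp add: dist_real_def)
  then show False by (simp add: \<epsilon>_def)
qed

lemma dir_deriv_inner:
  assumes "smooth_on S f" "smooth_on S g" "x \<in> S"
  shows "dir_deriv (\<lambda>x. f x \<bullet> g x) a x = f x \<bullet> dir_deriv g a x + dir_deriv f a x \<bullet> g x"
  by (rule dir_deriv_eq[OF has_derivative_inner]) (use assms smooth_on_has_derivative in auto)

lemma dir_deriv_inner_const:
  assumes "smooth_on S f" "x \<in> S"
  shows "dir_deriv (\<lambda>x. f x \<bullet> w) a x = dir_deriv f a x \<bullet> w"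
  using dir_deriv_inner[OF assms(1) smooth_on_const[OF smooth_on_open[OF assms(1)]] assms(2), of w a]
    dir_deriv_eq[OF has_derivative_const, of w a x] by simp

lemma dir_deriv_commute:
  fixes f :: "'a::real_normed_vector \<Rightarrow> 'b::real_inner"
  assumes "smooth_on S f" "x \<in> S"
  shows "dir_deriv (dir_deriv f a) b x = dir_deriv (dir_deriv f b) a x"
proof -
  have *: "dir_deriv (dir_deriv (\<lambda>x. f x \<bullet> w) a) b x = dir_deriv (dir_deriv f a) b x \<bullet> w" for w a b
  proof -
    have "dir_deriv (dir_deriv (\<lambda>x. f x \<bullet> w) a) b x = dir_deriv (\<lambda>x. dir_deriv f a x \<bullet> w) b x"
      using dir_deriv_cong[of S "\<lambda>x. dir_deriv f a x \<bullet> w" "dir_deriv (\<lambda>x. f x \<bullet> w) a" x b]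
        smooth_on_inner[OF smooth_on_dir_deriv[OF assms(1)] smooth_on_const[OF smooth_on_open[OF assms(1)]]]
        dir_deriv_inner_const[OF assms(1)] assms(2) by metis
    also have "\<dots> = dir_deriv (dir_deriv f a) b x \<bullet> w"
      by (rule dir_deriv_inner_const[OF smooth_on_dir_deriv[OF assms(1)] assms(2)])
    finally show ?thesis .
  qed
  have "(dir_deriv (dir_deriv f a) b x - dir_deriv (dir_deriv f b) a x) \<bullet> w = 0" for w
    using dir_deriv_commute_real[OF smooth_on_inner[OF assms(1) smooth_on_const[OF smooth_on_open[OF assms(1)]]] assms(2), of w a b]
      * by (simp add: inner_diff_left)
  then show ?thesis by (metis inner_eq_zero_iff right_minus_eq)
qed

lemma dir_deriv_add:
  assumes "smooth_on S f" "smooth_on S g" "x \<in> S"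
  shows "dir_deriv (\<lambda>x. f x + g x) a x = dir_deriv f a x + dir_deriv g a x"
  by (rule dir_deriv_eq[OF has_derivative_add]) (use assms smooth_on_has_derivative in auto)

lemma dir_deriv_mult:
  fixes f g :: "'a::real_normed_vector \<Rightarrow> real"
  assumes "smooth_on S f" "smooth_on S g" "x \<in> S"
  shows "dir_deriv (\<lambda>x. f x * g x) a x = f x * dir_deriv g a x + dir_deriv f a x * g x"
  using dir_deriv_inner[OF assms, of a] by (simp add: inner_real_def)

lemma dir_deriv_bounded_linear:
  assumes "bounded_linear L" "smooth_on S f" "x \<in> S"
  shows "dir_deriv (\<lambda>x. L (f x)) a x = L (dir_deriv f a x)"
  by (rule dir_deriv_eq[OF bounded_linear.has_derivative[OF assms(1)]])
    (use assms smooth_on_has_derivative in auto)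

lemma dir_deriv_const_on:
  assumes "open S" "\<And>x. x \<in> S \<Longrightarrow> f x = c" "x \<in> S"
  shows "dir_deriv f a x = 0"
  using dir_deriv_cong[OF smooth_on_const[OF assms(1)], of c f x a] assms
    dir_deriv_eq[OF has_derivative_const, of c a x] by simp

lemma dir_deriv_zero_const:
  fixes f :: "'a::real_normed_vector \<Rightarrow> 'b::real_normed_vector"
  assumes "smooth_on S f" "convex S" "\<And>x a. x \<in> S \<Longrightarrow> dir_deriv f a x = 0" "x \<in> S" "y \<in> S"
  shows "f x = f y"
proof -
  have "\<exists>c. \<forall>x\<in>S. f x = c"
  proof (rule has_derivative_zero_constant[OF assms(2)])
    fix z assume z: "z \<in> S"
    show "(f has_derivative (\<lambda>h. 0)) (at z within S)"
      using smooth_on_has_derivative[OF assms(1) z] assms(3)[OF z] by (simp add: has_derivative_at_withinI)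
  qed
  then show ?thesis using assms(4,5) by metis
qed

text \<open>This is strict differentiability: the remainder is small for all pairs near
  \<open>p\<close>, with the derivative frozen at \<open>p\<close>. The variation of the flow needs
  it because both endpoints move. It follows from the mean value inequality for \<open>f\<close>
  minus its linear part.\<close>

lemma smooth_on_linearization:
  fixes f :: "'a::euclidean_space \<Rightarrow> 'b::real_normed_vector"
  assumes "smooth_on U f" "p \<in> U" "\<epsilon> > 0"
  obtains \<rho> where "\<rho> > 0" "ball p \<rho> \<subseteq> U"
    "\<And>x y. x \<in> ball p \<rho> \<Longrightarrow> y \<in> ball p \<rho> \<Longrightarrow>
       norm (f y - f x - dir_deriv f (y - x) p) \<le> \<epsilon> * norm (y - x)"
proof -
  \<comment> \<open>The division by the dimension pays for the sum over \<open>Basis\<close> in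
    \<open>bnd\<close>.\<close>
  define \<delta> where "\<delta> = \<epsilon> / real DIM('a)"
  have \<delta>: "\<delta> > 0" using assms(3) by (simp add: \<delta>_def)
  have op: "open U" using assms(1) smooth_on_open by blast
  have "\<forall>b\<in>Basis. \<forall>\<^sub>F y in nhds p. dist (dir_deriv f b y) (dir_deriv f b p) < \<delta>"
  proof
    fix b :: 'a
    have "isCont (dir_deriv f b) p"
      using smooth_on_continuous_on[OF smooth_on_dir_deriv[OF assms(1)]] op assms(2)
        continuous_on_eq_continuous_at by blast
    then show "\<forall>\<^sub>F y in nhds p. dist (dir_deriv f b y) (dir_deriv f b p) < \<delta>"
      unfolding isCont_def tendsto_at_iff_tendsto_nhds using \<delta> tendstoD by blast
  qed
  then have "\<forall>\<^sub>F y in nhds p. \<forall>b\<in>Basis. dist (dir_deriv f b y) (dir_deriv f b p) < \<delta>"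
    by (simp add: eventually_ball_finite_distrib)
  moreover have "\<forall>\<^sub>F y in nhds p. y \<in> U" using op assms(2) by (simp add: eventually_nhds_in_open)
  ultimately have "\<forall>\<^sub>F y in nhds p. (\<forall>b\<in>Basis. dist (dir_deriv f b y) (dir_deriv f b p) < \<delta>) \<and> y \<in> U"
    by (rule eventually_conj)
  then obtain \<rho> where \<rho>: "\<rho> > 0"
    and near: "\<And>y. dist y p < \<rho> \<Longrightarrow> (\<forall>b\<in>Basis. dist (dir_deriv f b y) (dir_deriv f b p) < \<delta>) \<and> y \<in> U"
    unfolding eventually_nhds_metric by blast
  have sub: "ball p \<rho> \<subseteq> U" using near by (auto simp: dist_commute)
  have linp: "linear (\<lambda>a. dir_deriv f a p)" using smooth_on_linear_dir_deriv[OF assms(1,2)] .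
  have bnd: "norm (dir_deriv f v y - dir_deriv f v p) \<le> \<epsilon> * norm v" if y: "y \<in> ball p \<rho>" for v y
  proof -
    have liny: "linear (\<lambda>a. dir_deriv f a y)" using smooth_on_linear_dir_deriv[OF assms(1)] sub y by blast
    have "linear (\<lambda>a. dir_deriv f a y - dir_deriv f a p)" using liny linp by (rule linear_compose_sub)
    note lin = this
    have "dir_deriv f v y - dir_deriv f v p
        = (\<Sum>b\<in>Basis. (v \<bullet> b) *\<^sub>R (dir_deriv f b y - dir_deriv f b p))"
      using linear_sum[OF lin, of "\<lambda>b. (v \<bullet> b) *\<^sub>R b" Basis] linear_cmul[OF lin]
      by (simp add: euclidean_representation)
    also have "norm \<dots> \<le> (\<Sum>b\<in>(Basis::'a set). norm v * \<delta>)"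
    proof (rule sum_norm_le)
      fix b :: 'a assume b: "b \<in> Basis"
      have "norm ((v \<bullet> b) *\<^sub>R (dir_deriv f b y - dir_deriv f b p)) = \<bar>v \<bullet> b\<bar> * dist (dir_deriv f b y) (dir_deriv f b p)"
        by (simp add: dist_norm)
      also have "\<dots> \<le> norm v * \<delta>"
        using near[of y] y b Basis_le_norm[OF b, of v] by (intro mult_mono) (auto simp: dist_commute less_imp_le)
      finally show "norm ((v \<bullet> b) *\<^sub>R (dir_deriv f b y - dir_deriv f b p)) \<le> norm v * \<delta>" .
    qed
    also have "\<dots> = \<epsilon> * norm v" by (simp add: \<delta>_def)
    finally show ?thesis .
  qed
  show ?thesis
  proof
    fix x y assume x: "x \<in> ball p \<rho>" and y: "y \<in> ball p \<rho>"
    define g where "g z = f z - dir_deriv f z p" for z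
    have bl: "bounded_linear (\<lambda>a. dir_deriv f a p)" using linp by (simp add: linear_linear)
    have "norm (g y - g x) \<le> \<epsilon> * norm (y - x)"
    proof (rule differentiable_bound[OF convex_ball _ _ y x])
      fix z assume z: "z \<in> ball p \<rho>"
      have "(g has_derivative (\<lambda>v. dir_deriv f v z - dir_deriv f v p)) (at z)"
        unfolding g_def using smooth_on_has_derivative[OF assms(1)] sub z bl
        by (intro has_derivative_diff bounded_linear_imp_has_derivative) auto
      then show "(g has_derivative (\<lambda>v. dir_deriv f v z - dir_deriv f v p)) (at z within ball p \<rho>)"
        by (rule has_derivative_at_withinI)
      show "onorm (\<lambda>v. dir_deriv f v z - dir_deriv f v p) \<le> \<epsilon>"
        by (rule onorm_le) (rule bnd[OF z])
    qed
    then show "norm (f y - f x - dir_deriv f (y - x) p) \<le> \<epsilon> * norm (y - x)"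
      by (simp only: g_def linear_diff[OF linp]) (simp add: algebra_simps)
  qed (use \<rho> sub in auto)
qed

subsection \<open>Charts of hypersurfaces\<close>

text \<open>\<open>r\<close> is the local projection onto \<open>M\<close> along \<open>e\<close>; it plays the role of a parametrization of \<open>M\<close>.\<close>

definition hypersurface_chart ::
    "'a::euclidean_space set \<Rightarrow> 'a set \<Rightarrow> ('a \<Rightarrow> 'a) \<Rightarrow> ('a \<Rightarrow> 'a) \<Rightarrow> 'a \<Rightarrow> bool" where
  "hypersurface_chart M U r N e \<longleftrightarrow>
     open U \<and> smooth_on U r \<and> smooth_on U N \<and> r ` U \<subseteq> M \<and> (\<forall>x\<in>M \<inter> U. r x = x) \<and>
     (\<forall>y\<in>U. N y \<bullet> e = 1) \<and> (\<forall>y\<in>U. \<forall>a. dir_deriv r a y = a - (a \<bullet> N y) *\<^sub>R e) \<and>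
     (\<forall>y\<in>U. tangent_space M (r y) = {w. w \<bullet> N y = 0})"

lemma hypersurface_chart_subset:
  assumes "hypersurface_chart M U r N e" "open V" "V \<subseteq> U"
  shows "hypersurface_chart M V r N e"
  using assms smooth_on_subset unfolding hypersurface_chart_def by blast

text \<open>\<open>\<Phi>\<close> replaces the coordinate along \<open>e\<close> by the value of
  \<open>F\<close>; it is invertible near \<open>p\<close> because \<open>dir_deriv F e p\<close> is
  nonzero. Its local inverse, applied to \<open>\<pi> y\<close>, gives a zero of \<open>F\<close> on
  the line through \<open>y\<close> in direction \<open>e\<close>.\<close>

lemma implicit_retraction:
  fixes F :: "'a::euclidean_space \<Rightarrow> real"
  assumes F: "smooth_on U0 F" and p: "p \<in> U0" "F p = 0" and nz: "dir_deriv F e p \<noteq> 0" and e: "e \<bullet> e = 1"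
  obtains U r where "open U" "p \<in> U" "U \<subseteq> U0" "r ` U \<subseteq> U0" "\<And>y. y \<in> U \<Longrightarrow> F (r y) = 0"
    "\<And>x. x \<in> U \<Longrightarrow> F x = 0 \<Longrightarrow> r x = x"
    "\<And>y. y \<in> U \<Longrightarrow> dir_deriv F e (r y) \<noteq> 0"
    "\<And>y. y \<in> U \<Longrightarrow> (r has_derivative (\<lambda>a. a - (dir_deriv F a (r y) / dir_deriv F e (r y)) *\<^sub>R e)) (at y)"
proof -
  have op: "open U0" using F smooth_on_open by blast
  define \<Phi> where "\<Phi> y = y + (F y - y \<bullet> e) *\<^sub>R e" for y
  define \<Phi>' where "\<Phi>' y a = a + (dir_deriv F a y - a \<bullet> e) *\<^sub>R e" for y a
  have der: "(\<Phi> has_derivative \<Phi>' y) (at y)" if "y \<in> U0" for y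
    unfolding \<Phi>_def \<Phi>'_def using smooth_on_has_derivative[OF F that]
    by (auto intro!: derivative_eq_intros)
  have bl: "bounded_linear (\<Phi>' y)" if "y \<in> U0" for y using der[OF that] has_derivative_bounded_linear by blast
  define f' where "f' y = Blinfun (\<Phi>' y)" for y
  have f': "blinfun_apply (f' y) = \<Phi>' y" if "y \<in> U0" for y
    using bl[OF that] by (simp add: f'_def bounded_linear_Blinfun_apply)
  have cont: "continuous_on U0 f'"
  proof (rule continuous_on_blinfun_componentwise)
    fix i :: 'a
    have "continuous_on U0 (\<lambda>y. \<Phi>' y i)" unfolding \<Phi>'_def
      using smooth_on_continuous_on[OF smooth_on_dir_deriv[OF F]] by (intro continuous_intros)
    then show "continuous_on U0 (\<lambda>y. blinfun_apply (f' y) i)"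
      using f' by (metis (mono_tags, lifting) continuous_on_cong)
  qed
  have linF: "linear (\<lambda>a. dir_deriv F a y)" if "y \<in> U0" for y
    using smooth_on_linear_dir_deriv[OF F that] .
  \<comment> \<open>The explicit left inverse of \<open>\<Phi>' p\<close>, found by solving along
    \<open>e\<close> with the nonzero slope \<open>dir_deriv F e p\<close>.\<close>
  define g0 where "g0 b = b + ((b \<bullet> e - dir_deriv F b p) / dir_deriv F e p) *\<^sub>R e" for b
  have "bounded_linear (\<lambda>a. dir_deriv F a p)" using linF[OF p(1)] by (simp add: linear_linear)
  then have "bounded_linear g0"
    unfolding g0_def divide_inverse
    by (intro bounded_linear_add bounded_linear_ident bounded_linear_compose[OF bounded_linear_scaleR_left]
        bounded_linear_compose[OF bounded_linear_mult_left] bounded_linear_sub bounded_linear_inner_left) auto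
  then have g0: "blinfun_apply (Blinfun g0) = g0" by (rule bounded_linear_Blinfun_apply)
  have inv: "Blinfun g0 o\<^sub>L f' p = id_blinfun"
  proof (rule blinfun_eqI)
    fix a
    have "(\<Phi>' p a \<bullet> e - dir_deriv F (\<Phi>' p a) p) / dir_deriv F e p = - (dir_deriv F a p - a \<bullet> e)"
      using nz e linear_add[OF linF[OF p(1)]] linear_cmul[OF linF[OF p(1)]]
      by (simp add: \<Phi>'_def inner_add_left)
    then have "g0 (\<Phi>' p a) = a" by (simp only: g0_def) (simp add: \<Phi>'_def algebra_simps)
    then show "blinfun_apply (Blinfun g0 o\<^sub>L f' p) a = blinfun_apply id_blinfun a"
      using g0 f'[OF p(1)] by simp
  qed
  have derb: "\<And>x. x \<in> U0 \<Longrightarrow> (\<Phi> has_derivative (blinfun_apply (f' x))) (at x)" using der f' by simp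
  obtain U' V g g' where U': "open U'" "U' \<subseteq> U0" "p \<in> U'" and V: "open V" "\<Phi> p \<in> V"
    and hom: "homeomorphism U' V \<Phi> g"
    and g': "\<And>y. y \<in> V \<Longrightarrow> (g has_derivative (g' y)) (at y)"
    and g'inv: "\<And>y. y \<in> V \<Longrightarrow> g' y = inv (blinfun_apply (f'(g y)))"
    and bij: "\<And>y. y \<in> V \<Longrightarrow> bij (blinfun_apply (f'(g y)))"
    by (rule inverse_function_theorem[OF op derb cont p(1) inv], assumption) (rule that; assumption)
  define \<pi> where "\<pi> y = y - (y \<bullet> e) *\<^sub>R e" for y
  define r where "r y = g (\<pi> y)" for y
  define U where "U = U' \<inter> \<pi> -` V"
  have "continuous_on UNIV \<pi>" unfolding \<pi>_def by (intro continuous_intros)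
  then have opU: "open U" unfolding U_def using U'(1) V(1) by (simp add: open_vimage open_Int)
  have \<Phi>\<pi>: "\<Phi> x = \<pi> x" if "F x = 0" for x using that by (simp add: \<Phi>_def \<pi>_def)
  have pU: "p \<in> U" using U'(3) V(2) \<Phi>\<pi>[OF p(2)] by (simp add: U_def)
  have gV: "g v \<in> U'" "\<Phi> (g v) = v" if "v \<in> V" for v
    using hom that unfolding homeomorphism_def by auto
  have rU: "r y \<in> U0" "\<Phi> (r y) = \<pi> y" if "y \<in> U" for y
    using gV[of "\<pi> y"] that U'(2) by (auto simp: U_def r_def)
  have Fr: "F (r y) = 0" if "y \<in> U" for y
  proof -
    have "\<Phi> (r y) \<bullet> e = \<pi> y \<bullet> e" using rU(2)[OF that] by simp
    then show ?thesis using e by (simp add: \<Phi>_def \<pi>_def inner_add_left inner_diff_left)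
  qed
  have rx: "r x = x" if "x \<in> U" "F x = 0" for x
    using that \<Phi>\<pi>[OF that(2)] hom unfolding homeomorphism_def r_def U_def by auto
  \<comment> \<open>Otherwise \<open>\<Phi>'\<close> at \<open>r y\<close> would send
    \<open>e\<close> to zero, although it is bijective there.\<close>
  have nzr: "dir_deriv F e (r y) \<noteq> 0" if "y \<in> U" for y
  proof
    assume 0: "dir_deriv F e (r y) = 0"
    have "inj (\<Phi>' (r y))" using bij[of "\<pi> y"] that f'[OF rU(1)[OF that]] bij_is_inj by (auto simp: U_def r_def)
    moreover have "\<Phi>' (r y) e = \<Phi>' (r y) 0"
      using 0 e linear_0[OF linF[OF rU(1)[OF that]]] by (simp add: \<Phi>'_def)
    ultimately have "e = 0" by (rule injD)
    then show False using e by simp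
  qed
  have rder: "(r has_derivative (\<lambda>a. a - (dir_deriv F a (r y) / dir_deriv F e (r y)) *\<^sub>R e)) (at y)"
    if y: "y \<in> U" for y
  proof -
    have yV: "\<pi> y \<in> V" using y by (simp add: U_def)
    have d\<pi>: "(\<pi> has_derivative \<pi>) (at y)" unfolding \<pi>_def by (auto intro!: derivative_eq_intros)
    have 1: "(r has_derivative (\<lambda>a. g' (\<pi> y) (\<pi> a))) (at y)"
      using diff_chain_at[OF d\<pi> g'[OF yV]] by (simp add: r_def[abs_def] o_def)
    have "g' (\<pi> y) (\<pi> a) = a - (dir_deriv F a (r y) / dir_deriv F e (r y)) *\<^sub>R e" for a
    proof -
      let ?w = "a - (dir_deriv F a (r y) / dir_deriv F e (r y)) *\<^sub>R e"
      have "\<Phi>' (r y) ?w = \<pi> a"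
        using nzr[OF y] e
        by (simp add: \<Phi>'_def \<pi>_def inner_diff_left linear_diff[OF linF[OF rU(1)[OF y]]]
            linear_cmul[OF linF[OF rU(1)[OF y]]]) (simp add: algebra_simps)
      moreover have "inv (\<Phi>' (r y)) (\<Phi>' (r y) ?w) = ?w"
        using bij[OF yV] f'[OF rU(1)[OF y]] by (simp add: r_def bij_is_inj)
      moreover have "g' (\<pi> y) = inv (\<Phi>' (r y))" using g'inv[OF yV] f'[OF rU(1)[OF y]] by (simp add: r_def)
      ultimately show ?thesis by simp
    qed
    then show ?thesis using 1 by simp
  qed
  show ?thesis
    by (rule that[OF opU pU _ _ Fr rx nzr rder]) (use U'(2) rU in \<open>auto simp: U_def\<close>)
qed

lemma tangent_space_line:
  fixes r :: "'a::euclidean_space \<Rightarrow> 'a"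
  assumes "smooth_on U r" "r ` U \<subseteq> M" "y \<in> U"
  shows "dir_deriv r a y \<in> tangent_space M (r y)"
proof -
  have "open U" using assms smooth_on_open by blast
  have c: "continuous_on UNIV (\<lambda>t::real. y + t *\<^sub>R a)" by (intro continuous_intros)
  have "open ((\<lambda>t::real. y + t *\<^sub>R a) -` U)" using c \<open>open U\<close> open_vimage by blast
  moreover have "0 \<in> (\<lambda>t::real. y + t *\<^sub>R a) -` U" using assms by simp
  ultimately obtain d where d: "d > 0" "ball 0 d \<subseteq> (\<lambda>t::real. y + t *\<^sub>R a) -` U"
    using open_contains_ball by blast
  then have in_U: "y + t *\<^sub>R a \<in> U" if "t \<in> {-d<..<d}" for t
    using that by (auto simp: subset_eq dist_real_def)
  have "smooth_on {-d<..<d} (\<lambda>t. y + t *\<^sub>R a)"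
    by (intro smooth_on_add smooth_on_const smooth_on_bounded_linear[OF bounded_linear_scaleR_left] smooth_on_ident) auto
  then have "smooth_on {-d<..<d} (\<lambda>t. r (y + t *\<^sub>R a))"
    by (rule smooth_on_compose[OF assms(1)]) (use in_U in auto)
  moreover have "((\<lambda>t. r (y + t *\<^sub>R a)) has_vector_derivative dir_deriv r a y) (at 0)"
    using has_derivative_line[OF assms(1), of y 0 a] assms(3) by simp
  ultimately have "curve_through M (r y) (dir_deriv r a y) (\<lambda>t. r (y + t *\<^sub>R a))"
    unfolding curve_through_def using d(1) in_U assms(2) by (auto intro!: exI[of _ d])
  then show ?thesis unfolding tangent_space_def by blast
qed

text \<open>Serves with several functions: a local defining function, the squared norm of
  \<open>A (x - c)\<close>, the product of normal and field, and the identity map in the case of a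
  one-point set.\<close>

lemma curve_through_level_set:
  assumes "curve_through M p v \<gamma>" "open U" "p \<in> U" "\<And>x. x \<in> M \<inter> U \<Longrightarrow> F x = c"
    "(F has_derivative F') (at p)"
  shows "F' v = 0"
proof -
  obtain d where d: "d > 0" "\<forall>t\<in>{-d<..<d}. \<gamma> t \<in> M" and g0: "\<gamma> 0 = p"
    and g': "(\<gamma> has_vector_derivative v) (at 0)"
    using assms(1) unfolding curve_through_def by blast
  have "isCont \<gamma> 0" using g' has_vector_derivative_continuous by blast
  then have "\<forall>\<^sub>F t in nhds 0. \<gamma> t \<in> U"
    using assms(2,3) g0 by (metis isCont_def tendsto_at_iff_tendsto_nhds topological_tendstoD)
  moreover have "\<forall>\<^sub>F t in nhds (0::real). t \<in> {-d<..<d}" using d(1) by (intro eventually_nhds_in_open) auto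
  ultimately have ev: "\<forall>\<^sub>F t in nhds 0. F (\<gamma> t) = c"
    by eventually_elim (use d assms(4) in auto)
  have "((\<lambda>t. F (\<gamma> t)) has_derivative (\<lambda>h. F' (h *\<^sub>R v))) (at 0)"
    using diff_chain_at[of \<gamma> "\<lambda>h. h *\<^sub>R v" 0 F F'] g' g0 assms(5) by (simp add: o_def has_vector_derivative_def)
  moreover have "((\<lambda>t. F (\<gamma> t)) has_derivative (\<lambda>h. 0)) (at 0)"
  proof -
    obtain S where S: "open S" "0 \<in> S" "\<forall>t\<in>S. F (\<gamma> t) = c" using ev unfolding eventually_nhds by blast
    show ?thesis
      by (rule has_derivative_transform_within_open[OF has_derivative_const S(1,2)]) (use S(3) in auto)
  qed
  ultimately have "(\<lambda>h. F' (h *\<^sub>R v)) = (\<lambda>h. 0)" by (rule has_derivative_unique)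
  then have "F' (1 *\<^sub>R v) = 0" by metis
  then show ?thesis by simp
qed

lemma hypersurface_chart_exists:
  fixes M :: "'a::euclidean_space set"
  assumes "smooth_hypersurface M" "p \<in> M"
  obtains U r N e where "p \<in> U" "hypersurface_chart M U r N e"
proof -
  obtain U0 F where U0: "open U0" "p \<in> U0" and F: "smooth_on U0 (F :: 'a \<Rightarrow> real)"
    and M: "M \<inter> U0 = {x\<in>U0. F x = 0}"
    and ex: "\<forall>x\<in>M \<inter> U0. \<exists>D. (F has_derivative D) (at x) \<and> D \<noteq> (\<lambda>_. 0)"
    using assms(1)[unfolded smooth_hypersurface_def, rule_format, OF assms(2)] by metis
  obtain D where D: "(F has_derivative D) (at p)" "D \<noteq> (\<lambda>_. 0)"
    using ex U0(2) assms(2) by (meson IntI)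
  obtain w where w: "D w \<noteq> 0" using D(2) by auto
  have linD: "linear D" using D(1) has_derivative_linear by blast
  define e where "e = w /\<^sub>R norm w"
  have "w \<noteq> 0" using w linear_0[OF linD] by auto
  then have e: "e \<bullet> e = 1" by (simp add: e_def flip: power2_norm_eq_inner)
  have "D e \<noteq> 0" using w \<open>w \<noteq> 0\<close> linear_cmul[OF linD] by (simp add: e_def)
  then have nz: "dir_deriv F e p \<noteq> 0" using dir_deriv_eq[OF D(1)] by simp
  have Fp: "F p = 0" using M assms(2) U0 by blast
  obtain U r where U: "open U" "p \<in> U" "U \<subseteq> U0" and rU: "r ` U \<subseteq> U0"
    and Fr: "\<And>y. y \<in> U \<Longrightarrow> F (r y) = 0"
    and rx: "\<And>x. x \<in> U \<Longrightarrow> F x = 0 \<Longrightarrow> r x = x"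
    and nzr: "\<And>y. y \<in> U \<Longrightarrow> dir_deriv F e (r y) \<noteq> 0"
    and rder: "\<And>y. y \<in> U \<Longrightarrow>
      (r has_derivative (\<lambda>a. a - (dir_deriv F a (r y) / dir_deriv F e (r y)) *\<^sub>R e)) (at y)"
    by (rule implicit_retraction[OF F U0(2) Fp nz e]) blast
  have Fa: "Ck k U0 (dir_deriv F a)" for k a using smooth_on_dir_deriv[OF F] by (simp add: smooth_on_def)
  \<comment> \<open>Bootstrapping: the formula for the derivative of \<open>r\<close> involves only
    \<open>r\<close> and derivatives of \<open>F\<close>, so class C^k of \<open>r\<close> gives
    class C^(k+1).\<close>
  have Ckr: "Ck k U r" for k
  proof (induction k)
    case 0
    have "continuous_on U r"
      by (intro continuous_at_imp_continuous_on ballI) (rule has_derivative_continuous[OF rder])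
    then show ?case by simp
  next
    case (Suc k)
    show ?case
    proof (rule Ck_SucI[OF U(1)])
      show "(r has_derivative (\<lambda>a. a + (-1) *\<^sub>R (dir_deriv F a (r y) * inverse (dir_deriv F e (r y))) *\<^sub>R e)) (at y)"
        if "y \<in> U" for y
        using rder[OF that] by (simp add: divide_inverse)
      show "Ck k U (\<lambda>y. a + (-1) *\<^sub>R (dir_deriv F a (r y) * inverse (dir_deriv F e (r y))) *\<^sub>R e)" for a
        by (intro Ck_add Ck_const Ck_bounded_linear[OF bounded_linear_scaleR_right]
            Ck_bounded_linear[OF bounded_linear_scaleR_left] Ck_bilinear[OF bounded_bilinear_mult]
            Ck_compose[OF U(1) U0(1) Fa Suc.IH rU] Ck_inverse[OF U(1)] nzr)
    qed
  qed
  then have smr: "smooth_on U r" using U(1) by (simp add: smooth_on_def)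
  \<comment> \<open>The gradient of \<open>F\<close> at \<open>r y\<close>, divided by its component
    along \<open>e\<close> so that \<open>N y \<bullet> e = 1\<close>.\<close>
  define N where "N y = (\<Sum>b\<in>Basis. (dir_deriv F b (r y) * inverse (dir_deriv F e (r y))) *\<^sub>R b)" for y
  have smN: "smooth_on U N"
    unfolding N_def smooth_on_def
    by (intro conjI allI U(1) Ck_sum Ck_bounded_linear[OF bounded_linear_scaleR_left]
        Ck_bilinear[OF bounded_bilinear_mult] Ck_compose[OF U(1) U0(1) Fa Ckr rU] Ck_inverse[OF U(1)] nzr)
  have Na: "a \<bullet> N y = dir_deriv F a (r y) / dir_deriv F e (r y)" if "y \<in> U" for a y
  proof -
    have lin: "linear (\<lambda>a. dir_deriv F a (r y))" using smooth_on_linear_dir_deriv[OF F] rU that by blast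
    have "dir_deriv F a (r y) = (\<Sum>b\<in>Basis. (a \<bullet> b) * dir_deriv F b (r y))"
      using linear_sum[OF lin, of "\<lambda>b. (a \<bullet> b) *\<^sub>R b" Basis] linear_cmul[OF lin]
      by (simp add: euclidean_representation)
    moreover have "a \<bullet> N y = (\<Sum>b\<in>Basis. (a \<bullet> b) * dir_deriv F b (r y)) * inverse (dir_deriv F e (r y))"
      unfolding sum_distrib_right by (simp add: N_def inner_sum_right mult_ac)
    ultimately show ?thesis by (simp add: divide_inverse)
  qed
  have rd: "dir_deriv r a y = a - (a \<bullet> N y) *\<^sub>R e" if "y \<in> U" for y a
    using dir_deriv_eq[OF rder[OF that]] Na[OF that] by simp
  have rM: "r ` U \<subseteq> M" using rU Fr M by blast
  have tan: "tangent_space M (r y) = {w. w \<bullet> N y = 0}" if y: "y \<in> U" for y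
  proof
    show "{w. w \<bullet> N y = 0} \<subseteq> tangent_space M (r y)"
    proof
      fix w assume "w \<in> {w. w \<bullet> N y = 0}"
      then have "dir_deriv r w y = w" using rd[OF y] by simp
      then show "w \<in> tangent_space M (r y)" using tangent_space_line[OF smr rM y, of w] by simp
    qed
    show "tangent_space M (r y) \<subseteq> {w. w \<bullet> N y = 0}"
    proof
      fix w assume "w \<in> tangent_space M (r y)"
      then obtain \<gamma> where \<gamma>: "curve_through M (r y) w \<gamma>" unfolding tangent_space_def by blast
      have ry: "r y \<in> U0" using y rU by blast
      have "dir_deriv F w (r y) = 0"
        by (rule curve_through_level_set[OF \<gamma> U0(1) ry _ smooth_on_has_derivative[OF F ry]]) (use M in auto)
      then show "w \<in> {w. w \<bullet> N y = 0}" using Na[OF y] by simp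
    qed
  qed
  have "hypersurface_chart M U r N e"
    unfolding hypersurface_chart_def
  proof (intro conjI ballI allI U(1) smr smN rM)
    show "r x = x" if "x \<in> M \<inter> U" for x using rx[of x] that M U(3) by auto
    show "N y \<bullet> e = 1" if "y \<in> U" for y using Na[OF that, of e] nzr[OF that] by (simp add: inner_commute)
  qed (use rd tan in auto)
  then show ?thesis using that U(2) by blast
qed

subsection \<open>The Killing equation\<close>

lemma curve_through_shift:
  fixes \<gamma> :: "real \<Rightarrow> 'a::euclidean_space"
  assumes "smooth_on {-d<..<d} \<gamma>" "\<And>t. t \<in> {-d<..<d} \<Longrightarrow> \<gamma> t \<in> M" "s \<in> {-d<..<d}"
  shows "dir_deriv \<gamma> 1 s \<in> tangent_space M (\<gamma> s)"
proof -
  define e where "e = min (d - s) (d + s)"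
  have e: "e > 0" using assms(3) by (auto simp: e_def)
  have in_d: "s + t \<in> {-d<..<d}" if "t \<in> {-e<..<e}" for t using that by (auto simp: e_def)
  have sm: "smooth_on {-e<..<e} (\<lambda>t. \<gamma> (s + t))"
    by (rule smooth_on_compose[OF assms(1)])
      (use in_d in \<open>auto intro!: smooth_on_add smooth_on_const smooth_on_ident\<close>)
  have "((\<lambda>t. \<gamma> (s + t *\<^sub>R 1)) has_vector_derivative dir_deriv \<gamma> 1 (s + 0 *\<^sub>R 1)) (at 0)"
    by (rule has_derivative_line[OF assms(1)]) (use assms(3) in auto)
  then have "curve_through M (\<gamma> s) (dir_deriv \<gamma> 1 s) (\<lambda>t. \<gamma> (s + t))"
    unfolding curve_through_def using e sm in_d assms(2) by (auto intro!: exI[of _ e])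
  then show ?thesis unfolding tangent_space_def by blast
qed

text \<open>\<open>f\<close> can be differentiated only through a local smooth extension
  \<open>g\<close>, whose derivative preserves lengths of tangent vectors; the velocity of a curve
  in \<open>M\<close> is such a vector.\<close>

lemma riemannian_isometry_curve:
  assumes "riemannian_isometry M f" "smooth_on {-d<..<d} \<gamma>" "\<And>t. t \<in> {-d<..<d} \<Longrightarrow> \<gamma> t \<in> M"
    "s \<in> {-d<..<d}"
  obtains w where "((\<lambda>t. f (\<gamma> t)) has_vector_derivative w) (at s)" "norm w = norm (dir_deriv \<gamma> 1 s)"
proof -
  have pM: "\<gamma> s \<in> M" using assms(3,4) by blast
  obtain U g g' where U: "open U" "\<gamma> s \<in> U" and g: "\<forall>y\<in>M \<inter> U. g y = f y"
    and g': "(g has_derivative g') (at (\<gamma> s))"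
    and iso: "\<forall>u\<in>tangent_space M (\<gamma> s). \<forall>w\<in>tangent_space M (\<gamma> s). g' u \<bullet> g' w = u \<bullet> w"
    using assms(1) pM unfolding riemannian_isometry_def by meson
  have \<gamma>': "(\<gamma> has_derivative (\<lambda>h. h *\<^sub>R dir_deriv \<gamma> 1 s)) (at s)"
    using has_derivative_line[OF assms(2), of 0 s 1] assms(4) by (simp add: has_vector_derivative_def)
  have lin: "linear g'" using g' has_derivative_linear by blast
  have 1: "((\<lambda>t. g (\<gamma> t)) has_vector_derivative g' (dir_deriv \<gamma> 1 s)) (at s)"
    using diff_chain_at[OF \<gamma>' g'] linear_cmul[OF lin] by (simp add: o_def has_vector_derivative_def)
  have "open ({-d<..<d} \<inter> \<gamma> -` U)"
    using continuous_open_preimage[OF smooth_on_continuous_on[OF assms(2)] _ U(1)] by simp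
  then have "((\<lambda>t. f (\<gamma> t)) has_vector_derivative g' (dir_deriv \<gamma> 1 s)) (at s)"
    by (rule has_vector_derivative_transform_within_open[OF 1]) (use assms(3,4) g U(2) in auto)
  moreover have "norm (g' (dir_deriv \<gamma> 1 s)) = norm (dir_deriv \<gamma> 1 s)"
    using iso curve_through_shift[OF assms(2,3,4)] by (simp add: norm_eq)
  ultimately show ?thesis using that by blast
qed

lemma vector_derivative_bound:
  fixes f :: "real \<Rightarrow> 'a::real_normed_vector"
  assumes "convex S" "\<And>t. t \<in> S \<Longrightarrow> (f has_vector_derivative f' t) (at t)"
    "\<And>t. t \<in> S \<Longrightarrow> norm (f' t) \<le> C" "a \<in> S" "b \<in> S"
  shows "norm (f b - f a) \<le> C * \<bar>b - a\<bar>"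
proof -
  have "norm (f b - f a) \<le> C * norm (b - a)"
  proof (rule differentiable_bound[OF assms(1) _ _ assms(5,4)])
    show "(f has_derivative (\<lambda>h. h *\<^sub>R f' t)) (at t within S)" if "t \<in> S" for t
      using assms(2)[OF that] by (simp add: has_vector_derivative_def has_derivative_at_withinI)
    show "onorm (\<lambda>h. h *\<^sub>R f' t) \<le> C" if "t \<in> S" for t
      using assms(3)[OF that] by (intro onorm_le) (simp add: mult.commute[of C] mult_left_mono)
  qed
  then show ?thesis by simp
qed

lemma has_vector_derivative_quotient:
  assumes "(f has_vector_derivative v) (at 0)"
  shows "((\<lambda>s. (f s - f 0) /\<^sub>R s) \<longlongrightarrow> v) (at 0)"
proof -
  have "((\<lambda>h. norm (f (0 + h) - f 0 - h *\<^sub>R v) / norm h) \<longlongrightarrow> 0) (at 0)"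
    using assms unfolding has_vector_derivative_def has_derivative_at by blast
  moreover have "\<forall>\<^sub>F h in at 0. norm (f (0 + h) - f 0 - h *\<^sub>R v) / norm h = norm ((f h - f 0) /\<^sub>R h - v)"
    using eventually_neq_at_within[of 0 0 UNIV]
  proof eventually_elim
    case (elim h)
    have "(f h - f 0) /\<^sub>R h - v = (f h - f 0 - h *\<^sub>R v) /\<^sub>R h"
      using elim by (simp add: scaleR_diff_right)
    then show ?case by (simp add: divide_inverse mult.commute)
  qed
  ultimately have "((\<lambda>h. norm ((f h - f 0) /\<^sub>R h - v)) \<longlongrightarrow> 0) (at 0)"
    by (rule Lim_transform_eventually)
  then show ?thesis using Lim_null tendsto_norm_zero_iff by blast
qed

text \<open>
  No joint regularity of the flow in time and space is available, so the variation of the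
  velocities \<open>w t\<close> of the transported curves is obtained from the difference quotients
  of the curve, which are bounded uniformly because the flow consists of isometries.
\<close>

lemma flow_variation_estimate:
  fixes \<xi>' :: "'a::euclidean_space \<Rightarrow> 'a"
  assumes flow: "\<And>x t. x \<in> M \<Longrightarrow> \<phi> t x \<in> M \<and> ((\<lambda>s. \<phi> s x) has_vector_derivative \<xi> (\<phi> t x)) (at t)"
    and flow0: "\<And>x. x \<in> M \<Longrightarrow> \<phi> 0 x = x"
    and unit: "\<And>x. x \<in> M \<Longrightarrow> norm (\<xi> x) = 1"
    and ext: "\<And>x. x \<in> M \<Longrightarrow> x \<in> ball p \<rho> \<Longrightarrow> \<xi> x = \<xi>' x"
    and L: "linear L" "\<And>x. norm (L x) \<le> K * norm x" "0 \<le> K"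
    and lin: "\<And>x y. x \<in> ball p \<rho> \<Longrightarrow> y \<in> ball p \<rho> \<Longrightarrow> norm (\<xi>' y - \<xi>' x - L (y - x)) \<le> \<epsilon> * norm (y - x)"
    and xy: "x \<in> M" "y \<in> M" "x \<in> ball p (\<rho>/2)" "y \<in> ball p (\<rho>/2)"
    and bnd: "\<And>t. norm (\<phi> t y - \<phi> t x) \<le> C" and t: "\<bar>t\<bar> < \<rho>/2" and \<epsilon>: "0 \<le> \<epsilon>"
  shows "norm (\<phi> t y - \<phi> t x - (y - x) - t *\<^sub>R L (y - x)) \<le> (\<epsilon> + K * (K + \<epsilon>) * \<bar>t\<bar>) * C * \<bar>t\<bar>"
proof -
  have C: "0 \<le> C" using bnd[of 0] norm_ge_zero order_trans by blast
  \<comment> \<open>The field has unit length, so a flow line moves by at most the elapsed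
    time.\<close>
  have near: "\<phi> s z \<in> ball p \<rho>" if "z \<in> M" "z \<in> ball p (\<rho>/2)" "\<bar>s\<bar> < \<rho>/2" for s z
  proof -
    have "norm (\<phi> s z - \<phi> 0 z) \<le> 1 * \<bar>s - 0\<bar>"
      by (rule vector_derivative_bound[OF convex_UNIV, where f' = "\<lambda>s. \<xi> (\<phi> s z)"])
        (use flow[OF that(1)] unit in auto)
    then have "dist z (\<phi> s z) \<le> \<bar>s\<bar>" using flow0[OF that(1)] by (simp add: dist_norm norm_minus_commute)
    moreover have "dist p z < \<rho>/2" using that(2) by simp
    ultimately show ?thesis using that(3) dist_triangle[of p "\<phi> s z" z] by simp
  qed
  let ?I = "{-\<bar>t\<bar>..\<bar>t\<bar>}"
  have \<xi>eq: "\<xi> (\<phi> s z) = \<xi>' (\<phi> s z)" if "s \<in> ?I" "z \<in> M" "z \<in> ball p (\<rho>/2)" for s z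
    using ext[of "\<phi> s z"] flow[OF that(2)] near[of z s] that t by auto
  have dlin: "norm (\<xi> (\<phi> s y) - \<xi> (\<phi> s x) - L (\<phi> s y - \<phi> s x)) \<le> \<epsilon> * C" if s: "s \<in> ?I" for s
  proof -
    have "norm (\<xi>' (\<phi> s y) - \<xi>' (\<phi> s x) - L (\<phi> s y - \<phi> s x)) \<le> \<epsilon> * norm (\<phi> s y - \<phi> s x)"
      by (rule lin) (use near[of x s] near[of y s] s t xy in auto)
    also have "\<dots> \<le> \<epsilon> * C" using bnd \<epsilon> by (simp add: mult_left_mono)
    finally show ?thesis using \<xi>eq s xy by simp
  qed
  have d\<xi>: "norm (\<xi> (\<phi> s y) - \<xi> (\<phi> s x)) \<le> (K + \<epsilon>) * C" if s: "s \<in> ?I" for s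
  proof -
    have "norm (L (\<phi> s y - \<phi> s x)) \<le> K * C"
      using L(2)[of "\<phi> s y - \<phi> s x"] mult_left_mono[OF bnd[of s] L(3)] by linarith
    then show ?thesis
      using dlin[OF s] norm_triangle_sub[of "\<xi> (\<phi> s y) - \<xi> (\<phi> s x)" "L (\<phi> s y - \<phi> s x)"]
      by (simp add: distrib_right)
  qed
  \<comment> \<open>First integration: the difference of the two flow lines stays close to
    \<open>y - x\<close>. The second integration, of the error \<open>f\<close> below, uses this to
    freeze the argument of \<open>L\<close>.\<close>
  have diff: "norm (\<phi> s y - \<phi> s x - (y - x)) \<le> (K + \<epsilon>) * C * \<bar>t\<bar>" if s: "s \<in> ?I" for s
  proof -
    have "norm ((\<phi> s y - \<phi> s x) - (\<phi> 0 y - \<phi> 0 x)) \<le> (K + \<epsilon>) * C * \<bar>s - 0\<bar>"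
      by (rule vector_derivative_bound[where S = ?I and f = "\<lambda>s. \<phi> s y - \<phi> s x"
            and f' = "\<lambda>s. \<xi> (\<phi> s y) - \<xi> (\<phi> s x)"])
        (use flow xy d\<xi> s in \<open>auto intro: has_vector_derivative_diff\<close>)
    also have "\<dots> \<le> (K + \<epsilon>) * C * \<bar>t\<bar>" using s L(3) \<epsilon> C by (intro mult_left_mono) auto
    finally show ?thesis using flow0 xy by simp
  qed
  define f where "f s = \<phi> s y - \<phi> s x - (y - x) - s *\<^sub>R L (y - x)" for s
  have "norm (f t - f 0) \<le> ((\<epsilon> + K * (K + \<epsilon>) * \<bar>t\<bar>) * C) * \<bar>t - 0\<bar>"
  proof (rule vector_derivative_bound[where S = ?I])
    fix s assume s: "s \<in> ?I"
    show "(f has_vector_derivative (\<xi> (\<phi> s y) - \<xi> (\<phi> s x) - 0 - L (y - x))) (at s)"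
      unfolding f_def using flow xy
      by (intro has_vector_derivative_diff has_vector_derivative_const)
        (auto intro!: derivative_eq_intros)
    have "norm (L (\<phi> s y - \<phi> s x - (y - x))) \<le> K * ((K + \<epsilon>) * C * \<bar>t\<bar>)"
      using L(2)[of "\<phi> s y - \<phi> s x - (y - x)"] mult_left_mono[OF diff[OF s] L(3)] by linarith
    moreover have "\<xi> (\<phi> s y) - \<xi> (\<phi> s x) - 0 - L (y - x)
        = (\<xi> (\<phi> s y) - \<xi> (\<phi> s x) - L (\<phi> s y - \<phi> s x)) + L (\<phi> s y - \<phi> s x - (y - x))"
      using linear_diff[OF L(1), of "\<phi> s y - \<phi> s x" "y - x"] by simp
    ultimately show "norm (\<xi> (\<phi> s y) - \<xi> (\<phi> s x) - 0 - L (y - x)) \<le> (\<epsilon> + K * (K + \<epsilon>) * \<bar>t\<bar>) * C"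
      using dlin[OF s] norm_triangle_ineq[of "\<xi> (\<phi> s y) - \<xi> (\<phi> s x) - L (\<phi> s y - \<phi> s x)" "L (\<phi> s y - \<phi> s x - (y - x))"]
      by (simp add: algebra_simps)
  qed auto
  moreover have "f 0 = 0" using flow0 xy by (simp add: f_def)
  ultimately show ?thesis by (simp only: f_def diff_0_right)
qed

text \<open>The vectors \<open>w t\<close>, images of \<open>u\<close> under the differential of the
  flow at time \<open>t\<close>, have constant length. Their derivative at time 0 is the derivative
  of the field along \<open>u\<close>, so differentiating \<open>w t \<bullet> w t\<close> gives the
  claim.\<close>

lemma killing_equation_at:
  fixes M :: "'a::euclidean_space set"
  assumes kil: "killing_field M \<xi>" and unit: "\<And>x. x \<in> M \<Longrightarrow> norm (\<xi> x) = 1"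
    and p: "p \<in> M" and u: "u \<in> tangent_space M p"
    and ext: "smooth_on U \<xi>'" "p \<in> U" "\<And>x. x \<in> M \<inter> U \<Longrightarrow> \<xi>' x = \<xi> x"
  shows "dir_deriv \<xi>' u p \<bullet> u = 0"
proof -
  obtain \<phi> :: "real \<Rightarrow> 'a \<Rightarrow> 'a" where
    flow: "\<And>x t. x \<in> M \<Longrightarrow> \<phi> t x \<in> M \<and> ((\<lambda>s. \<phi> s x) has_vector_derivative \<xi> (\<phi> t x)) (at t)"
    and flow0: "\<And>x. x \<in> M \<Longrightarrow> \<phi> 0 x = x"
    and iso: "\<And>t. riemannian_isometry M (\<phi> t)"
    using kil unfolding killing_field_def by auto
  obtain \<gamma> d where d: "d > 0" "smooth_on {-d<..<d} \<gamma>" "\<And>t. t \<in> {-d<..<d} \<Longrightarrow> \<gamma> t \<in> M"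
    and \<gamma>0: "\<gamma> 0 = p" and \<gamma>': "(\<gamma> has_vector_derivative u) (at 0)"
    using u unfolding tangent_space_def curve_through_def by auto
  have u_eq: "dir_deriv \<gamma> 1 0 = u"
    using dir_deriv_eq[OF \<gamma>'[unfolded has_vector_derivative_def]] by simp
  have "\<exists>w. \<forall>t. ((\<lambda>s. \<phi> t (\<gamma> s)) has_vector_derivative w t) (at 0) \<and> norm (w t) = norm u"
  proof (intro choice allI)
    fix t
    have 0: "0 \<in> {-d<..<d}" using d(1) by auto
    obtain v where "((\<lambda>s. \<phi> t (\<gamma> s)) has_vector_derivative v) (at 0)" "norm v = norm (dir_deriv \<gamma> 1 0)"
      by (rule riemannian_isometry_curve[OF iso d(2,3) 0])
    then show "\<exists>v. ((\<lambda>s. \<phi> t (\<gamma> s)) has_vector_derivative v) (at 0) \<and> norm v = norm u"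
      using u_eq by auto
  qed
  then obtain w where w: "\<And>t. ((\<lambda>s. \<phi> t (\<gamma> s)) has_vector_derivative w t) (at 0)" "\<And>t. norm (w t) = norm u"
    by blast
  have w0: "w 0 = u"
  proof -
    have "((\<lambda>s. \<phi> 0 (\<gamma> s)) has_vector_derivative u) (at 0)"
      by (rule has_vector_derivative_transform_within_open[OF \<gamma>', of "{-d<..<d}"]) (use d flow0 in auto)
    then show ?thesis using w(1)[of 0] vector_derivative_unique_at by blast
  qed
  define L where "L a = dir_deriv \<xi>' a p" for a
  have linL: "linear L" using smooth_on_linear_dir_deriv[OF ext(1,2)] by (simp add: L_def[abs_def])
  then have blL: "bounded_linear L" by (simp add: linear_linear)
  obtain K where K: "K > 0" "\<And>x. norm (L x) \<le> K * norm x" using linear_bounded_pos[OF linL] by blast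
  have "compact ((\<lambda>s. dir_deriv \<gamma> 1 s) ` {-d/2..d/2})"
    using smooth_on_continuous_on[OF smooth_on_dir_deriv[OF d(2)]] d(1)
    by (intro compact_continuous_image continuous_on_subset[where t = "{-d/2..d/2}"]) auto
  then obtain C where C: "C > 0" "\<And>s. s \<in> {-d/2..d/2} \<Longrightarrow> norm (dir_deriv \<gamma> 1 s) \<le> C"
    using compact_imp_bounded bounded_pos by (metis (no_types, lifting) imageI)
  \<comment> \<open>The curve transported to time \<open>t\<close> has the same speed as
    \<open>\<gamma>\<close>, which makes the Lipschitz constant independent of
    \<open>t\<close>.\<close>
  have lip: "norm (\<phi> t (\<gamma> s) - \<phi> t p) \<le> C * \<bar>s\<bar>" if s: "s \<in> {-d/2..d/2}" for s t
  proof -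
    have "\<exists>f'. \<forall>s\<in>{-d/2..d/2}. ((\<lambda>s. \<phi> t (\<gamma> s)) has_vector_derivative f' s) (at s) \<and> norm (f' s) \<le> C"
    proof (intro bchoice ballI)
      fix s assume s: "s \<in> {-d/2..d/2}"
      then have s': "s \<in> {-d<..<d}" using d(1) by auto
      obtain v where "((\<lambda>s. \<phi> t (\<gamma> s)) has_vector_derivative v) (at s)" "norm v = norm (dir_deriv \<gamma> 1 s)"
        by (rule riemannian_isometry_curve[OF iso d(2,3) s'])
      then show "\<exists>w. ((\<lambda>s. \<phi> t (\<gamma> s)) has_vector_derivative w) (at s) \<and> norm w \<le> C"
        using C(2)[OF s] by auto
    qed
    then obtain f' where f': "\<And>s. s\<in>{-d/2..d/2} \<Longrightarrow> ((\<lambda>s. \<phi> t (\<gamma> s)) has_vector_derivative f' s) (at s) \<and> norm (f' s) \<le> C"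
      by blast
    have "norm (\<phi> t (\<gamma> s) - \<phi> t (\<gamma> 0)) \<le> C * \<bar>s - 0\<bar>"
      by (rule vector_derivative_bound[where S = "{-d/2..d/2}" and f' = f']) (use f' s d(1) in auto)
    then show ?thesis using \<gamma>0 by simp
  qed
  have \<gamma>lim: "((\<lambda>s. (\<gamma> s - p) /\<^sub>R s) \<longlongrightarrow> u) (at 0)"
    using has_vector_derivative_quotient[OF \<gamma>'] \<gamma>0 by simp
  \<comment> \<open>\<open>flow_variation_estimate\<close> is applied to the points \<open>p\<close>
    and \<open>\<gamma> s\<close> with the bound \<open>C * \<bar>s\<bar>\<close>. Dividing by
    \<open>s\<close> and letting \<open>s\<close> tend to 0 turns the differences of points into the
    vectors \<open>u\<close> and \<open>w t\<close>.\<close>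
  have est: "\<exists>\<delta>>0. \<forall>t. \<bar>t\<bar> < \<delta> \<longrightarrow> norm (w t - w 0 - t *\<^sub>R L u) \<le> (\<epsilon> + K * (K + \<epsilon>) * \<bar>t\<bar>) * C * \<bar>t\<bar>"
    if \<epsilon>: "\<epsilon> > 0" for \<epsilon>
  proof -
    obtain \<rho> where \<rho>: "\<rho> > 0" "ball p \<rho> \<subseteq> U"
      "\<And>x y. x \<in> ball p \<rho> \<Longrightarrow> y \<in> ball p \<rho> \<Longrightarrow> norm (\<xi>' y - \<xi>' x - dir_deriv \<xi>' (y - x) p) \<le> \<epsilon> * norm (y - x)"
      by (rule smooth_on_linearization[OF ext(1,2) \<epsilon>]) blast
    show ?thesis
    proof (intro exI[of _ "\<rho>/2"] conjI allI impI)
      fix t assume t: "\<bar>t\<bar> < \<rho>/2"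
      let ?q = "\<lambda>s. (\<phi> t (\<gamma> s) - \<phi> t p - (\<gamma> s - p) - t *\<^sub>R L (\<gamma> s - p)) /\<^sub>R s"
      let ?R = "(\<epsilon> + K * (K + \<epsilon>) * \<bar>t\<bar>) * C * \<bar>t\<bar>"
      have "((\<lambda>s. (\<phi> t (\<gamma> s) - \<phi> t p) /\<^sub>R s) \<longlongrightarrow> w t) (at 0)"
        using has_vector_derivative_quotient[OF w(1)[of t]] \<gamma>0 by simp
      moreover have "((\<lambda>s. L ((\<gamma> s - p) /\<^sub>R s)) \<longlongrightarrow> L u) (at 0)"
        by (rule bounded_linear.tendsto[OF blL \<gamma>lim])
      ultimately have "((\<lambda>s. (\<phi> t (\<gamma> s) - \<phi> t p) /\<^sub>R s - (\<gamma> s - p) /\<^sub>R s - t *\<^sub>R L ((\<gamma> s - p) /\<^sub>R s))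
          \<longlongrightarrow> w t - u - t *\<^sub>R L u) (at 0)"
        using \<gamma>lim by (intro tendsto_intros)
      moreover have "(\<lambda>s. (\<phi> t (\<gamma> s) - \<phi> t p) /\<^sub>R s - (\<gamma> s - p) /\<^sub>R s - t *\<^sub>R L ((\<gamma> s - p) /\<^sub>R s)) = ?q"
        by (simp only: linear_cmul[OF linL]) (simp add: scaleR_diff_right mult.commute)
      ultimately have 1: "(?q \<longlongrightarrow> w t - u - t *\<^sub>R L u) (at 0)" by simp
      have "isCont \<gamma> 0" using \<gamma>' has_vector_derivative_continuous by blast
      then have "\<forall>\<^sub>F s in at 0. \<gamma> s \<in> ball p (\<rho>/2)"
        using \<gamma>0 \<rho>(1) topological_tendstoD[of \<gamma> p "at 0" "ball p (\<rho>/2)"] by (simp add: isCont_def)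
      moreover have "\<forall>\<^sub>F s in at (0::real). s \<in> {-d/2<..<d/2}"
        using d(1) by (intro eventually_at_in_open') auto
      moreover have "\<forall>\<^sub>F s in at (0::real). s \<noteq> 0" by (rule eventually_neq_at_within)
      ultimately have 2: "\<forall>\<^sub>F s in at 0. norm (?q s) \<le> ?R"
      proof eventually_elim
        case (elim s)
        have "norm (\<phi> t (\<gamma> s) - \<phi> t p - (\<gamma> s - p) - t *\<^sub>R L (\<gamma> s - p))
            \<le> (\<epsilon> + K * (K + \<epsilon>) * \<bar>t\<bar>) * (C * \<bar>s\<bar>) * \<bar>t\<bar>"
        proof (rule flow_variation_estimate[where M = M and \<phi> = \<phi> and \<xi> = \<xi> and \<xi>' = \<xi>' and p = p and \<rho> = \<rho>])
          show "\<xi> x = \<xi>' x" if "x \<in> M" "x \<in> ball p \<rho>" for x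
            using that ext(3) \<rho>(2) by auto
          show "norm (\<phi> t (\<gamma> s) - \<phi> t p) \<le> C * \<bar>s\<bar>" for t
            by (rule lip) (use elim in auto)
        qed (use flow flow0 unit linL K \<rho>(1) \<rho>(3)[folded L_def] p elim d t \<epsilon> in auto)
        then have "norm (\<phi> t (\<gamma> s) - \<phi> t p - (\<gamma> s - p) - t *\<^sub>R L (\<gamma> s - p)) \<le> ?R * \<bar>s\<bar>"
          by (simp add: mult_ac)
        then show ?case using elim(3) by (simp add: divide_inverse[symmetric] mult.commute[of "inverse \<bar>s\<bar>"] pos_divide_le_eq)
      qed
      have "norm (w t - u - t *\<^sub>R L u) \<le> ?R"
        by (rule Lim_norm_ubound[OF _ 1 2]) simp
      then show "norm (w t - w 0 - t *\<^sub>R L u) \<le> ?R" using w0 by simp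
    qed (use \<rho> in auto)
  qed
  have "(w has_vector_derivative L u) (at 0)"
    unfolding has_vector_derivative_def has_derivative_at_alt
  proof (intro conjI allI impI)
    show "bounded_linear (\<lambda>x. x *\<^sub>R L u)" by (rule bounded_linear_scaleR_left)
    fix e :: real assume e: "e > 0"
    \<comment> \<open>Half of \<open>e\<close> is spent on the linearization error, half on the term
      quadratic in the time, which the radius \<open>\<epsilon> / Q\<close> below controls.\<close>
    define \<epsilon> where "\<epsilon> = e / (2 * C)"
    have \<epsilon>: "\<epsilon> > 0" using e C(1) by (simp add: \<epsilon>_def)
    obtain \<delta> where \<delta>: "\<delta> > 0"
      "\<And>t. \<bar>t\<bar> < \<delta> \<Longrightarrow> norm (w t - w 0 - t *\<^sub>R L u) \<le> (\<epsilon> + K * (K + \<epsilon>) * \<bar>t\<bar>) * C * \<bar>t\<bar>"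
      using est[OF \<epsilon>] by blast
    define Q where "Q = K * (K + \<epsilon>)"
    have Q: "Q > 0" using K(1) \<epsilon> by (simp add: Q_def)
    show "\<exists>d>0. \<forall>y. norm (y - 0) < d \<longrightarrow> norm (w y - w 0 - (y - 0) *\<^sub>R L u) \<le> e * norm (y - 0)"
    proof (intro exI[of _ "min \<delta> (\<epsilon> / Q)"] conjI allI impI)
      show "0 < min \<delta> (\<epsilon> / Q)" using \<delta>(1) \<epsilon> Q by simp
      fix y :: real assume y: "norm (y - 0) < min \<delta> (\<epsilon> / Q)"
      then have "Q * \<bar>y\<bar> \<le> \<epsilon>" using Q by (simp add: pos_less_divide_eq mult.commute)
      then have "(\<epsilon> + Q * \<bar>y\<bar>) * C * \<bar>y\<bar> \<le> (2 * \<epsilon>) * C * \<bar>y\<bar>"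
        using C(1) by (intro mult_right_mono) auto
      also have "(2 * \<epsilon>) * C = e" using C(1) by (simp add: \<epsilon>_def)
      finally show "norm (w y - w 0 - (y - 0) *\<^sub>R L u) \<le> e * norm (y - 0)"
        using \<delta>(2)[of y] y by (simp add: Q_def)
    qed
  qed
  then have "((\<lambda>t. w t \<bullet> w t) has_vector_derivative (w 0 \<bullet> L u + L u \<bullet> w 0)) (at 0)"
    unfolding has_vector_derivative_def
    using has_derivative_inner[of w "\<lambda>h. h *\<^sub>R L u" 0 UNIV w "\<lambda>h. h *\<^sub>R L u"]
    by (simp add: algebra_simps)
  moreover have "(\<lambda>t. w t \<bullet> w t) = (\<lambda>t. u \<bullet> u)" using w(2) by (simp add: norm_eq)
  ultimately have "w 0 \<bullet> L u + L u \<bullet> w 0 = 0"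
    using vector_derivative_at has_vector_derivative_const by metis
  then show ?thesis using w0 by (simp add: L_def inner_commute)
qed

subsection \<open>Local rigidity\<close>

text \<open>This is where the dimension enters: three orthogonality conditions leave a nonzero
  vector. It supplies the triple of tangent vectors used in \<open>D2_e_zero\<close>.\<close>

lemma exists_nonzero_orthogonal3:
  fixes u v w :: "'a::euclidean_space"
  assumes "DIM('a) \<ge> 4"
  obtains x where "x \<noteq> 0" "x \<bullet> u = 0" "x \<bullet> v = 0" "x \<bullet> w = 0"
proof -
  have "dim {u, v, w} \<le> card {u, v, w}" by (rule dim_le_card') simp
  also have "\<dots> \<le> 3" by (simp add: card_insert_if)
  finally have "dim {u, v, w} < DIM('a)" using assms by linarith
  then obtain x where x: "x \<noteq> 0" "\<And>y. y \<in> span {u, v, w} \<Longrightarrow> orthogonal x y"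
    using orthogonal_to_subspace_exists[of "{u, v, w}"] by blast
  have "x \<bullet> y = 0" if "y \<in> {u, v, w}" for y
    using x(2)[OF span_base[OF that]] by (simp add: orthogonal_def)
  then show ?thesis using that x(1) by simp
qed

text \<open>
  The pullback of a hypersurface and of a unit Killing field by a chart \<open>r\<close> with
  \<open>dr(a) = a - (a \<bullet> N) e\<close>. The normal \<open>N\<close> is scaled so that \<open>N \<bullet> e = 1\<close>; then the second derivative
  of the chart is \<open>h a b\<close> times the constant vector \<open>e\<close>, and \<open>b0\<close> below is the value \<open>B e\<close> forced by
  skew-symmetry.
\<close>

locale killing_chart =
  fixes U :: "'a::euclidean_space set" and N \<Xi> :: "'a \<Rightarrow> 'a" and e :: 'a
  assumes smN: "smooth_on U N" and sm\<Xi>: "smooth_on U \<Xi>"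
    and Ne: "y \<in> U \<Longrightarrow> N y \<bullet> e = 1"
    and Nsym: "y \<in> U \<Longrightarrow> a \<bullet> dir_deriv N b y = b \<bullet> dir_deriv N a y"
    and \<Xi>e: "y \<in> U \<Longrightarrow> dir_deriv \<Xi> e y = 0"
    and \<Xi>N: "y \<in> U \<Longrightarrow> \<Xi> y \<bullet> N y = 0"
    and \<Xi>_unit: "y \<in> U \<Longrightarrow> \<Xi> y \<bullet> \<Xi> y = 1"
    and killing: "y \<in> U \<Longrightarrow>
      dir_deriv \<Xi> a y \<bullet> (b - (b \<bullet> N y) *\<^sub>R e) + dir_deriv \<Xi> b y \<bullet> (a - (a \<bullet> N y) *\<^sub>R e) = 0"
begin

text \<open>The derivative of the chart in direction \<open>a\<close>, that is, the projection of
  \<open>a\<close> to the tangent space along \<open>e\<close>.\<close>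

definition X :: "'a \<Rightarrow> 'a \<Rightarrow> 'a" where "X a y = a + ((- a) \<bullet> N y) *\<^sub>R e"

definition h :: "'a \<Rightarrow> 'a \<Rightarrow> 'a \<Rightarrow> real" where "h a b y = dir_deriv N b y \<bullet> (- a)"

abbreviation D1 where "D1 \<equiv> dir_deriv \<Xi>"

abbreviation D2 where "D2 a \<equiv> dir_deriv (D1 a)"

definition b0 :: "'a \<Rightarrow> 'a" where "b0 y = (\<Sum>b\<in>Basis. (D1 b y \<bullet> (- e)) *\<^sub>R b)"

text \<open>On tangent vectors this is the derivative of the field; on \<open>e\<close> it is
  \<open>b0\<close>, because \<open>D1 e\<close> vanishes and \<open>N y \<bullet> e = 1\<close>.
  Unlike \<open>D1\<close> it is skew on the whole ambient space.\<close>

definition B :: "'a \<Rightarrow> 'a \<Rightarrow> 'a" where "B y a = D1 a y + (N y \<bullet> a) *\<^sub>R b0 y"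

lemma open_U: "open U"
  using smN smooth_on_open by blast

lemma smX: "smooth_on U (X a)"
  unfolding X_def[abs_def]
  by (intro smooth_on_add smooth_on_scaleR smooth_on_inner smooth_on_const smN open_U)

lemma smD1: "smooth_on U (D1 a)"
  by (rule smooth_on_dir_deriv[OF sm\<Xi>])

lemma smD2: "smooth_on U (D2 a b)"
  by (rule smooth_on_dir_deriv[OF smD1])

lemma smh: "smooth_on U (h a b)"
  unfolding h_def[abs_def]
  by (intro smooth_on_inner smooth_on_const smooth_on_dir_deriv smN open_U)

lemma smb0: "smooth_on U b0"
  unfolding b0_def[abs_def]
  by (intro smooth_on_sum smooth_on_scaleR smooth_on_inner smooth_on_const smD1 open_U)

lemma smB: "smooth_on U (\<lambda>y. B y a)"
  unfolding B_def[abs_def]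
  by (intro smooth_on_add smooth_on_scaleR smooth_on_inner smooth_on_const smD1 smN smb0 open_U)

lemma dir_deriv_X: "y \<in> U \<Longrightarrow> dir_deriv (X a) b y = h a b y *\<^sub>R e"
proof -
  assume y: "y \<in> U"
  have "((\<lambda>y. a + (- a \<bullet> N y) *\<^sub>R e) has_derivative (\<lambda>b. (- a \<bullet> dir_deriv N b y) *\<^sub>R e)) (at y)"
    using smooth_on_has_derivative[OF smN y] by (auto intro!: derivative_eq_intros)
  from dir_deriv_eq[OF this, of b] show ?thesis
    by (simp add: X_def[abs_def] h_def inner_commute)
qed

lemma h_sym: "y \<in> U \<Longrightarrow> h a b y = h b a y"
  using Nsym[of y a b] by (simp add: h_def inner_commute)

lemma D2_sym: "y \<in> U \<Longrightarrow> D2 a b y = D2 b a y"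
  by (rule dir_deriv_commute[OF sm\<Xi>])

lemma linear_D1: "y \<in> U \<Longrightarrow> linear (\<lambda>a. D1 a y)"
  by (rule smooth_on_linear_dir_deriv[OF sm\<Xi>])

lemma linear_D2: "y \<in> U \<Longrightarrow> linear (\<lambda>b. D2 a b y)"
  by (rule smooth_on_linear_dir_deriv[OF smD1])

lemma decompose: "w = X w y + (w \<bullet> N y) *\<^sub>R e"
  by (simp add: X_def)

lemma X_tangent: "a \<bullet> N y = 0 \<Longrightarrow> X a y = a"
  by (simp add: X_def)

lemma X_orth: "y \<in> U \<Longrightarrow> X a y \<bullet> N y = 0"
  using Ne[of y] by (simp add: X_def inner_diff_left inner_commute[of e])

lemma killing_X: "y \<in> U \<Longrightarrow> D1 a y \<bullet> X b y + D1 b y \<bullet> X a y = 0"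
  using killing[of y a b] by (simp add: X_def)

text \<open>The expression is symmetric in \<open>a\<close> and \<open>c\<close> because second
  derivatives commute, and skew in \<open>a\<close> and \<open>b\<close> by differentiating the
  Killing equation. An expression in three arguments with both properties vanishes.\<close>

lemma first_order:
  assumes y: "y \<in> U"
  shows "D2 a c y \<bullet> X b y + h a c y * (D1 b y \<bullet> e) = 0"
proof -
  define T where "T a c b = D2 a c y \<bullet> X b y + h a c y * (D1 b y \<bullet> e)" for a c b
  have sym: "T a c b = T c a b" for a b c
    using D2_sym[OF y, of a c] h_sym[OF y, of a c] by (simp add: T_def)
  have skew: "T a c b = - T b c a" for a b c
  proof -
    have "dir_deriv (\<lambda>y. D1 a y \<bullet> X b y + D1 b y \<bullet> X a y) c y = 0"
      by (rule dir_deriv_const_on[OF open_U killing_X y])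
    moreover have "dir_deriv (\<lambda>y. D1 a y \<bullet> X b y + D1 b y \<bullet> X a y) c y = T a c b + T b c a"
      by (simp add: dir_deriv_add[OF smooth_on_inner[OF smD1 smX] smooth_on_inner[OF smD1 smX] y]
          dir_deriv_inner[OF smD1 smX y] dir_deriv_X[OF y] T_def)
    ultimately show ?thesis by simp
  qed
  have "T a c b = - T a c b" using sym skew by metis
  then show ?thesis by (simp add: T_def)
qed

text \<open>Differentiating \<open>first_order\<close> along \<open>d\<close> and exchanging
  \<open>c\<close> and \<open>d\<close> cancels the third derivatives of the field and the second
  derivatives of \<open>N\<close>, both symmetric in these directions.\<close>

lemma linearized_gauss:
  assumes y: "y \<in> U"
  shows "(D2 a c y \<bullet> e) * h b d y + h a c y * (D2 b d y \<bullet> e)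
       = (D2 a d y \<bullet> e) * h b c y + h a d y * (D2 b c y \<bullet> e)"
proof -
  have *: "dir_deriv (D2 a c) d y \<bullet> X b y + (D2 a c y \<bullet> e) * h b d y
      + h a c y * (D2 b d y \<bullet> e) + (dir_deriv (dir_deriv N c) d y \<bullet> (- a)) * (D1 b y \<bullet> e) = 0" for c d
  proof -
    have sm: "smooth_on U (\<lambda>y. D1 b y \<bullet> e)" by (intro smooth_on_inner smD1 smooth_on_const open_U)
    have "dir_deriv (\<lambda>y. D2 a c y \<bullet> X b y + h a c y * (D1 b y \<bullet> e)) d y = 0"
      by (rule dir_deriv_const_on[OF open_U first_order y])
    moreover have "dir_deriv (h a c) d y = dir_deriv (dir_deriv N c) d y \<bullet> (- a)"
      unfolding h_def[abs_def] by (rule dir_deriv_inner_const[OF smooth_on_dir_deriv[OF smN] y])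
    moreover have "smooth_on U (\<lambda>y. h a c y * (D1 b y \<bullet> e))"
      using smooth_on_inner[OF smh sm] by (simp add: inner_real_def)
    ultimately show ?thesis
      by (simp add: dir_deriv_add[OF smooth_on_inner[OF smD2 smX] _ y] dir_deriv_inner[OF smD2 smX y]
          dir_deriv_mult[OF smh sm y] dir_deriv_X[OF y] dir_deriv_inner_const[OF smD1 y]) (simp add: mult.commute)
  qed
  have "dir_deriv (D2 a c) d y = dir_deriv (D2 a d) c y" by (rule dir_deriv_commute[OF smD1 y])
  moreover have "dir_deriv (dir_deriv N c) d y = dir_deriv (dir_deriv N d) c y"
    by (rule dir_deriv_commute[OF smN y])
  ultimately show ?thesis using *[of c d] *[of d c] by simp
qed

lemma D1_orth: "y \<in> U \<Longrightarrow> D1 a y \<bullet> \<Xi> y = 0"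
proof -
  assume y: "y \<in> U"
  have "dir_deriv (\<lambda>y. \<Xi> y \<bullet> \<Xi> y) a y = 0" by (rule dir_deriv_const_on[OF open_U \<Xi>_unit y])
  then show ?thesis using dir_deriv_inner[OF sm\<Xi> sm\<Xi> y] by (simp add: inner_commute)
qed

text \<open>The derivative of the field along itself turns out to be
  \<open>\<kappa> y *\<^sub>R N y\<close>: the flow lines are geodesics, and this is their normal
  acceleration measured against \<open>N\<close>.\<close>

definition \<kappa> :: "'a \<Rightarrow> real" where "\<kappa> y = D1 (\<Xi> y) y \<bullet> e"

text \<open>Differentiating the unit length condition twice turns the Gram form into minus the
  second derivative paired with the field, and \<open>first_order\<close> evaluates that
  pairing.\<close>

lemma gram_eq:
  assumes y: "y \<in> U"
  shows "D1 a y \<bullet> D1 b y = h a b y * \<kappa> y"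
proof -
  have "dir_deriv (\<lambda>y. D1 a y \<bullet> \<Xi> y) b y = 0" by (rule dir_deriv_const_on[OF open_U D1_orth y])
  then have "D1 a y \<bullet> D1 b y + D2 a b y \<bullet> \<Xi> y = 0"
    using dir_deriv_inner[OF smD1 sm\<Xi> y] by simp
  moreover have "D2 a b y \<bullet> \<Xi> y + h a b y * \<kappa> y = 0"
    using first_order[OF y, of a b "\<Xi> y"] X_tangent[OF \<Xi>N[OF y]] by (simp add: \<kappa>_def)
  ultimately show ?thesis by linarith
qed

lemma b0_inner:
  assumes y: "y \<in> U"
  shows "b0 y \<bullet> a = - (D1 a y \<bullet> e)"
proof -
  have "D1 a y = (\<Sum>b\<in>Basis. (a \<bullet> b) *\<^sub>R D1 b y)"
    using linear_sum[OF linear_D1[OF y], of "\<lambda>b. (a \<bullet> b) *\<^sub>R b" Basis] linear_cmul[OF linear_D1[OF y]]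
    by (simp add: euclidean_representation)
  then have "D1 a y \<bullet> e = (\<Sum>b\<in>Basis. (a \<bullet> b) * (D1 b y \<bullet> e))"
    by (simp add: inner_sum_left)
  then show ?thesis
    by (simp add: b0_def inner_sum_left inner_sum_right sum_negf inner_commute[of _ a] mult.commute)
qed

lemma b0_e: "y \<in> U \<Longrightarrow> b0 y \<bullet> e = 0"
  by (simp add: b0_inner \<Xi>e)

lemma B_skew:
  assumes y: "y \<in> U"
  shows "B y a \<bullet> b = - (a \<bullet> B y b)"
proof -
  have D1_inner: "D1 a y \<bullet> b = D1 a y \<bullet> X b y - (N y \<bullet> b) * (b0 y \<bullet> a)" for a b
    by (subst decompose[of b y]) (simp add: inner_add_right b0_inner[OF y] inner_commute[of "N y"])
  have "B y a \<bullet> b + B y b \<bullet> a = D1 a y \<bullet> b + D1 b y \<bullet> a + (N y \<bullet> a) * (b0 y \<bullet> b) + (N y \<bullet> b) * (b0 y \<bullet> a)"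
    by (simp add: B_def inner_add_left)
  also have "\<dots> = 0" unfolding D1_inner[of a b] D1_inner[of b a] using killing_X[OF y, of a b] by simp
  finally show ?thesis by (simp add: inner_commute)
qed

lemma B_linear: "y \<in> U \<Longrightarrow> linear (B y)"
proof -
  assume y: "y \<in> U"
  have "linear (\<lambda>a. (N y \<bullet> a) *\<^sub>R b0 y)"
    by (intro linearI) (simp_all add: inner_add_right algebra_simps)
  then show ?thesis unfolding B_def[abs_def] using linear_compose_add[OF linear_D1[OF y]] by blast
qed

lemma B_tangent: "a \<bullet> N y = 0 \<Longrightarrow> B y a = D1 a y"
  by (simp add: B_def inner_commute)

lemma D1_eq_B:
  assumes y: "y \<in> U"
  shows "D1 a y = B y (X a y)"
proof -
  have "D1 (X a y) y = D1 a y"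
    using \<Xi>e[OF y] by (simp add: X_def linear_add[OF linear_D1[OF y]] linear_cmul[OF linear_D1[OF y]]
        linear_diff[OF linear_D1[OF y]])
  then show ?thesis using B_tangent[OF X_orth[OF y]] by simp
qed

text \<open>By the Killing equation and unit length, the derivative of the field along itself is
  \<open>\<kappa>\<close> times \<open>N\<close>, and \<open>\<kappa>\<close> is nonzero because
  \<open>h\<close> does not vanish on the field. Skewness makes a kernel vector \<open>a\<close> of
  \<open>B\<close> orthogonal to \<open>N\<close>, and then \<open>gram_eq\<close> forces
  \<open>h a a\<close> to vanish.\<close>

lemma inj_B_if_definite:
  assumes y: "y \<in> U" and def: "\<And>a. a \<noteq> 0 \<Longrightarrow> a \<bullet> N y = 0 \<Longrightarrow> h a a y \<noteq> 0"
  shows "inj (B y)"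
proof -
  let ?w = "D1 (\<Xi> y) y"
  have w: "?w \<bullet> X a y = 0" for a
    using killing_X[OF y, of "\<Xi> y" a] X_tangent[OF \<Xi>N[OF y]] D1_orth[OF y] by simp
  have w_eq: "?w = \<kappa> y *\<^sub>R N y"
  proof -
    have "?w \<bullet> v = (\<kappa> y *\<^sub>R N y) \<bullet> v" for v
      using w[of v] by (subst decompose[of v y]) (simp add: inner_add_right \<kappa>_def inner_commute Ne[OF y]
        X_orth[OF y, of v, simplified inner_commute])
    then show ?thesis by (metis inner_diff_left inner_eq_zero_iff right_minus_eq)
  qed
  have "dir_deriv (\<lambda>y. \<Xi> y \<bullet> N y) (\<Xi> y) y = 0" by (rule dir_deriv_const_on[OF open_U \<Xi>N y])
  then have "?w \<bullet> N y = h (\<Xi> y) (\<Xi> y) y"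
    using dir_deriv_inner[OF sm\<Xi> smN y] by (simp add: h_def inner_commute)
  moreover have "\<Xi> y \<noteq> 0" using \<Xi>_unit[OF y] by auto
  ultimately have "\<kappa> y \<noteq> 0" using def[of "\<Xi> y"] \<Xi>N[OF y] w_eq by auto
  have "a = 0" if "B y a = 0" for a
  proof (rule ccontr)
    assume "a \<noteq> 0"
    have "a \<bullet> B y (\<Xi> y) = 0" using B_skew[OF y, of a "\<Xi> y"] that by simp
    then have "a \<bullet> N y = 0" using B_tangent[OF \<Xi>N[OF y]] w_eq \<open>\<kappa> y \<noteq> 0\<close> by simp
    then have "D1 a y = 0" using B_tangent that by simp
    then show False
      using gram_eq[OF y, of a a] def[OF \<open>a \<noteq> 0\<close> \<open>a \<bullet> N y = 0\<close>] \<open>\<kappa> y \<noteq> 0\<close> by simp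
  qed
  then show ?thesis using linear_injective_0[OF B_linear[OF y]] by blast
qed

text \<open>
  Where \<open>B\<close> is injective the form \<open>D1 a \<bullet> D1 b\<close> is positive definite on the tangent space and
  proportional to \<open>h\<close>; evaluating \<open>linearized_gauss\<close> on three vectors orthogonal for this form
  shows that the normal part of the second derivative of the field vanishes.
\<close>

lemma D2_e_zero:
  assumes y: "y \<in> U" and inj: "inj (B y)" and dim: "DIM('a) \<ge> 4"
  shows "D2 a b y \<bullet> e = 0"
proof -
  define \<beta> where "\<beta> a b = D2 a b y \<bullet> e" for a b
  define H where "H a b = D1 a y \<bullet> D1 b y" for a b
  have \<beta>_sym: "\<beta> a b = \<beta> b a" for a b using D2_sym[OF y] by (simp add: \<beta>_def)
  have \<beta>_add: "\<beta> a (b + c) = \<beta> a b + \<beta> a c" for a b c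
    by (simp add: \<beta>_def linear_add[OF linear_D2[OF y]] inner_add_left)
  have \<beta>_scale: "\<beta> a (s *\<^sub>R b) = s * \<beta> a b" for a b s
    by (simp add: \<beta>_def linear_cmul[OF linear_D2[OF y]])
  have H_sym: "H a b = H b a" for a b by (simp add: H_def inner_commute)
  \<comment> \<open>Multiplication by \<open>\<kappa> y\<close> replaces \<open>h\<close> by
    \<open>H\<close>, which is positive definite on the tangent space.\<close>
  have gauss: "\<beta> a c * H b d + H a c * \<beta> b d = \<beta> a d * H b c + H a d * \<beta> b c" for a b c d
  proof -
    have "(\<beta> a c * h b d y + h a c y * \<beta> b d) * \<kappa> y = (\<beta> a d * h b c y + h a d y * \<beta> b c) * \<kappa> y"
      using linearized_gauss[OF y, of a c b d] by (simp add: \<beta>_def)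
    then show ?thesis unfolding H_def gram_eq[OF y] by (simp add: algebra_simps)
  qed
  have H_pos: "H a a > 0" if "a \<noteq> 0" "a \<bullet> N y = 0" for a
  proof -
    have "B y a \<noteq> 0" using inj that(1) linear_injective_0[OF B_linear[OF y]] by blast
    then show ?thesis using B_tangent[OF that(2)] by (simp add: H_def)
  qed
  \<comment> \<open>By skewness of \<open>B\<close>, orthogonality for \<open>H\<close> is ordinary
    orthogonality to \<open>B y (B y a)\<close>.\<close>
  have H_orth: "H a b = 0" if "a \<bullet> N y = 0" "b \<bullet> N y = 0" "b \<bullet> B y (B y a) = 0" for a b
    using B_skew[OF y, of b "B y a"] that B_tangent by (simp add: H_def inner_commute)
  have diag: "\<beta> a a * H b b + H a a * \<beta> b b = 0" if "H a b = 0" for a b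
    using gauss[of a a b b] that H_sym[of a b] by simp
  \<comment> \<open>For three nonzero tangent vectors orthogonal with respect to \<open>H\<close>,
    the diagonal quotients of \<open>\<beta>\<close> by \<open>H\<close> have pairwise sums zero, so
    each of them is zero.\<close>
  have \<beta>_diag: "\<beta> a a = 0" if a: "a \<bullet> N y = 0" for a
  proof (cases "a = 0")
    case True
    then show ?thesis using \<beta>_scale[of a 0 a] by simp
  next
    case False
    obtain b where b: "b \<noteq> 0" "b \<bullet> N y = 0" "b \<bullet> B y (B y a) = 0"
      by (rule exists_nonzero_orthogonal3[OF dim, of "N y" "B y (B y a)"])
    obtain c where c: "c \<noteq> 0" "c \<bullet> N y = 0" "c \<bullet> B y (B y a) = 0" "c \<bullet> B y (B y b) = 0"
      by (rule exists_nonzero_orthogonal3[OF dim, of "N y" "B y (B y a)" "B y (B y b)"])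
    have ab: "\<beta> a a * H b b + H a a * \<beta> b b = 0" and ac: "\<beta> a a * H c c + H a a * \<beta> c c = 0"
      and bc: "\<beta> b b * H c c + H b b * \<beta> c c = 0"
      using diag[OF H_orth[OF a b(2,3)]] diag[OF H_orth[OF a c(2,3)]] diag[OF H_orth[OF b(2) c(2,4)]] .
    have "2 * H b b * H c c * \<beta> a a = H c c * (\<beta> a a * H b b + H a a * \<beta> b b)
      + H b b * (\<beta> a a * H c c + H a a * \<beta> c c) - H a a * (\<beta> b b * H c c + H b b * \<beta> c c)"
      by (simp add: algebra_simps)
    then have "2 * H b b * H c c * \<beta> a a = 0" using ab ac bc by simp
    then show ?thesis using H_pos[OF b(1,2)] H_pos[OF c(1,2)] by simp
  qed
  have \<beta>_tan: "\<beta> a b = 0" if "a \<bullet> N y = 0" "b \<bullet> N y = 0" for a b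
  proof -
    have "\<beta> (a + b) (a + b) = \<beta> a a + 2 * \<beta> a b + \<beta> b b"
      using \<beta>_add[of "a + b" a b] \<beta>_sym[of "a + b" a] \<beta>_sym[of "a + b" b] \<beta>_add[of a a b] \<beta>_add[of b a b]
        \<beta>_sym[of a b] by simp
    then show ?thesis
      using \<beta>_diag[of "a + b"] \<beta>_diag[OF that(1)] \<beta>_diag[OF that(2)] that by (simp add: inner_add_left)
  qed
  have \<beta>e: "\<beta> a e = 0" for a
  proof -
    have "D2 e a y = 0" by (rule dir_deriv_const_on[OF open_U \<Xi>e y])
    then have "\<beta> e a = 0" by (simp add: \<beta>_def)
    then show ?thesis by (simp only: \<beta>_sym[of a e])
  qed
  \<comment> \<open>\<open>\<beta>\<close> ignores components along \<open>e\<close>, so its values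
    on tangent vectors decide.\<close>
  have "\<beta> a b = \<beta> a (X b y)" for a b
    using \<beta>_add[of a "X b y" "(b \<bullet> N y) *\<^sub>R e", folded decompose] \<beta>_scale[of a "b \<bullet> N y" e] \<beta>e[of a]
    by simp
  from this[of a b] this[of "X b y" a] have "\<beta> a b = \<beta> (X a y) (X b y)"
    using \<beta>_sym[of a "X b y"] \<beta>_sym[of "X a y" "X b y"] by simp
  then show ?thesis using \<beta>_tan X_orth[OF y] by (simp add: \<beta>_def)
qed

text \<open>An injective linear map is bounded below by some \<open>c\<close>, and perturbations of
  operator norm less than \<open>c\<close> keep it injective. The continuous function
  \<open>g\<close> dominates the operator norm of the perturbation.\<close>

lemma inj_B_open:
  assumes y0: "y0 \<in> U" and inj: "inj (B y0)"
  obtains \<rho> where "\<rho> > 0" "ball y0 \<rho> \<subseteq> U" "\<And>y. y \<in> ball y0 \<rho> \<Longrightarrow> inj (B y)"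
proof -
  obtain c where c: "c > 0" "\<And>a. c * norm a \<le> norm (B y0 a)"
    using linear_inj_bounded_below_pos[OF B_linear[OF y0] inj] by blast
  define g where "g y = (\<Sum>b\<in>Basis. norm (B y b - B y0 b))" for y
  have "continuous_on U g"
    unfolding g_def using smooth_on_continuous_on[OF smB] by (intro continuous_intros)
  then have "isCont g y0" using y0 open_U continuous_on_eq_continuous_at by blast
  then have "\<forall>\<^sub>F y in nhds y0. dist (g y) (g y0) < c"
    using c(1) by (metis isCont_def tendsto_at_iff_tendsto_nhds tendstoD)
  moreover have "\<forall>\<^sub>F y in nhds y0. y \<in> U" using y0 open_U by (simp add: eventually_nhds_in_open)
  ultimately have "\<forall>\<^sub>F y in nhds y0. g y < c \<and> y \<in> U"
    by eventually_elim (simp add: g_def dist_real_def)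
  then obtain \<rho> where \<rho>: "\<rho> > 0" "\<And>y. dist y y0 < \<rho> \<Longrightarrow> g y < c \<and> y \<in> U"
    unfolding eventually_nhds_metric by blast
  have injB: "inj (B y)" if "y \<in> ball y0 \<rho>" for y
  proof -
    have y: "y \<in> U" "g y < c" using \<rho>(2)[of y] that by (auto simp: dist_commute)
    have lin: "linear (\<lambda>a. B y a - B y0 a)" using linear_compose_sub[OF B_linear[OF y(1)] B_linear[OF y0]] .
    have bnd: "norm (B y a - B y0 a) \<le> norm a * g y" for a
    proof -
      have eq: "B y a - B y0 a = (\<Sum>b\<in>Basis. (a \<bullet> b) *\<^sub>R (B y b - B y0 b))"
        using linear_sum[OF lin, of "\<lambda>b. (a \<bullet> b) *\<^sub>R b" Basis] linear_cmul[OF lin]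
        by (simp add: euclidean_representation)
      show ?thesis unfolding g_def sum_distrib_left eq
        by (rule sum_norm_le) (simp add: Basis_le_norm mult_right_mono)
    qed
    have "a = 0" if "B y a = 0" for a
    proof (rule ccontr)
      assume "a \<noteq> 0"
      have "c * norm a \<le> norm a * g y" using c(2)[of a] bnd[of a] that by simp
      moreover have "norm a * g y < norm a * c" using y(2) \<open>a \<noteq> 0\<close> by (intro mult_strict_left_mono) auto
      ultimately show False by (simp add: mult.commute)
    qed
    then show ?thesis using linear_injective_0[OF B_linear[OF y(1)]] by blast
  qed
  show ?thesis by (rule that[OF \<rho>(1) _ injB]) (use \<rho>(2) in \<open>auto simp: dist_commute\<close>)
qed

text \<open>Once \<open>b0\<close> is known to be locally constant, the derivative of
  \<open>B y a\<close> is \<open>D2 a c y - h a c y *\<^sub>R b0 y\<close>. Its pairing with tangent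
  vectors vanishes by \<open>first_order\<close>, its pairing with \<open>e\<close> by
  \<open>D2_e_zero\<close>.\<close>

lemma B_locally_constant:
  assumes y0: "y0 \<in> U" and inj: "inj (B y0)" and dim: "DIM('a) \<ge> 4"
  obtains \<rho> where "\<rho> > 0" "ball y0 \<rho> \<subseteq> U" "\<And>y a. y \<in> ball y0 \<rho> \<Longrightarrow> B y a = B y0 a"
proof -
  obtain \<rho> where \<rho>: "\<rho> > 0" "ball y0 \<rho> \<subseteq> U" "\<And>y. y \<in> ball y0 \<rho> \<Longrightarrow> inj (B y)"
    using inj_B_open[OF y0 inj] by blast
  have zero: "D2 a b y \<bullet> e = 0" if "y \<in> ball y0 \<rho>" for y a b
    using D2_e_zero[OF _ \<rho>(3) dim] that \<rho>(2) by blast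
  have sm: "smooth_on (ball y0 \<rho>) (\<lambda>y. B y a)" for a using smooth_on_subset[OF smB _ \<rho>(2)] by simp
  have db0: "dir_deriv b0 c y = 0" if y: "y \<in> ball y0 \<rho>" for c y
  proof -
    have yU: "y \<in> U" using y \<rho>(2) by blast
    have "dir_deriv b0 c y \<bullet> a = 0" for a
    proof -
      have "dir_deriv (\<lambda>y. b0 y \<bullet> a) c y = dir_deriv (\<lambda>y. D1 a y \<bullet> (- e)) c y"
        by (rule dir_deriv_cong[of U])
          (use yU in \<open>auto simp: b0_inner simp flip: inner_minus_right
            intro!: smooth_on_inner smD1 smooth_on_const open_U\<close>)
      then show ?thesis
        unfolding dir_deriv_inner_const[OF smb0 yU] dir_deriv_inner_const[OF smD1 yU]
        using zero[OF y] by simp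
    qed
    then show ?thesis by (metis inner_eq_zero_iff)
  qed
  have "dir_deriv (\<lambda>y. B y a) c y = 0" if y: "y \<in> ball y0 \<rho>" for a c y
  proof -
    have yU: "y \<in> U" using y \<rho>(2) by blast
    have "((\<lambda>y. (N y \<bullet> a) *\<^sub>R b0 y) has_derivative
        (\<lambda>c. (N y \<bullet> a) *\<^sub>R dir_deriv b0 c y + (dir_deriv N c y \<bullet> a) *\<^sub>R b0 y)) (at y)"
      using smooth_on_has_derivative[OF smN yU] smooth_on_has_derivative[OF smb0 yU]
      by (auto intro!: derivative_eq_intros)
    from dir_deriv_eq[OF this, of c]
    have "dir_deriv (\<lambda>y. (N y \<bullet> a) *\<^sub>R b0 y) c y = (dir_deriv N c y \<bullet> a) *\<^sub>R b0 y"
      using db0[OF y] by simp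
    then have eq: "dir_deriv (\<lambda>y. B y a) c y = D2 a c y - h a c y *\<^sub>R b0 y"
      unfolding B_def[abs_def]
      using dir_deriv_add[OF smD1[of a] _ yU, of "\<lambda>y. (N y \<bullet> a) *\<^sub>R b0 y" c]
        smooth_on_scaleR[OF smooth_on_inner[OF smN smooth_on_const[OF open_U]] smb0]
      by (simp add: h_def)
    have "(D2 a c y - h a c y *\<^sub>R b0 y) \<bullet> w = 0" for w
    proof -
      have "b0 y \<bullet> X w y = b0 y \<bullet> w"
        using decompose[of w y] b0_e[OF yU] by (metis add.right_neutral inner_add_right inner_scaleR_right mult_zero_right)
      then have "(D2 a c y - h a c y *\<^sub>R b0 y) \<bullet> X w y = 0"
        using first_order[OF yU, of a c w] b0_inner[OF yU, of w] by (simp add: inner_diff_left)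
      moreover have "(D2 a c y - h a c y *\<^sub>R b0 y) \<bullet> e = 0"
        using zero[OF y] b0_e[OF yU] by (simp add: inner_diff_left)
      ultimately show ?thesis by (subst decompose[of w y]) (simp add: inner_add_right)
    qed
    then show ?thesis using eq by (metis inner_eq_zero_iff)
  qed
  then have "B y a = B y0 a" if "y \<in> ball y0 \<rho>" for y a
    using dir_deriv_zero_const[OF sm convex_ball, of a y y0] that \<rho>(1) by simp
  then show ?thesis using that \<rho>(1,2) by blast
qed

end

section \<open>Charts adapted to a Killing field, and the passage to the whole hypersurface\<close>

lemma killing_chart_exists:
  fixes M :: "'a::euclidean_space set"
  assumes hyp: "smooth_hypersurface M" and kil: "killing_field M \<xi>"
    and unit: "\<And>x. x \<in> M \<Longrightarrow> \<xi> x \<bullet> \<xi> x = 1" and p: "p \<in> M"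
  obtains U r N e where "p \<in> U" "hypersurface_chart M U r N e" "killing_chart U N (\<lambda>y. \<xi> (r y)) e"
proof -
  obtain U0 r N e where pU0: "p \<in> U0" and ch0: "hypersurface_chart M U0 r N e"
    using hypersurface_chart_exists[OF hyp p] by blast
  obtain W \<xi>' where W: "open W" "p \<in> W" "smooth_on W \<xi>'" "\<forall>x\<in>M \<inter> W. \<xi>' x = \<xi> x"
    using kil p unfolding killing_field_def smooth_map_on_def by meson
  \<comment> \<open>Restricting to points that \<open>r\<close> sends into \<open>W\<close> lets the
    field be differentiated through its smooth extension \<open>\<xi>'\<close>.\<close>
  define U where "U = U0 \<inter> r -` W"
  have "open U0" "continuous_on U0 r"
    using ch0 smooth_on_continuous_on unfolding hypersurface_chart_def by auto
  then have opU: "open U" unfolding U_def using W(1) continuous_open_preimage by blast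
  have "r p = p" using ch0 p pU0 unfolding hypersurface_chart_def by blast
  then have pU: "p \<in> U" using pU0 W(2) by (simp add: U_def)
  have ch: "hypersurface_chart M U r N e" using hypersurface_chart_subset[OF ch0 opU] by (simp add: U_def)
  have smr: "smooth_on U r" and smN: "smooth_on U N" and rM: "\<And>y. y \<in> U \<Longrightarrow> r y \<in> M"
    and Ne: "\<And>y. y \<in> U \<Longrightarrow> N y \<bullet> e = 1"
    and rd: "\<And>y a. y \<in> U \<Longrightarrow> dir_deriv r a y = a - (a \<bullet> N y) *\<^sub>R e"
    and tan: "\<And>y. y \<in> U \<Longrightarrow> tangent_space M (r y) = {w. w \<bullet> N y = 0}"
    using ch unfolding hypersurface_chart_def by auto
  have rW: "r y \<in> W" if "y \<in> U" for y using that by (simp add: U_def)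
  have eq: "\<xi>' (r y) = \<xi> (r y)" if "y \<in> U" for y using W(4) rM[OF that] rW[OF that] by blast
  have sm': "smooth_on U (\<lambda>y. \<xi>' (r y))" by (rule smooth_on_compose[OF W(3) smr]) (use rW in auto)
  have sm\<Xi>: "smooth_on U (\<lambda>y. \<xi> (r y))" by (rule smooth_on_cong[OF sm' eq])
  have D1: "dir_deriv (\<lambda>y. \<xi> (r y)) a y = dir_deriv \<xi>' (a - (a \<bullet> N y) *\<^sub>R e) (r y)" if y: "y \<in> U" for a y
  proof -
    have "dir_deriv (\<lambda>y. \<xi> (r y)) a y = dir_deriv (\<lambda>y. \<xi>' (r y)) a y"
      by (rule dir_deriv_cong[OF sm' eq y])
    also have "\<dots> = dir_deriv \<xi>' (dir_deriv r a y) (r y)"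
      using dir_deriv_eq[OF diff_chain_at[OF smooth_on_has_derivative[OF smr y] smooth_on_has_derivative[OF W(3) rW[OF y]]]]
      by (simp add: o_def)
    finally show ?thesis using rd[OF y] by simp
  qed
  have lin: "linear (\<lambda>a. dir_deriv \<xi>' a (r y))" if "y \<in> U" for y
    using smooth_on_linear_dir_deriv[OF W(3) rW[OF that]] .
  have nunit: "norm (\<xi> x) = 1" if "x \<in> M" for x using unit[OF that] by (simp add: norm_eq_1)
  have quad: "dir_deriv \<xi>' u (r y) \<bullet> u = 0" if "y \<in> U" "u \<bullet> N y = 0" for y u
    by (rule killing_equation_at[OF kil nunit rM[OF that(1)] _ W(3) rW[OF that(1)]])
      (use tan[OF that(1)] that W(4) in auto)
  \<comment> \<open>\<open>killing_equation_at\<close> gives only the quadratic form; polarization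
    recovers the bilinear Killing equation.\<close>
  have polar: "dir_deriv \<xi>' u (r y) \<bullet> w + dir_deriv \<xi>' w (r y) \<bullet> u = 0"
    if "y \<in> U" "u \<bullet> N y = 0" "w \<bullet> N y = 0" for y u w
    using quad[of y "u + w"] quad[of y u] quad[of y w] that
    by (simp add: linear_add[OF lin[OF that(1)]] inner_add_left inner_add_right)
  have "killing_chart U N (\<lambda>y. \<xi> (r y)) e"
  proof
    fix y a b assume y: "y \<in> U"
    \<comment> \<open>Second derivatives of the chart are multiples of \<open>e\<close>; that they
      commute yields the symmetry of the derivative of \<open>N\<close>.\<close>
    have dd: "dir_deriv (dir_deriv r a) b y = (- (a \<bullet> dir_deriv N b y)) *\<^sub>R e" for a b
    proof -
      have "((\<lambda>y. a - (a \<bullet> N y) *\<^sub>R e) has_derivative (\<lambda>b. (- (a \<bullet> dir_deriv N b y)) *\<^sub>R e)) (at y)"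
        using smooth_on_has_derivative[OF smN y] by (auto intro!: derivative_eq_intros)
      then have "(dir_deriv r a has_derivative (\<lambda>b. (- (a \<bullet> dir_deriv N b y)) *\<^sub>R e)) (at y)"
        by (rule has_derivative_transform_within_open[OF _ opU y]) (simp add: rd)
      then show ?thesis by (rule dir_deriv_eq)
    qed
    have "dir_deriv (dir_deriv r a) b y \<bullet> N y = dir_deriv (dir_deriv r b) a y \<bullet> N y"
      using dir_deriv_commute[OF smr y] by simp
    then show "a \<bullet> dir_deriv N b y = b \<bullet> dir_deriv N a y"
      unfolding dd using Ne[OF y] by (simp add: inner_commute[of e])
    show "dir_deriv (\<lambda>y. \<xi> (r y)) e y = 0"
      using D1[OF y, of e] Ne[OF y] linear_0[OF lin[OF y]] by (simp add: inner_commute[of e])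
    show "\<xi> (r y) \<bullet> N y = 0"
      using kil rM[OF y] tan[OF y] unfolding killing_field_def by blast
    have t: "(a - (a \<bullet> N y) *\<^sub>R e) \<bullet> N y = 0" for a
      using Ne[OF y] by (simp add: inner_diff_left inner_commute[of e])
    show "dir_deriv (\<lambda>y. \<xi> (r y)) a y \<bullet> (b - (b \<bullet> N y) *\<^sub>R e) +
        dir_deriv (\<lambda>y. \<xi> (r y)) b y \<bullet> (a - (a \<bullet> N y) *\<^sub>R e) = 0"
      unfolding D1[OF y] by (rule polar[OF y t t])
  qed (use smN sm\<Xi> Ne unit rM in auto)
  then show ?thesis using that pU ch by blast
qed

text \<open>With \<open>B\<close> constant near \<open>p\<close>, the difference between the field
  and \<open>B p\<close>, both read through the chart, has zero derivative by
  \<open>D1_eq_B\<close>.\<close>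

lemma killing_field_locally_affine:
  fixes M :: "'a::euclidean_space set"
  assumes ch: "hypersurface_chart M U r N e" and kc: "killing_chart U N (\<lambda>y. \<xi> (r y)) e"
    and p: "p \<in> U" and inj: "inj (killing_chart.B N (\<lambda>y. \<xi> (r y)) e p)" and dim: "DIM('a) \<ge> 4"
  obtains \<rho> c where "\<rho> > 0" "\<And>x. x \<in> M \<inter> ball p \<rho> \<Longrightarrow> \<xi> x = killing_chart.B N (\<lambda>y. \<xi> (r y)) e p x + c"
proof -
  interpret K: killing_chart U N "\<lambda>y. \<xi> (r y)" e by (rule kc)
  obtain \<rho> where \<rho>: "\<rho> > 0" "ball p \<rho> \<subseteq> U" "\<And>y a. y \<in> ball p \<rho> \<Longrightarrow> K.B y a = K.B p a"
    by (rule K.B_locally_constant[OF p inj dim]) blast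
  have smr: "smooth_on U r" and rd: "\<And>y a. y \<in> U \<Longrightarrow> dir_deriv r a y = a - (a \<bullet> N y) *\<^sub>R e"
    using ch unfolding hypersurface_chart_def by auto
  have bl: "bounded_linear (\<lambda>x. - K.B p x)"
    using bounded_linear_minus[OF linear_linear[THEN iffD2, OF K.B_linear[OF p]]] .
  define f where "f y = \<xi> (r y) + - K.B p (r y)" for y
  have smf: "smooth_on U f"
    unfolding f_def by (intro smooth_on_add K.sm\<Xi> smooth_on_bounded_linear[OF bl smr])
  have "dir_deriv f a y = 0" if y: "y \<in> ball p \<rho>" for a y
  proof -
    have yU: "y \<in> U" using y \<rho>(2) by blast
    have "dir_deriv f a y = K.D1 a y - K.B p (dir_deriv r a y)"
      unfolding f_def
      using dir_deriv_add[OF K.sm\<Xi> smooth_on_bounded_linear[OF bl smr] yU, of a]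
        dir_deriv_bounded_linear[OF bl smr yU, of a] by simp
    also have "\<dots> = K.B y (K.X a y) - K.B p (K.X a y)"
      using K.D1_eq_B[OF yU] rd[OF yU] by (simp add: K.X_def)
    finally show ?thesis using \<rho>(3)[OF y] by simp
  qed
  then have const: "f y = f p" if "y \<in> ball p \<rho>" for y
    using dir_deriv_zero_const[OF smooth_on_subset[OF smf _ \<rho>(2)] convex_ball, of y p] that \<rho>(1) by simp
  show ?thesis
  proof (rule that[OF \<rho>(1)])
    fix x assume x: "x \<in> M \<inter> ball p \<rho>"
    then have "r x = x" using ch \<rho>(2) unfolding hypersurface_chart_def by blast
    then show "\<xi> x = K.B p x + f p" using const[of x] x by (simp add: f_def algebra_simps)
  qed
qed

text \<open>A skew operator is determined by its values on the tangent space at \<open>p\<close>,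
  since skewness then fixes its value on \<open>e\<close>. So \<open>B\<close> at \<open>p\<close>
  depends on the field alone, and operators from different charts can be compared.\<close>

lemma killing_chart_B_affine:
  fixes M :: "'a::euclidean_space set"
  assumes ch: "hypersurface_chart M U r N e" and kc: "killing_chart U N (\<lambda>y. \<xi> (r y)) e"
    and p: "p \<in> U" "p \<in> M" and \<delta>: "\<delta> > 0" and aff: "\<And>x. x \<in> M \<inter> ball p \<delta> \<Longrightarrow> \<xi> x = A x + c"
    and A: "linear A" "\<And>a b. A a \<bullet> b = - (a \<bullet> A b)"
  shows "killing_chart.B N (\<lambda>y. \<xi> (r y)) e p = A"
proof
  fix a
  interpret K: killing_chart U N "\<lambda>y. \<xi> (r y)" e by (rule kc)
  have smr: "smooth_on U r" and rd: "\<And>y a. y \<in> U \<Longrightarrow> dir_deriv r a y = a - (a \<bullet> N y) *\<^sub>R e"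
    and rM: "\<And>y. y \<in> U \<Longrightarrow> r y \<in> M" and rp: "r p = p"
    using ch p unfolding hypersurface_chart_def by auto
  define W where "W = U \<inter> r -` ball p \<delta>"
  have opW: "open W"
    unfolding W_def using smooth_on_continuous_on[OF smr] K.open_U continuous_open_preimage by blast
  have pW: "p \<in> W" using p \<delta> rp by (simp add: W_def)
  have bl: "bounded_linear A" using A(1) by (simp add: linear_linear)
  have D1: "K.D1 a p = A (K.X a p)" for a
  proof -
    have "((\<lambda>y. A (r y) + c) has_derivative (\<lambda>a. A (dir_deriv r a p))) (at p)"
      using bounded_linear.has_derivative[OF bl smooth_on_has_derivative[OF smr p(1)]]
      by (auto intro!: derivative_eq_intros)
    then have "((\<lambda>y. \<xi> (r y)) has_derivative (\<lambda>a. A (dir_deriv r a p))) (at p)"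
      by (rule has_derivative_transform_within_open[OF _ opW pW]) (use aff rM in \<open>auto simp: W_def\<close>)
    then show ?thesis using dir_deriv_eq rd[OF p(1)] by (fastforce simp: K.X_def)
  qed
  have Ae: "A e \<bullet> e = 0" using A(2)[of e e] by (simp add: inner_commute)
  have "K.b0 p \<bullet> b = A e \<bullet> b" for b
  proof -
    have "K.b0 p \<bullet> b = - (A (K.X b p) \<bullet> e)" using K.b0_inner[OF p(1)] D1 by simp
    also have "\<dots> = K.X b p \<bullet> A e" using A(2)[of "K.X b p" e] by simp
    also have "\<dots> = b \<bullet> A e" using Ae by (simp add: K.X_def inner_diff_left inner_commute[of e])
    finally show ?thesis by (simp add: inner_commute)
  qed
  then have b0: "K.b0 p = A e" by (metis inner_diff_left inner_eq_zero_iff right_minus_eq)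
  have "K.B p a = A (K.X a p) + (N p \<bullet> a) *\<^sub>R A e" by (simp add: K.B_def D1 b0)
  also have "\<dots> = A (K.X a p + (a \<bullet> N p) *\<^sub>R e)"
    by (simp add: linear_add[OF A(1)] linear_cmul[OF A(1)] inner_commute)
  finally show "K.B p a = A a" using K.decompose[of a p] by simp
qed

lemma local_max_second_derivative:
  fixes g g' :: "real \<Rightarrow> real"
  assumes d: "d > 0" and g': "\<And>t. \<bar>t\<bar> < d \<Longrightarrow> (g has_real_derivative g' t) (at t)"
    and g'': "(g' has_real_derivative l) (at 0)" and max: "\<And>t. \<bar>t\<bar> < d \<Longrightarrow> g t \<le> g 0"
  shows "l \<le> 0"
proof (rule ccontr)
  assume "\<not> l \<le> 0"
  have "g' 0 = 0"
    by (rule DERIV_local_max[OF g'[of 0] d]) (use d max in auto)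
  obtain \<delta> where \<delta>: "\<delta> > 0" "\<And>h. 0 < h \<Longrightarrow> h < \<delta> \<Longrightarrow> g' 0 < g' (0 + h)"
    using DERIV_pos_inc_right[OF g''] \<open>\<not> l \<le> 0\<close> by auto
  define s where "s = min d \<delta> / 2"
  have s: "0 < s" "s < d" "s < \<delta>" using d \<delta>(1) by (auto simp: s_def)
  have "\<exists>z>0. z < s \<and> g s - g 0 = (s - 0) * g' z"
    by (rule MVT2[OF s(1)]) (use g' s in auto)
  then obtain z where z: "0 < z" "z < s" "g s - g 0 = s * g' z" by auto
  then have "g' z > 0" using \<delta>(2)[of z] s \<open>g' 0 = 0\<close> by simp
  then show False using z s max[of s] by (smt (verit) mult_pos_pos)
qed

text \<open>Along a tangent direction \<open>a\<close> the squared distance of the chart from the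
  origin has second derivative \<open>2 * (h a a p * (p \<bullet> e) + a \<bullet> a)\<close>, which
  cannot be positive at a maximum. Hence \<open>h a a p\<close> is nonzero for nonzero
  \<open>a\<close>.\<close>

lemma inj_B_at_farthest_point:
  fixes M :: "'a::euclidean_space set"
  assumes ch: "hypersurface_chart M U r N e" and kc: "killing_chart U N (\<lambda>y. \<xi> (r y)) e"
    and p: "p \<in> U" "p \<in> M" and max: "\<And>x. x \<in> M \<Longrightarrow> norm x \<le> norm p"
  shows "inj (killing_chart.B N (\<lambda>y. \<xi> (r y)) e p)"
proof -
  interpret K: killing_chart U N "\<lambda>y. \<xi> (r y)" e by (rule kc)
  have smr: "smooth_on U r" and rd: "\<And>y a. y \<in> U \<Longrightarrow> dir_deriv r a y = K.X a y"
    and rM: "\<And>y. y \<in> U \<Longrightarrow> r y \<in> M" and rp: "r p = p"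
    using ch p unfolding hypersurface_chart_def K.X_def by auto
  show ?thesis
  proof (rule K.inj_B_if_definite[OF p(1)])
    fix a assume a: "a \<noteq> 0" "a \<bullet> N p = 0"
    obtain d0 where d0: "d0 > 0" "ball p d0 \<subseteq> U" using p(1) K.open_U open_contains_ball by blast
    define d where "d = d0 / norm a"
    have d: "d > 0" using d0 a by (simp add: d_def)
    have inU: "p + t *\<^sub>R a \<in> U" if "\<bar>t\<bar> < d" for t
      using that d0(2) a by (auto simp: subset_eq dist_norm d_def pos_less_divide_eq)
    define f where "f y = r y \<bullet> r y" for y
    define G where "G y = 2 * (r y \<bullet> K.X a y)" for y
    have smf: "smooth_on U f" unfolding f_def by (intro smooth_on_inner smr)
    have df: "dir_deriv f a y = G y" if "y \<in> U" for y
      unfolding f_def using dir_deriv_inner[OF smr smr that] rd[OF that]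
      by (simp add: G_def inner_commute)
    have sm2: "smooth_on U (\<lambda>y. r y \<bullet> K.X a y)" by (intro smooth_on_inner smr K.smX)
    have smG: "smooth_on U G"
      unfolding G_def by (rule smooth_on_bounded_linear[OF bounded_linear_mult_right sm2])
    have dG: "dir_deriv G a p = 2 * (K.h a a p * (p \<bullet> e) + a \<bullet> a)"
      unfolding G_def
      using dir_deriv_bounded_linear[OF bounded_linear_mult_right sm2 p(1), of 2 a]
        dir_deriv_inner[OF smr K.smX p(1), of a a] K.dir_deriv_X[OF p(1)] rd[OF p(1)] rp
        K.X_tangent[OF a(2)] by simp
    have "dir_deriv G a p \<le> 0"
    proof (rule local_max_second_derivative[OF d])
      show "((\<lambda>t. f (p + t *\<^sub>R a)) has_real_derivative G (p + t *\<^sub>R a)) (at t)" if "\<bar>t\<bar> < d" for t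
        using has_derivative_line[OF smf inU[OF that]] df[OF inU[OF that]]
        by (simp add: has_real_derivative_iff_has_vector_derivative)
      show "((\<lambda>t. G (p + t *\<^sub>R a)) has_real_derivative dir_deriv G a p) (at 0)"
        using has_derivative_line[OF smG, of p 0 a] p(1)
        by (simp add: has_real_derivative_iff_has_vector_derivative)
      show "f (p + t *\<^sub>R a) \<le> f (p + 0 *\<^sub>R a)" if "\<bar>t\<bar> < d" for t
        using max[OF rM[OF inU[OF that]]] rp by (simp add: f_def norm_le)
    qed
    moreover have "a \<bullet> a > 0" using a(1) by simp
    ultimately have "K.h a a p * (p \<bullet> e) < 0" using dG[unfolded distrib_left] by linarith
    then show "K.h a a p \<noteq> 0" by auto
  qed
qed

lemma killing_field_affine:
  fixes M :: "'a::euclidean_space set"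
  assumes dim: "DIM('a) \<ge> 4" and hyp: "smooth_hypersurface M" and cpt: "compact M"
    and conn: "connected M" and ne: "M \<noteq> {}" and kil: "killing_field M \<xi>"
    and unit: "\<And>x. x \<in> M \<Longrightarrow> \<xi> x \<bullet> \<xi> x = 1"
  obtains A c where "linear A" "inj A" "\<And>a b. A a \<bullet> b = - (a \<bullet> A b)" "\<And>x. x \<in> M \<Longrightarrow> \<xi> x = A (x - c)"
proof -
  obtain p0 where p0: "p0 \<in> M" "\<And>x. x \<in> M \<Longrightarrow> norm x \<le> norm p0"
    using continuous_attains_sup[OF cpt ne, of norm] continuous_on_norm_id by blast
  obtain U r N e where p0U: "p0 \<in> U" and ch: "hypersurface_chart M U r N e"
    and kc: "killing_chart U N (\<lambda>y. \<xi> (r y)) e"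
    by (rule killing_chart_exists[OF hyp kil unit p0(1)])
  define A where "A = killing_chart.B N (\<lambda>y. \<xi> (r y)) e p0"
  have injA: "inj A" unfolding A_def by (rule inj_B_at_farthest_point[OF ch kc p0U p0])
  have linA: "linear A" unfolding A_def by (rule killing_chart.B_linear[OF kc p0U])
  have skewA: "A a \<bullet> b = - (a \<bullet> A b)" for a b unfolding A_def by (rule killing_chart.B_skew[OF kc p0U])
  obtain \<rho>0 c0 where \<rho>0: "\<rho>0 > 0" "\<And>x. x \<in> M \<inter> ball p0 \<rho>0 \<Longrightarrow> \<xi> x = A x + c0"
    unfolding A_def by (rule killing_field_locally_affine[OF ch kc p0U injA[unfolded A_def] dim]) blast
  \<comment> \<open>\<open>A\<close> and \<open>c0\<close> are fixed at the farthest point; the set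
    collects the points near which these same data describe the field. It is shown to be open and
    closed in \<open>M\<close>.\<close>
  define S where "S = {p\<in>M. \<exists>\<delta>>0. \<forall>x\<in>M \<inter> ball p \<delta>. \<xi> x = A x + c0}"
  have SM: "S \<subseteq> M" by (auto simp: S_def)
  have p0S: "p0 \<in> S" using p0(1) \<rho>0 by (auto simp: S_def)
  have "openin (top_of_set M) S"
    unfolding openin_euclidean_subtopology_iff
  proof (intro conjI ballI SM)
    fix p assume "p \<in> S"
    then obtain \<delta> where \<delta>: "\<delta> > 0" "\<forall>x\<in>M \<inter> ball p \<delta>. \<xi> x = A x + c0" by (auto simp: S_def)
    show "\<exists>e>0. \<forall>x'\<in>M. dist x' p < e \<longrightarrow> x' \<in> S"
    proof (intro exI[of _ "\<delta>/2"] conjI ballI impI)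
      fix x assume x: "x \<in> M" "dist x p < \<delta>/2"
      have "y \<in> ball p \<delta>" if "y \<in> ball x (\<delta>/2)" for y
        using dist_triangle[of p y x] x(2) that by (simp add: dist_commute)
      then have "\<forall>y\<in>M \<inter> ball x (\<delta>/2). \<xi> y = A y + c0" using \<delta>(2) by blast
      then show "x \<in> S" unfolding S_def using x(1) \<delta>(1) half_gt_zero by blast
    qed (use \<delta> in simp)
  qed
  moreover have "openin (top_of_set M) (M - S)"
    unfolding openin_euclidean_subtopology_iff
  proof (intro conjI ballI)
    fix p assume p: "p \<in> M - S"
    show "\<exists>e>0. \<forall>x'\<in>M. dist x' p < e \<longrightarrow> x' \<in> M - S"
    proof (rule ccontr)
      assume "\<not> ?thesis"
      then have near: "\<exists>s\<in>S. dist s p < \<epsilon>" if "\<epsilon> > 0" for \<epsilon> using that by blast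
      obtain U r N e where pU: "p \<in> U" and ch: "hypersurface_chart M U r N e"
        and kc: "killing_chart U N (\<lambda>y. \<xi> (r y)) e"
        by (rule killing_chart_exists[OF hyp kil unit, of p]) (use p in auto)
      interpret K: killing_chart U N "\<lambda>y. \<xi> (r y)" e by (rule kc)
      \<comment> \<open>At points of \<open>S\<close> near \<open>p\<close> the operator
        \<open>B\<close> of this chart equals \<open>A\<close>, and continuity of \<open>B\<close>
        carries the equality to \<open>p\<close>.\<close>
      have "K.B p a = A a" for a
      proof (rule ccontr)
        assume "K.B p a \<noteq> A a"
        have "isCont (\<lambda>y. K.B y a) p"
          using smooth_on_continuous_on[OF K.smB] pU K.open_U continuous_on_eq_continuous_at by blast
        then have "((\<lambda>y. K.B y a) \<longlongrightarrow> K.B p a) (nhds p)"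
          using tendsto_at_iff_tendsto_nhds[of "\<lambda>y. K.B y a" p] by (simp add: isCont_def)
        then have "\<forall>\<^sub>F y in nhds p. dist (K.B y a) (K.B p a) < dist (A a) (K.B p a)"
          by (rule tendstoD) (use \<open>K.B p a \<noteq> A a\<close> in auto)
        moreover have "\<forall>\<^sub>F y in nhds p. y \<in> U" using pU K.open_U by (simp add: eventually_nhds_in_open)
        ultimately have "\<forall>\<^sub>F y in nhds p. dist (K.B y a) (K.B p a) < dist (A a) (K.B p a) \<and> y \<in> U"
          by (rule eventually_conj)
        then obtain \<epsilon> where "\<epsilon> > 0"
          and \<epsilon>: "\<And>y. dist y p < \<epsilon> \<Longrightarrow> dist (K.B y a) (K.B p a) < dist (A a) (K.B p a) \<and> y \<in> U"
          unfolding eventually_nhds_metric by blast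
        obtain s where s: "s \<in> S" "dist s p < \<epsilon>" using near[OF \<open>\<epsilon> > 0\<close>] by blast
        then obtain \<delta> where \<delta>: "\<delta> > 0" "\<forall>x\<in>M \<inter> ball s \<delta>. \<xi> x = A x + c0" "s \<in> M" by (auto simp: S_def)
        have "K.B s = A"
          by (rule killing_chart_B_affine[OF ch kc _ \<delta>(3,1) _ linA skewA]) (use \<epsilon>[OF s(2)] \<delta>(2) in auto)
        then show False using \<epsilon>[OF s(2)] by simp
      qed
      then have KA: "K.B p = A" by blast
      \<comment> \<open>As \<open>A\<close> is injective, the field is affine near \<open>p\<close>
        with linear part \<open>A\<close>; a nearby point of \<open>S\<close> identifies the
        constant with \<open>c0\<close>.\<close>
      obtain \<rho> c where \<rho>: "\<rho> > 0" "\<And>x. x \<in> M \<inter> ball p \<rho> \<Longrightarrow> \<xi> x = A x + c"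
        by (rule killing_field_locally_affine[OF ch kc pU _ dim, unfolded KA, OF injA]) blast
      obtain s where s: "s \<in> S" "dist s p < \<rho>" using near[OF \<rho>(1)] by blast
      then have "\<xi> s = A s + c0" "s \<in> M" by (auto simp: S_def)
      then have "c = c0" using \<rho>(2)[of s] s(2) by (simp add: dist_commute)
      then have "p \<in> S" using \<rho> p by (auto simp: S_def)
      then show False using p by blast
    qed
  qed auto
  ultimately have "S = M"
    using conn p0S SM unfolding connected_clopen closedin_def by auto
  \<comment> \<open>Injectivity in finite dimension allows the constant to be absorbed into a
    center.\<close>
  have "surj A" using linear_inj_imp_surj[OF linA injA] .
  then obtain c where c: "A c = - c0" by (metis surjD)
  show ?thesis
  proof (rule that[OF linA injA skewA])
    fix x assume "x \<in> M"
    then have "x \<in> S" using \<open>S = M\<close> by simp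
    then have "\<xi> x = A x + c0" by (auto simp: S_def)
    then show "\<xi> x = A (x - c)" using c by (simp add: linear_diff[OF linA])
  qed
qed

subsection \<open>Ellipsoids and skew operators\<close>

lemma parallel_if_orthogonal:
  fixes n w :: "'a::real_inner"
  assumes "\<And>a. a \<bullet> n = 0 \<Longrightarrow> a \<bullet> w = 0"
  obtains s where "w = s *\<^sub>R n"
proof (cases "n = 0")
  case True
  then have "w \<bullet> w = 0" using assms[of w] by simp
  then show ?thesis using that[of 0] by simp
next
  case False
  define s where "s = (w \<bullet> n) / (n \<bullet> n)"
  let ?a = "w - s *\<^sub>R n"
  have an: "?a \<bullet> n = 0" using False by (simp add: s_def inner_diff_left)
  then have "?a \<bullet> ?a = 0" using assms[OF an] by (simp add: inner_diff_right)
  then show ?thesis using that[of s] by simp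
qed

lemma tangent_space_orthogonal:
  fixes M :: "'a::euclidean_space set"
  assumes "smooth_hypersurface M" "p \<in> M"
  obtains n where "tangent_space M p = {a. a \<bullet> n = 0}"
proof -
  obtain U r N e where pU: "p \<in> U" and ch: "hypersurface_chart M U r N e"
    by (rule hypersurface_chart_exists[OF assms])
  have "r p = p" using ch pU assms(2) unfolding hypersurface_chart_def by blast
  then have "tangent_space M p = {a. a \<bullet> N p = 0}"
    using ch pU unfolding hypersurface_chart_def by metis
  then show ?thesis by (rule that)
qed

text \<open>By skewness, \<open>A (A (p - c))\<close> is, up to the factor -2, the gradient at
  \<open>p\<close> of the squared norm of \<open>A (x - c)\<close>.\<close>

lemma ellipsoid_normal:
  assumes A: "linear A" "\<And>a b. A a \<bullet> b = - (a \<bullet> A b)"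
    and sub: "\<And>x. x \<in> M \<Longrightarrow> A (x - c) \<bullet> A (x - c) = 1"
    and p: "p \<in> M" and a: "a \<in> tangent_space M p"
  shows "a \<bullet> A (A (p - c)) = 0"
proof -
  obtain \<gamma> where \<gamma>: "curve_through M p a \<gamma>" using a unfolding tangent_space_def by blast
  have "bounded_linear A" using linear_linear[THEN iffD2, OF A(1)] .
  then have "((\<lambda>x. A (x - c)) has_derivative A) (at p)"
    by (intro bounded_linear.has_derivative[where f = A] derivative_eq_intros) auto
  then have "((\<lambda>x. A (x - c) \<bullet> A (x - c)) has_derivative (\<lambda>h. A (p - c) \<bullet> A h + A h \<bullet> A (p - c))) (at p)"
    by (rule has_derivative_inner) fact
  from curve_through_level_set[OF \<gamma> open_UNIV UNIV_I _ this, of 1] sub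
  have "A a \<bullet> A (p - c) = 0" by (simp add: inner_commute)
  then show ?thesis using A(2)[of a "A (p - c)"] by simp
qed

lemma curve_through_max:
  fixes f :: "'a::euclidean_space \<Rightarrow> real"
  assumes "curve_through M p v \<gamma>" "\<And>x. x \<in> M \<Longrightarrow> f x \<le> f p" "(f has_derivative f') (at p)"
  shows "f' v = 0"
proof -
  obtain d where d: "d > 0" "\<And>t. t \<in> {-d<..<d} \<Longrightarrow> \<gamma> t \<in> M" and g0: "\<gamma> 0 = p"
    and g': "(\<gamma> has_vector_derivative v) (at 0)"
    using assms(1) unfolding curve_through_def by blast
  have lin: "linear f'" using assms(3) has_derivative_linear by blast
  have "((\<lambda>t. f (\<gamma> t)) has_derivative (\<lambda>h. f' (h *\<^sub>R v))) (at 0)"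
    using diff_chain_at[of \<gamma> "\<lambda>h. h *\<^sub>R v" 0 f f'] g' g0 assms(3) by (simp add: o_def has_vector_derivative_def)
  then have "((\<lambda>t. f (\<gamma> t)) has_real_derivative f' v) (at 0)"
    by (simp add: has_field_derivative_def linear_cmul[OF lin] mult.commute[of _ "f' v"])
  then show ?thesis
  proof (rule DERIV_local_max[OF _ d(1)])
    show "\<forall>y. \<bar>0 - y\<bar> < d \<longrightarrow> f (\<gamma> y) \<le> f (\<gamma> 0)"
    proof (intro allI impI)
      fix y assume "\<bar>0 - y\<bar> < d"
      then have "\<gamma> y \<in> M" by (intro d(2)) auto
      then show "f (\<gamma> y) \<le> f (\<gamma> 0)" using assms(2) g0 by simp
    qed
  qed
qed

text \<open>The work lies in showing that a point \<open>q\<close> of the ellipsoid belongs to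
  \<open>M\<close>. At a maximum \<open>p\<close> over \<open>M\<close> of the affine function
  \<open>f\<close> built from \<open>q\<close>, both \<open>A (A (q - c))\<close> and
  \<open>A (A (p - c))\<close> are orthogonal to the tangent space, hence parallel, and injectivity
  of \<open>A\<close> makes \<open>q - c\<close> a multiple of \<open>p - c\<close>.\<close>

lemma killing_hypersurface_eq_ellipsoid:
  fixes M :: "'a::euclidean_space set"
  assumes hyp: "smooth_hypersurface M" and cpt: "compact M" and ne: "M \<noteq> {}"
    and kil: "killing_field M \<xi>" and unit: "\<And>x. x \<in> M \<Longrightarrow> \<xi> x \<bullet> \<xi> x = 1"
    and A: "linear A" "inj A" "\<And>a b. A a \<bullet> b = - (a \<bullet> A b)" and \<xi>: "\<And>x. x \<in> M \<Longrightarrow> \<xi> x = A (x - c)"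
  shows "M = {x. A (x - c) \<bullet> A (x - c) = 1}"
proof
  have sub: "A (x - c) \<bullet> A (x - c) = 1" if "x \<in> M" for x using unit[OF that] \<xi>[OF that] by simp
  then show "M \<subseteq> {x. A (x - c) \<bullet> A (x - c) = 1}" by blast
  show "{x. A (x - c) \<bullet> A (x - c) = 1} \<subseteq> M"
  proof
    fix q assume "q \<in> {x. A (x - c) \<bullet> A (x - c) = 1}"
    then have q: "A (q - c) \<bullet> A (q - c) = 1" by simp
    have bl: "bounded_linear A" using linear_linear[THEN iffD2, OF A(1)] .
    define f where "f x = A (x - c) \<bullet> A (q - c)" for x
    have "continuous_on M f"
      unfolding f_def by (intro continuous_intros bounded_linear.continuous_on[OF bl])
    then obtain p where p: "p \<in> M" and max: "\<And>x. x \<in> M \<Longrightarrow> f x \<le> f p"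
      using continuous_attains_sup[OF cpt ne] by blast
    obtain n where tan: "tangent_space M p = {a. a \<bullet> n = 0}"
      by (rule tangent_space_orthogonal[OF hyp p])
    have fder: "(f has_derivative (\<lambda>h. A h \<bullet> A (q - c))) (at p)"
      unfolding f_def
      by (intro has_derivative_inner_left bounded_linear.has_derivative[OF bl] derivative_eq_intros) auto
    have "a \<bullet> A (A (q - c)) = 0" if "a \<bullet> n = 0" for a
    proof -
      have "a \<in> tangent_space M p" using that tan by simp
      then obtain \<gamma> where "curve_through M p a \<gamma>" unfolding tangent_space_def by blast
      from curve_through_max[OF this max fder] show ?thesis using A(3)[of a "A (q - c)"] by simp
    qed
    then obtain \<alpha> where \<alpha>: "A (A (q - c)) = \<alpha> *\<^sub>R n" by (rule parallel_if_orthogonal)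
    have "a \<bullet> A (A (p - c)) = 0" if "a \<bullet> n = 0" for a
      by (rule ellipsoid_normal[OF A(1,3) sub p]) (use that tan in auto)
    then obtain \<beta> where \<beta>: "A (A (p - c)) = \<beta> *\<^sub>R n" by (rule parallel_if_orthogonal)
    have A0: "A x = 0 \<longleftrightarrow> x = 0" for x
      using A(2) linear_injective_0[OF A(1)] linear_0[OF A(1)] by blast
    have "p - c \<noteq> 0" using sub[OF p] linear_0[OF A(1)] by auto
    then have "\<beta> *\<^sub>R n \<noteq> 0" using \<beta> A0 by metis
    then have "\<beta> \<noteq> 0" by simp
    define s where "s = \<alpha> / \<beta>"
    have "A (A (x - s *\<^sub>R y)) = A (A x) - s *\<^sub>R A (A y)" for x y
      by (simp only: linear_diff[OF A(1)] linear_cmul[OF A(1)])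
    then have "A (A ((q - c) - s *\<^sub>R (p - c))) = \<alpha> *\<^sub>R n - s *\<^sub>R (\<beta> *\<^sub>R n)" by (simp only: \<alpha> \<beta>)
    also have "\<dots> = 0" using \<open>\<beta> \<noteq> 0\<close> by (simp add: s_def)
    finally have "(q - c) - s *\<^sub>R (p - c) = 0" by (simp only: A0)
    then have qs: "q - c = s *\<^sub>R (p - c)" by simp
    have Aq: "A (q - c) = s *\<^sub>R A (p - c)" unfolding qs by (rule linear_cmul[OF A(1)])
    have "s * s = 1" using q sub[OF p] unfolding Aq by simp
    then consider "s = 1" | "s = -1" by (auto simp: square_eq_1_iff)
    then show "q \<in> M"
    proof cases
      case 1
      then show ?thesis using qs p by simp
    next
      case 2
      \<comment> \<open>Here the maximum of \<open>f\<close> is -1, the least value that the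
        Cauchy-Schwarz inequality allows for unit vectors, so \<open>M\<close> collapses to the
        point \<open>p\<close>.\<close>
      have "x = p" if x: "x \<in> M" for x
      proof -
        have "f p = -1" using sub[OF p] 2 unfolding f_def Aq by simp
        then have "A (x - c) \<bullet> A (q - c) \<le> -1" using max[OF x] by (simp add: f_def)
        then have "(A (x - c) + A (q - c)) \<bullet> (A (x - c) + A (q - c)) \<le> 0"
          using sub[OF x] q by (simp add: inner_add_left inner_add_right inner_commute)
        then have "A (x - c) + A (q - c) = 0" by (metis inner_ge_zero inner_eq_zero_iff order_antisym)
        then have "A ((x - c) - (p - c)) = 0" using Aq 2 by (simp only: linear_diff[OF A(1), of "x - c" "p - c"]) simp
        then show ?thesis by (simp add: A0)
      qed
      \<comment> \<open>A curve in a one-point set has zero velocity, while \<open>\<xi> p\<close>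
        has length 1.\<close>
      moreover obtain \<gamma> where "curve_through M p (\<xi> p) \<gamma>"
        using kil p unfolding killing_field_def tangent_space_def by blast
      ultimately have "\<xi> p = 0"
        using curve_through_level_set[of M p "\<xi> p" \<gamma> UNIV "\<lambda>x. x" p "\<lambda>h. h"] by simp
      then show ?thesis using unit[OF p] by simp
    qed
  qed
qed

section \<open>Normal form of an injective skew operator\<close>

lemma linear_coefficient_zero:
  fixes b c :: real
  assumes "\<And>t. 0 \<le> t * b + t * t * c"
  shows "b = 0"
proof (rule ccontr)
  assume b: "b \<noteq> 0"
  \<comment> \<open>This \<open>t\<close> minimizes
    \<open>t * b + t * t * (\<bar>c\<bar> + 1)\<close>, a majorant of the given expression with
    positive leading coefficient.\<close>
  define t where "t = - b / (2 * (\<bar>c\<bar> + 1))"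
  have pos: "\<bar>c\<bar> + 1 > 0" by simp
  have "t * t * c \<le> t * t * (\<bar>c\<bar> + 1)" by (intro mult_left_mono) auto
  then have "0 \<le> t * (b + t * (\<bar>c\<bar> + 1))" using assms[of t] by (simp add: algebra_simps)
  also have "b + t * (\<bar>c\<bar> + 1) = b / 2" using pos by (simp add: t_def field_simps)
  also have "t * (b / 2) = - (b * b) / (4 * (\<bar>c\<bar> + 1))" by (simp add: t_def field_simps)
  finally have "b * b \<le> 0" using pos by (simp add: divide_le_0_iff zero_le_divide_iff)
  moreover have "b * b > 0" using b by (simp add: zero_less_mult_iff) linarith
  ultimately show False by linarith
qed

text \<open>A unit vector \<open>u\<close> of \<open>V\<close> maximizing \<open>norm (A u)\<close>
  is an eigenvector of the square of \<open>A\<close>, by a first variation argument;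
  \<open>u\<close> and \<open>A u\<close> then span an invariant plane.\<close>

lemma skew_eigenplane:
  fixes A :: "'a::euclidean_space \<Rightarrow> 'a"
  assumes A: "linear A" "inj A" "\<And>a b. A a \<bullet> b = - (a \<bullet> A b)"
    and V: "subspace V" "A ` V \<subseteq> V" "V \<noteq> {0}"
  obtains u v \<omega> where "u \<in> V" "v \<in> V" "u \<bullet> u = 1" "v \<bullet> v = 1" "u \<bullet> v = 0" "\<omega> \<noteq> 0"
    "A u = \<omega> *\<^sub>R v" "A v = - \<omega> *\<^sub>R u"
proof -
  have bl: "bounded_linear A" using linear_linear[THEN iffD2, OF A(1)] .
  obtain z where z: "z \<in> V" "z \<noteq> 0" using V(1,3) subspace_0 by blast
  have "compact (V \<inter> sphere 0 1)" using closed_subspace[OF V(1)] by (simp add: closed_Int_compact)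
  moreover have "(1 / norm z) *\<^sub>R z \<in> V \<inter> sphere 0 1" using z V(1) by (simp add: subspace_scale)
  then have "V \<inter> sphere 0 1 \<noteq> {}" by blast
  moreover have "continuous_on (V \<inter> sphere 0 1) (\<lambda>x. norm (A x))"
    by (intro continuous_on_norm bounded_linear.continuous_on[OF bl] continuous_on_id)
  ultimately obtain u where u0: "u \<in> V \<inter> sphere 0 1"
    and max0: "\<forall>x\<in>V \<inter> sphere 0 1. norm (A x) \<le> norm (A u)"
    using continuous_attains_sup[of "V \<inter> sphere 0 1" "\<lambda>x. norm (A x)"] by blast
  have u: "u \<in> V" "norm u = 1" using u0 by auto
  have max: "norm (A x) \<le> norm (A u)" if "x \<in> V" "norm x = 1" for x using max0 that by simp
  define \<omega> where "\<omega> = norm (A u)"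
  have uu: "u \<bullet> u = 1" using u(2) by (simp add: norm_eq_1)
  have "u \<noteq> 0" using u(2) by auto
  then have "A u \<noteq> 0" using A(2) linear_injective_0[OF A(1)] by blast
  then have \<omega>: "\<omega> > 0" by (simp add: \<omega>_def)
  have bound: "A x \<bullet> A x \<le> \<omega> * \<omega> * (x \<bullet> x)" if x: "x \<in> V" for x
  proof (cases "x = 0")
    case True
    then show ?thesis by (simp add: linear_0[OF A(1)])
  next
    case False
    have "norm (A ((1 / norm x) *\<^sub>R x)) \<le> \<omega>"
      unfolding \<omega>_def by (rule max) (use x V(1) False in \<open>auto simp: subspace_scale\<close>)
    then have "norm (A x) \<le> \<omega> * norm x"
      using False by (simp add: linear_cmul[OF A(1)] pos_divide_le_eq)
    then have "norm (A x) * norm (A x) \<le> (\<omega> * norm x) * (\<omega> * norm x)"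
      by (intro mult_mono) (use \<omega> in auto)
    then show ?thesis by (simp add: dot_square_norm power2_eq_square mult_ac)
  qed
  \<comment> \<open>The inequality \<open>bound\<close> along \<open>u + t *\<^sub>R w\<close> is an
    equality at \<open>t = 0\<close>, so the linear coefficient of its defect vanishes.\<close>
  have crit: "A u \<bullet> A w = \<omega> * \<omega> * (u \<bullet> w)" if w: "w \<in> V" for w
  proof -
    have "0 \<le> t * (2 * (\<omega> * \<omega> * (u \<bullet> w) - A u \<bullet> A w)) + t * t * (\<omega> * \<omega> * (w \<bullet> w) - A w \<bullet> A w)" for t
    proof -
      have "u + t *\<^sub>R w \<in> V" using u(1) w V(1) by (simp add: subspace_add subspace_scale)
      from bound[OF this]
      have "A u \<bullet> A u + 2 * t * (A u \<bullet> A w) + t * t * (A w \<bullet> A w)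
          \<le> \<omega> * \<omega> * (1 + 2 * t * (u \<bullet> w) + t * t * (w \<bullet> w))"
        using uu by (simp add: linear_add[OF A(1)] linear_cmul[OF A(1)] inner_add_left inner_add_right
            inner_commute algebra_simps)
      moreover have "A u \<bullet> A u = \<omega> * \<omega>" by (simp add: \<omega>_def dot_square_norm power2_eq_square)
      ultimately show ?thesis by (simp add: algebra_simps)
    qed
    from linear_coefficient_zero[OF this] show ?thesis by simp
  qed
  have AAu: "A (A u) = - (\<omega> * \<omega>) *\<^sub>R u"
  proof -
    \<comment> \<open>Invariance of \<open>V\<close> makes this defect an admissible test vector in
      \<open>crit\<close>, which shows that it is orthogonal to itself.\<close>
    let ?w = "A (A u) + (\<omega> * \<omega>) *\<^sub>R u"
    have wV: "?w \<in> V" using u(1) V(1,2) by (simp add: image_subset_iff subspace_add subspace_scale)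
    have "?w \<bullet> ?w = 0"
      using crit[OF wV] A(3)[of "A u" ?w] by (simp add: inner_add_left)
    then show ?thesis by (simp add: eq_neg_iff_add_eq_0)
  qed
  show ?thesis
  proof (rule that[of u "(1 / \<omega>) *\<^sub>R A u" \<omega>])
    show "(1 / \<omega>) *\<^sub>R A u \<in> V" using u(1) V(1,2) by (simp add: image_subset_iff subspace_scale)
    show "(1 / \<omega>) *\<^sub>R A u \<bullet> (1 / \<omega>) *\<^sub>R A u = 1"
      using \<omega> by (simp add: \<omega>_def dot_square_norm power2_eq_square)
    have "u \<bullet> A u = 0" using A(3)[of u u] by (simp add: inner_commute)
    then show "u \<bullet> (1 / \<omega>) *\<^sub>R A u = 0" by simp
    show "A ((1 / \<omega>) *\<^sub>R A u) = - \<omega> *\<^sub>R u"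
      using \<omega> by (simp add: linear_cmul[OF A(1)] AAu)
  qed (use u uu \<omega> in auto)
qed

text \<open>Induction on the dimension: \<open>skew_eigenplane\<close> splits off an invariant
  plane, and skewness makes its orthogonal complement \<open>W\<close> in \<open>V\<close> invariant
  too. Each step removes exactly two dimensions, which gives the parity.\<close>

lemma skew_normal_form:
  fixes A :: "'a::euclidean_space \<Rightarrow> 'a"
  assumes A: "linear A" "inj A" "\<And>a b. A a \<bullet> b = - (a \<bullet> A b)"
    and V: "subspace V" "A ` V \<subseteq> V"
  shows "\<exists>(N::nat) u v \<omega>. dim V = 2 * N \<and>
     (\<forall>k<N. \<forall>j<N. u k \<bullet> v j = 0 \<and> u k \<bullet> u j = (if k = j then 1 else 0) \<and> v k \<bullet> v j = (if k = j then 1 else 0)) \<and>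
     (\<forall>k<N. u k \<in> V \<and> v k \<in> V \<and> \<omega> k \<noteq> 0 \<and> A (u k) = \<omega> k *\<^sub>R v k \<and> A (v k) = - \<omega> k *\<^sub>R u k) \<and>
     (\<forall>x\<in>V. x = (\<Sum>k<N. (x \<bullet> u k) *\<^sub>R u k + (x \<bullet> v k) *\<^sub>R v k))"
  using V
proof (induction "dim V" arbitrary: V rule: less_induct)
  case less
  show ?case
  proof (cases "V = {0}")
    case True
    then show ?thesis by (intro exI[of _ 0]) simp
  next
    case False
    obtain u v \<omega> where uv: "u \<in> V" "v \<in> V" "u \<bullet> u = 1" "v \<bullet> v = 1" "u \<bullet> v = 0" "\<omega> \<noteq> 0"
      "A u = \<omega> *\<^sub>R v" "A v = - \<omega> *\<^sub>R u"
      by (rule skew_eigenplane[OF A less.prems False])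
    have vu: "v \<bullet> u = 0" using uv(5) by (simp add: inner_commute)
    define W where "W = {x\<in>V. x \<bullet> u = 0 \<and> x \<bullet> v = 0}"
    have subW: "subspace W"
      using less.prems(1) unfolding W_def subspace_def by (auto simp: inner_add_left)
    have AW: "A ` W \<subseteq> W"
    proof
      fix y assume "y \<in> A ` W"
      then obtain x where x: "y = A x" "x \<in> V" "x \<bullet> u = 0" "x \<bullet> v = 0" by (auto simp: W_def)
      then show "y \<in> W" using A(3)[of x u] A(3)[of x v] uv less.prems(2) by (auto simp: W_def)
    qed
    have "W = {y \<in> V. \<forall>x\<in>span {u, v}. orthogonal x y}"
    proof -
      have "(\<forall>x\<in>span {u, v}. orthogonal x y) \<longleftrightarrow> y \<bullet> u = 0 \<and> y \<bullet> v = 0" for y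
      proof
        assume "\<forall>x\<in>span {u, v}. orthogonal x y"
        then show "y \<bullet> u = 0 \<and> y \<bullet> v = 0"
          using span_base[of u "{u, v}"] span_base[of v "{u, v}"] by (auto simp: orthogonal_def inner_commute)
      next
        assume "y \<bullet> u = 0 \<and> y \<bullet> v = 0"
        then show "\<forall>x\<in>span {u, v}. orthogonal x y"
          using orthogonal_to_span[of _ "{u, v}" y] by (auto simp: orthogonal_def inner_commute)
      qed
      then show ?thesis by (auto simp: W_def)
    qed
    moreover have "span {u, v} \<subseteq> V" using uv(1,2) less.prems(1) by (simp add: span_minimal)
    ultimately have "dim W + dim (span {u, v}) = dim V"
      using dim_subspace_orthogonal_to_vectors[of "span {u, v}" V] less.prems(1) by simp
    moreover have "dim (span {u, v}) = 2"
    proof -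
      have "u \<noteq> v" using uv(3,5) by auto
      moreover have "independent {u, v}"
        by (rule pairwise_orthogonal_independent) (use uv vu in \<open>auto simp: pairwise_def orthogonal_def\<close>)
      ultimately show ?thesis by (simp add: dim_eq_card_independent)
    qed
    ultimately have dimV: "dim V = dim W + 2" by simp
    then have lt: "dim W < dim V" by simp
    from less.hyps[OF lt subW AW] obtain N u' v' \<omega>' where IH: "dim W = 2 * N"
      "\<forall>k<N. \<forall>j<N. u' k \<bullet> v' j = 0 \<and> u' k \<bullet> u' j = (if k = j then 1 else 0) \<and> v' k \<bullet> v' j = (if k = j then 1 else 0)"
      "\<forall>k<N. u' k \<in> W \<and> v' k \<in> W \<and> \<omega>' k \<noteq> 0 \<and> A (u' k) = \<omega>' k *\<^sub>R v' k \<and> A (v' k) = - \<omega>' k *\<^sub>R u' k"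
      "\<forall>x\<in>W. x = (\<Sum>k<N. (x \<bullet> u' k) *\<^sub>R u' k + (x \<bullet> v' k) *\<^sub>R v' k)"
      by (elim exE conjE) (rule that; assumption)
    have W: "u' k \<in> V" "v' k \<in> V" "u' k \<bullet> u = 0" "u' k \<bullet> v = 0" "v' k \<bullet> u = 0" "v' k \<bullet> v = 0"
      "u \<bullet> u' k = 0" "v \<bullet> u' k = 0" "u \<bullet> v' k = 0" "v \<bullet> v' k = 0" if "k < N" for k
      using IH(3) that by (auto simp: W_def inner_commute)
    let ?u = "u'(N := u)" and ?v = "v'(N := v)" and ?\<omega> = "\<omega>'(N := \<omega>)"
    have 1: "dim V = 2 * Suc N" using dimV IH(1) by simp
    have 2: "\<forall>k<Suc N. \<forall>j<Suc N. ?u k \<bullet> ?v j = 0 \<and> ?u k \<bullet> ?u j = (if k = j then 1 else 0)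
        \<and> ?v k \<bullet> ?v j = (if k = j then 1 else 0)"
      using IH(2) W uv(3,4,5) by (auto simp: less_Suc_eq)
    have 3: "\<forall>k<Suc N. ?u k \<in> V \<and> ?v k \<in> V \<and> ?\<omega> k \<noteq> 0 \<and> A (?u k) = ?\<omega> k *\<^sub>R ?v k \<and> A (?v k) = - ?\<omega> k *\<^sub>R ?u k"
      using IH(3) W uv by (auto simp: less_Suc_eq)
    have 4: "x = (\<Sum>k<Suc N. (x \<bullet> ?u k) *\<^sub>R ?u k + (x \<bullet> ?v k) *\<^sub>R ?v k)" if x: "x \<in> V" for x
    proof -
      define y where "y = x - (x \<bullet> u) *\<^sub>R u - (x \<bullet> v) *\<^sub>R v"
      have "y \<in> W"
        unfolding W_def y_def using x uv vu less.prems(1)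
        by (auto simp: subspace_diff subspace_scale inner_diff_left)
      then have "y = (\<Sum>k<N. (y \<bullet> u' k) *\<^sub>R u' k + (y \<bullet> v' k) *\<^sub>R v' k)" using IH(4) by blast
      also have "\<dots> = (\<Sum>k<N. (x \<bullet> u' k) *\<^sub>R u' k + (x \<bullet> v' k) *\<^sub>R v' k)"
        by (rule sum.cong) (use W in \<open>auto simp: y_def inner_diff_left\<close>)
      finally have "x = (\<Sum>k<N. (x \<bullet> u' k) *\<^sub>R u' k + (x \<bullet> v' k) *\<^sub>R v' k) + ((x \<bullet> u) *\<^sub>R u + (x \<bullet> v) *\<^sub>R v)"
        by (simp add: y_def algebra_simps)
      then show ?thesis by simp
    qed
    show ?thesis
      by (rule exI[of _ "Suc N"], rule exI[of _ ?u], rule exI[of _ ?v], rule exI[of _ ?\<omega>])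
        (intro conjI 1 2 3 ballI 4)
  qed
qed

section \<open>Diffeomorphism type, shape operator and conclusion\<close>

lemma smooth_map_on_affine:
  fixes L :: "'a::euclidean_space \<Rightarrow> 'b::euclidean_space"
  assumes "linear L"
  shows "smooth_map_on S (\<lambda>x. L (x - c) + d)"
proof -
  have "smooth_on UNIV (\<lambda>x. L (x + - c) + d)"
    by (intro smooth_on_add smooth_on_const smooth_on_ident
        smooth_on_bounded_linear[OF linear_linear[THEN iffD2, OF assms]]) auto
  then show ?thesis unfolding smooth_map_on_def by (intro ballI exI[of _ UNIV]) auto
qed

lemma diffeomorphic_ellipsoid_sphere:
  fixes A :: "'a::euclidean_space \<Rightarrow> 'a"
  assumes "linear A" "inj A"
  shows "diffeomorphic {x. A (x - c) \<bullet> A (x - c) = 1} (sphere (0::'a) 1)"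
proof -
  obtain B where B: "linear B" "\<And>x. B (A x) = x"
    using linear_injective_left_inverse[OF assms] by (metis comp_apply id_apply)
  have AB: "A (B y) = y" for y
    using linear_inj_imp_surj[OF assms] B(2) by (metis surjD)
  have norm1: "norm y = 1 \<longleftrightarrow> y \<bullet> y = 1" for y :: 'a by (simp add: norm_eq_1)
  show ?thesis
    unfolding diffeomorphic_def
  proof (intro exI conjI)
    \<comment> \<open>The zero added here and the zero subtracted in the inverse map bring both into
      the shape of \<open>smooth_map_on_affine\<close>.\<close>
    show "smooth_map_on {x. A (x - c) \<bullet> A (x - c) = 1} (\<lambda>x. A (x - c) + 0)"
      by (rule smooth_map_on_affine[OF assms(1)])
    show "smooth_map_on (sphere 0 1) (\<lambda>y. B (y - 0) + c)" by (rule smooth_map_on_affine[OF B(1)])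
  qed (auto simp: AB B(2) norm1)
qed

text \<open>Differentiating the orthogonality of \<open>\<nu>\<close> and \<open>\<xi>\<close> along
  the field moves the derivative from the normal onto the field, whose derivative is
  \<open>A\<close>.\<close>

lemma shape_operator_killing:
  fixes M :: "'a::euclidean_space set"
  assumes kil: "killing_field M \<xi>" and A: "linear A" and \<xi>: "\<And>x. x \<in> M \<Longrightarrow> \<xi> x = A (x - c)"
    and \<nu>: "unit_normal_field M \<nu>" and p: "p \<in> M"
  shows "shape_operator M \<nu> p (\<xi> p) \<bullet> \<xi> p = \<nu> p \<bullet> A (A (p - c))"
proof -
  have bl: "bounded_linear A" using linear_linear[THEN iffD2, OF A] .
  obtain U g where U: "open U" "p \<in> U" and smg: "smooth_on U g" and g: "\<forall>y\<in>M \<inter> U. g y = \<nu> y"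
    using \<nu> p unfolding unit_normal_field_def smooth_map_on_def by meson
  note gder = smooth_on_has_derivative[OF smg U(2)]
  define w where "w = dir_deriv g (\<xi> p) p"
  have curve: "((\<nu> \<circ> \<gamma>) has_vector_derivative w) (at 0)" if \<gamma>: "curve_through M p (\<xi> p) \<gamma>" for \<gamma>
  proof -
    obtain d where d: "d > 0" "smooth_on {-d<..<d} \<gamma>" "\<And>t. t \<in> {-d<..<d} \<Longrightarrow> \<gamma> t \<in> M" and g0: "\<gamma> 0 = p"
      and g': "(\<gamma> has_vector_derivative \<xi> p) (at 0)"
      using \<gamma> unfolding curve_through_def by blast
    have lin: "linear (\<lambda>a. dir_deriv g a p)" using smooth_on_linear_dir_deriv[OF smg U(2)] .
    have 1: "((\<lambda>t. g (\<gamma> t)) has_vector_derivative w) (at 0)"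
      using diff_chain_at[of \<gamma> "\<lambda>h. h *\<^sub>R \<xi> p" 0 g "\<lambda>a. dir_deriv g a p"] g' g0 gder linear_cmul[OF lin]
      by (simp add: o_def has_vector_derivative_def w_def)
    have op: "open ({-d<..<d} \<inter> \<gamma> -` U)"
      using continuous_open_preimage[OF smooth_on_continuous_on[OF d(2)] _ U(1)] by simp
    have "((\<lambda>t. \<nu> (\<gamma> t)) has_vector_derivative w) (at 0)"
      by (rule has_vector_derivative_transform_within_open[OF 1 op]) (use d g0 U(2) g in auto)
    then show ?thesis by (simp add: o_def)
  qed
  obtain \<gamma>0 where \<gamma>0: "curve_through M p (\<xi> p) \<gamma>0"
    using kil p unfolding killing_field_def tangent_space_def by blast
  \<comment> \<open>The description is proper: a local extension of \<open>\<nu>\<close> gives the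
    same derivative along every curve with velocity \<open>\<xi> p\<close>, and such a curve
    exists.\<close>
  have "(THE w. \<forall>\<gamma>. curve_through M p (\<xi> p) \<gamma> \<longrightarrow> ((\<nu> \<circ> \<gamma>) has_vector_derivative w) (at 0)) = w"
    by (rule the_equality) (use curve \<gamma>0 vector_derivative_unique_at in blast)+
  then have so: "shape_operator M \<nu> p (\<xi> p) = - w" by (simp add: shape_operator_def)
  have "((\<lambda>x. A (x - c)) has_derivative A) (at p)"
    by (intro bounded_linear.has_derivative[OF bl] derivative_eq_intros) auto
  from has_derivative_inner[OF gder this]
  have F: "((\<lambda>x. g x \<bullet> A (x - c)) has_derivative (\<lambda>h. g p \<bullet> A h + dir_deriv g h p \<bullet> A (p - c))) (at p)" .
  have "g p \<bullet> A (\<xi> p) + dir_deriv g (\<xi> p) p \<bullet> A (p - c) = 0"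
  proof (rule curve_through_level_set[OF \<gamma>0 U _ F])
    fix x assume x: "x \<in> M \<inter> U"
    then have "\<nu> x \<bullet> \<xi> x = 0"
      using \<nu> kil unfolding unit_normal_field_def killing_field_def by blast
    then show "g x \<bullet> A (x - c) = 0" using x g \<xi> by simp
  qed
  then show ?thesis using so g p U(2) \<xi>[OF p] by (simp add: w_def)
qed

theorem theorem1:
  fixes M :: "'a::euclidean_space set" and \<xi> :: "'a \<Rightarrow> 'a"
  assumes dim: "DIM('a) \<ge> 4"
    and hyp: "smooth_hypersurface M" and cpt: "compact M" and conn: "connected M"
    and ne: "M \<noteq> {}"
    and kil: "killing_field M \<xi>"
    and unit: "\<forall>p\<in>M. \<xi> p \<bullet> \<xi> p = 1"
  shows "\<exists>(N::nat) (c::'a) (u::nat \<Rightarrow> 'a) (v::nat \<Rightarrow> 'a) (\<omega>::nat \<Rightarrow> real).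
     DIM('a) = 2 * N \<and>
     diffeomorphic M (sphere (0::'a) 1) \<and>
     (\<forall>k<N. \<forall>j<N. u k \<bullet> v j = 0 \<and> u k \<bullet> u j = (if k = j then 1 else 0)
                  \<and> v k \<bullet> v j = (if k = j then 1 else 0)) \<and>
     (\<forall>k<N. \<omega> k \<noteq> 0) \<and>
     M = {x. (\<Sum>k<N. (\<omega> k)\<^sup>2 * (((x - c) \<bullet> u k)\<^sup>2 + ((x - c) \<bullet> v k)\<^sup>2)) = 1} \<and>
     (\<forall>x\<in>M. \<xi> x = (\<Sum>k<N. \<omega> k *\<^sub>R (((x - c) \<bullet> u k) *\<^sub>R v k - ((x - c) \<bullet> v k) *\<^sub>R u k))) \<and>
     (\<forall>\<nu>. unit_normal_field M \<nu> \<and>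
          (\<exists>C. \<forall>p\<in>M. shape_operator M \<nu> p (\<xi> p) \<bullet> \<xi> p = C)
        \<longrightarrow> (\<forall>k<N. (\<omega> k)\<^sup>2 = (\<omega> 0)\<^sup>2))"
proof -
  have unit': "\<And>x. x \<in> M \<Longrightarrow> \<xi> x \<bullet> \<xi> x = 1" using unit by blast
  obtain A c where A: "linear A" "inj A" "\<And>a b. A a \<bullet> b = - (a \<bullet> A b)"
    and \<xi>: "\<And>x. x \<in> M \<Longrightarrow> \<xi> x = A (x - c)"
    by (rule killing_field_affine[OF dim hyp cpt conn ne kil unit'], assumption) (rule that; assumption)
  have M_eq: "M = {x. A (x - c) \<bullet> A (x - c) = 1}"
    by (rule killing_hypersurface_eq_ellipsoid[OF hyp cpt ne kil unit' A \<xi>])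
  from skew_normal_form[OF A subspace_UNIV subset_UNIV] obtain N u v \<omega> where N: "dim (UNIV :: 'a set) = 2 * N"
    and orth: "\<forall>k<N. \<forall>j<N. u k \<bullet> v j = 0 \<and> u k \<bullet> u j = (if k = j then 1 else 0) \<and> v k \<bullet> v j = (if k = j then 1 else 0)"
    and eig: "\<forall>k<N. u k \<in> UNIV \<and> v k \<in> UNIV \<and> \<omega> k \<noteq> 0 \<and> A (u k) = \<omega> k *\<^sub>R v k \<and> A (v k) = - \<omega> k *\<^sub>R u k"
    and repr: "\<forall>x\<in>UNIV. x = (\<Sum>k<N. (x \<bullet> u k) *\<^sub>R u k + (x \<bullet> v k) *\<^sub>R v k)"
    by (elim exE conjE) (rule that; assumption)
  have Ax: "A x = (\<Sum>k<N. \<omega> k *\<^sub>R ((x \<bullet> u k) *\<^sub>R v k - (x \<bullet> v k) *\<^sub>R u k))" for x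
  proof -
    have "A x = A (\<Sum>k<N. (x \<bullet> u k) *\<^sub>R u k + (x \<bullet> v k) *\<^sub>R v k)"
      using repr by (metis UNIV_I)
    also have "\<dots> = (\<Sum>k<N. A ((x \<bullet> u k) *\<^sub>R u k + (x \<bullet> v k) *\<^sub>R v k))"
      by (rule linear_sum[OF A(1)])
    also have "\<dots> = (\<Sum>k<N. \<omega> k *\<^sub>R ((x \<bullet> u k) *\<^sub>R v k - (x \<bullet> v k) *\<^sub>R u k))"
      by (rule sum.cong) (use eig in \<open>auto simp: linear_add[OF A(1)] linear_cmul[OF A(1)] algebra_simps\<close>)
    finally show ?thesis .
  qed
  have AxAx: "A x \<bullet> A x = (\<Sum>k<N. (\<omega> k)\<^sup>2 * ((x \<bullet> u k)\<^sup>2 + (x \<bullet> v k)\<^sup>2))" for x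
  proof -
    \<comment> \<open>Only the right factor is expanded; skewness then moves \<open>A\<close> in the
      left factor onto the frame vectors.\<close>
    have "A x \<bullet> A x = (\<Sum>k<N. \<omega> k * ((x \<bullet> u k) * (A x \<bullet> v k) - (x \<bullet> v k) * (A x \<bullet> u k)))"
      by (subst (2) Ax) (simp add: inner_sum_right inner_diff_right)
    also have "\<dots> = (\<Sum>k<N. (\<omega> k)\<^sup>2 * ((x \<bullet> u k)\<^sup>2 + (x \<bullet> v k)\<^sup>2))"
      by (rule sum.cong) (use eig in \<open>auto simp: A(3) power2_eq_square algebra_simps\<close>)
    finally show ?thesis .
  qed
  have shape: "(\<omega> k)\<^sup>2 = C\<^sup>2"
    if \<nu>: "unit_normal_field M \<nu>" and C: "\<forall>p\<in>M. shape_operator M \<nu> p (\<xi> p) \<bullet> \<xi> p = C" and k: "k < N"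
    for \<nu> C k
  proof -
    \<comment> \<open>The end of the axis in direction \<open>u k\<close>, where the normal vector
      \<open>A (A (p - c))\<close> has norm \<open>\<bar>\<omega> k\<bar>\<close>.\<close>
    define p where "p = c + (1 / \<omega> k) *\<^sub>R u k"
    have Ap: "A (p - c) = v k" using eig k by (simp add: p_def linear_cmul[OF A(1)])
    have pM: "p \<in> M" using orth k by (subst M_eq) (simp add: Ap)
    have AAp: "A (A (p - c)) = - \<omega> k *\<^sub>R u k" using eig k by (simp add: Ap)
    obtain n where tan: "tangent_space M p = {a. a \<bullet> n = 0}" by (rule tangent_space_orthogonal[OF hyp pM])
    have "a \<bullet> \<nu> p = 0" if "a \<bullet> n = 0" for a
      using \<nu> pM tan that unfolding unit_normal_field_def by (simp add: inner_commute)
    then obtain s where s: "\<nu> p = s *\<^sub>R n" by (rule parallel_if_orthogonal)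
    have "a \<bullet> A (A (p - c)) = 0" if "a \<bullet> n = 0" for a
      by (rule ellipsoid_normal[OF A(1,3) _ pM]) (use M_eq that tan in auto)
    then obtain t where t: "A (A (p - c)) = t *\<^sub>R n" by (rule parallel_if_orthogonal)
    have n1: "\<nu> p \<bullet> \<nu> p = 1" using \<nu> pM unfolding unit_normal_field_def by (simp add: norm_eq_1)
    have "C = \<nu> p \<bullet> A (A (p - c))"
      using shape_operator_killing[OF kil A(1) \<xi> \<nu> pM] C pM by simp
    \<comment> \<open>Equality in the Cauchy-Schwarz inequality, as both vectors are multiples of
      \<open>n\<close>; squaring removes the orientation of \<open>\<nu>\<close>.\<close>
    then have "C\<^sup>2 = (\<nu> p \<bullet> \<nu> p) * (A (A (p - c)) \<bullet> A (A (p - c)))"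
      unfolding s t by (simp add: power2_eq_square)
    then show ?thesis using n1 orth k by (simp add: AAp power2_eq_square)
  qed
  have diffeo: "diffeomorphic M (sphere (0::'a) 1)" unfolding M_eq by (rule diffeomorphic_ellipsoid_sphere[OF A(1,2)])
  have M_sum: "M = {x. (\<Sum>k<N. (\<omega> k)\<^sup>2 * (((x - c) \<bullet> u k)\<^sup>2 + ((x - c) \<bullet> v k)\<^sup>2)) = 1}"
    using M_eq AxAx by simp
  have \<xi>_sum: "\<forall>x\<in>M. \<xi> x = (\<Sum>k<N. \<omega> k *\<^sub>R (((x - c) \<bullet> u k) *\<^sub>R v k - ((x - c) \<bullet> v k) *\<^sub>R u k))"
    using \<xi> Ax by simp
  have round: "\<forall>\<nu>. unit_normal_field M \<nu> \<and> (\<exists>C. \<forall>p\<in>M. shape_operator M \<nu> p (\<xi> p) \<bullet> \<xi> p = C)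
        \<longrightarrow> (\<forall>k<N. (\<omega> k)\<^sup>2 = (\<omega> 0)\<^sup>2)"
  proof (intro allI impI)
    fix \<nu> k
    assume "unit_normal_field M \<nu> \<and> (\<exists>C. \<forall>p\<in>M. shape_operator M \<nu> p (\<xi> p) \<bullet> \<xi> p = C)" and k: "k < N"
    then obtain C where "unit_normal_field M \<nu>" "\<forall>p\<in>M. shape_operator M \<nu> p (\<xi> p) \<bullet> \<xi> p = C" by blast
    from shape[OF this k] shape[OF this, of 0] k show "(\<omega> k)\<^sup>2 = (\<omega> 0)\<^sup>2" by simp
  qed
  have \<omega>: "\<forall>k<N. \<omega> k \<noteq> 0" using eig by blast
  have dimN: "DIM('a) = 2 * N" using N by simp
  show ?thesis
    by (rule exI[of _ N], rule exI[of _ c], rule exI[of _ u], rule exI[of _ v], rule exI[of _ \<omega>])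
      (intro conjI dimN diffeo orth \<omega> M_sum \<xi>_sum round)
qed

end
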